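(* Assume that there are $\alpha_i\in\mathbb R$ and $\beta_i\ge 0$ $(i\in\mathbf S)$ such that, for each $i\in\mathbf S$ and all $\xi,\eta\in\mathscr C$, $$2\langle \xi(0)-\eta(0),\,b(\xi,i)-b(\eta,i)\rangle\le \alpha_i|\xi(0)-\eta(0)|^2+\beta_i\|\xi-\eta\|_\infty^2,$$ that there is $L_0>0$ with $|b(\xi,i)-b(\eta,i)|\le L_0\|\xi-\eta\|_\infty$ for all $\xi,\eta\in\mathscr C$, $i\in\mathbf S$, and that $\eta_1>0$, where, with $\hat\alpha:=\min_{i\in\mathbf S}\alpha_i$ and $Q_1:=Q+\mathrm{diag}\big(\alpha_1+e^{-\hat\alpha\tau}\beta_1,\dots,\alpha_N+e^{-\hat\alpha\tau}\beta_N\big)$, $\eta_1:=-\max_{\gamma\in\mathrm{spec}(Q_1)}\mathrm{Re}(\gamma)$. Then there exist $\delta_0\in(0,1)$, $\alpha>0$ and $c>0$ such that for every integer $k\ge0$, every step size $\delta\in(0,\delta_0)$ and all $\nu_1,\nu_2\in\mathcal P_0$, $$W_\rho(\nu_1P^{(\delta)}_{k\delta},\nu_2P^{(\delta)}_{k\delta})\le c\Big(1+\sum_{i\in\mathbf S}\int_{\mathscr C}\|\xi\|_\infty\,\nu_1(d\xi,i)+\sum_{i\in\mathbf S}\int_{\mathscr C}\|\eta\|_\infty\,\nu_2(d\eta,i)\Big)e^{-\alpha k\delta}.$$ Furthermore, for such $\delta$, $(Y_{k\delta}(\xi,i),\Lambda^i(k\delta))$ admits a unique invariant probability measure $\mu^{(\delta)}\in\mathcal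 P_0$ (i.e. $\mu^{(\delta)}P^{(\delta)}_{k\delta}=\mu^{(\delta)}$ for all $k\ge0$), and for all $(\xi,i)\in\mathscr C\times\mathbf S$ and $k\ge0$, $$W_\rho(\delta_{(\xi,i)}P^{(\delta)}_{k\delta},\mu^{(\delta)}P^{(\delta)}_{k\delta})\le c\Big(1+\|\xi\|_\infty+\sum_{j\in\mathbf S}\int_{\mathscr C}\|\eta\|_\infty\,\mu^{(\delta)}(d\eta,j)\Big)e^{-\alpha k\delta},$$ where $\delta_{(\xi,i)}$ is the Dirac measure at $(\xi,i)$.
   Context: Fix $\tau>0$ and let $\mathscr C=C([-\tau,0];\mathbb R^n)$ with $\|f\|_\infty=\sup_{-\tau\le\vartheta\le0}|f(\vartheta)|$. Let $\mathbf S=\{1,\dots,N\}$, $2\le N<\infty$. $(\Lambda(t))_{t\ge0}$ is an irreducible right-continuous continuous-time Markov chain on $\mathbf S$ with $Q$-matrix $Q=(q_{ij})$, i.e. $\mathbb P(\Lambda(t+h)=j\mid\Lambda(t)=i)=q_{ij}h+o(h)$ for $j\ne i$ and $=1+q_{ii}h+o(h)$ for $j=i$, as $h\downarrow0$. $(W(t))$ is an $m$-dimensional Brownian motion independent of $(\Lambda(t))$. $\Lambda^i$ denotes the chain started from $i$. Let $b:\mathscr C\times\mathbf S\to\mathbb R^n$ and $\sigma:\mathbf S\to\mathbb R^n\otimes\mathbb R^m$. Euler–Maruyama scheme: step sizes are always of the form $\delta=\tau/M\in(0,1)$ with $M>\tau$ an integer, and $t_\delta:=\lfloor t/\delta\rfloor\delta$.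 The process $Y$ is defined by $$dY(t)=b(Y_{t_\delta},\Lambda(t_\delta))\,dt+\sigma(\Lambda(t_\delta))\,dW(t),\quad t>0,\qquad Y(\vartheta)=\xi(\vartheta)\ (\vartheta\in[-\tau,0]),\ \Lambda(0)=i,$$ where $Y_{k\delta}$ is the $\mathscr C$-valued random variable obtained by linear interpolation of $Y((k-M)\delta),\dots,Y((k-1)\delta),Y(k\delta)$: for $\vartheta\in[l\delta,(l+1)\delta]$, $l=-M,\dots,-1$, $$Y_{k\delta}(\vartheta)=Y((k+l)\delta)+\frac{\vartheta-l\delta}{\delta}\{Y((k+l+1)\delta)-Y((k+l)\delta)\}.$$ To display the initial data one writes $Y_{k\delta}(\xi,i)$. $P^{(\delta)}_{k\delta}((\xi,i),\cdot)$ is the law of $(Y_{k\delta}(\xi,i),\Lambda^i(k\delta))$ and $\nu P^{(\delta)}_{k\delta}=\int P^{(\delta)}_{k\delta}(\mathbf x,\cdot)\,\nu(d\mathbf x)$. Let $\mathbf E=\mathscr C\times\mathbf S$ with distance $\rho((\xi,i),(\eta,j))=\|\xi-\eta\|_\infty+\mathbf 1_{\{i\ne j\}}$, let $\mathcal P$ be the set of probability measures on $\mathbf E$, and $\mathcal P_0=\{\nu\in\mathcal P:\sum_{i\in\mathbf S}\int_{\mathscr C}\|\xi\|_\infty\nu(d\xi,i)<\infty\}$. For $\mu,\nu\in\mathcal P_0$, $W_\rho(\mu,\nu)=\inf_{\pi}\int_{\mathbf E\times\mathbf E}\rho(\mathbf x,\mathbf y)\,\pi(d\mathbf x,d\mathbf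 y)$, the infimum over couplings $\pi$ of $\mu$ and $\nu$. $\mathrm{spec}(\cdot)$ is the set of (complex) eigenvalues of a matrix. *)

theory Defs
  imports "HOL-Probability.Probability"
begin

section \<open>The path space\<close>

text \<open>
  The space \<open>C([-\<tau>,0]; R^n)\<close> is represented by its isometric copy inside the library type of
  bounded continuous functions on the whole line: a continuous function on \<open>[-\<tau>,0]\<close> is extended
  to be constant to the left of \<open>-\<tau>\<close> and to the right of \<open>0\<close>.  The lemmas
  \<open>seg_space_ex1\<close> and \<open>norm_seg_space\<close> show that this is a bijection onto \<open>C([-\<tau>,0]; R^n)\<close>
  carrying \<open>norm\<close> to the supremum norm over \<open>[-\<tau>,0]\<close>.
\<close>

definition seg_space :: "real \<Rightarrow> (real \<Rightarrow>\<^sub>C (real ^ 'n)) set" where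
  "seg_space \<tau> = {\<xi>. \<forall>\<theta>. apply_bcontfun \<xi> \<theta> = apply_bcontfun \<xi> (max (-\<tau>) (min 0 \<theta>))}"

lemma bcontfun_clampI:
  fixes g :: "real \<Rightarrow> real ^ 'n"
  assumes "\<tau> > 0" and "continuous_on {-\<tau>..0} g"
  shows "(\<lambda>\<theta>. g (max (-\<tau>) (min 0 \<theta>))) \<in> bcontfun"
proof -
  have im: "(\<lambda>\<theta>. max (-\<tau>) (min 0 \<theta>)) ` UNIV \<subseteq> {-\<tau>..0}"
    using assms(1) by auto
  have "continuous_on UNIV (\<lambda>\<theta>. g (max (-\<tau>) (min 0 \<theta>)))"
    by (rule continuous_on_compose2[OF assms(2) _ im]) (intro continuous_intros)
  moreover have "bounded (g ` {-\<tau>..0})"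
    by (intro compact_imp_bounded compact_continuous_image assms(2)) auto
  then have "bounded (range (\<lambda>\<theta>. g (max (-\<tau>) (min 0 \<theta>))))"
    by (rule bounded_subset) (use assms(1) in auto)
  ultimately show ?thesis
    by (auto simp: bcontfun_def)
qed

lemma seg_space_ex1:
  fixes g :: "real \<Rightarrow> real ^ 'n"
  assumes "\<tau> > 0" and "continuous_on {-\<tau>..0} g"
  shows "\<exists>!\<xi>. \<xi> \<in> seg_space \<tau> \<and> (\<forall>\<theta>\<in>{-\<tau>..0}. apply_bcontfun \<xi> \<theta> = g \<theta>)"
proof (rule ex1I)
  let ?\<xi> = "Bcontfun (\<lambda>\<theta>. g (max (-\<tau>) (min 0 \<theta>)))"
  have eq: "apply_bcontfun ?\<xi> = (\<lambda>\<theta>. g (max (-\<tau>) (min 0 \<theta>)))"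
    by (rule Bcontfun_inverse[OF bcontfun_clampI[OF assms]])
  show "?\<xi> \<in> seg_space \<tau> \<and> (\<forall>\<theta>\<in>{-\<tau>..0}. apply_bcontfun ?\<xi> \<theta> = g \<theta>)"
    using assms(1) by (auto simp: seg_space_def eq)
next
  fix \<zeta> :: "real \<Rightarrow>\<^sub>C (real ^ 'n)"
  assume z: "\<zeta> \<in> seg_space \<tau> \<and> (\<forall>\<theta>\<in>{-\<tau>..0}. apply_bcontfun \<zeta> \<theta> = g \<theta>)"
  show "\<zeta> = Bcontfun (\<lambda>\<theta>. g (max (-\<tau>) (min 0 \<theta>)))"
  proof (rule bcontfun_eqI)
    fix \<theta>
    have "apply_bcontfun \<zeta> \<theta> = apply_bcontfun \<zeta> (max (-\<tau>) (min 0 \<theta>))"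
      using z unfolding seg_space_def by blast
    also have "\<dots> = g (max (-\<tau>) (min 0 \<theta>))"
      using z assms(1) by auto
    finally show "apply_bcontfun \<zeta> \<theta>
        = apply_bcontfun (Bcontfun (\<lambda>\<theta>. g (max (-\<tau>) (min 0 \<theta>)))) \<theta>"
      by (simp add: Bcontfun_inverse[OF bcontfun_clampI[OF assms]])
  qed
qed

lemma norm_seg_space:
  fixes \<xi> :: "real \<Rightarrow>\<^sub>C (real ^ 'n)"
  assumes "\<tau> > 0" and "\<xi> \<in> seg_space \<tau>"
  shows "norm \<xi> = (SUP \<theta>\<in>{-\<tau>..0}. norm (apply_bcontfun \<xi> \<theta>))"
proof (rule antisym)
  have bdd: "bdd_above ((\<lambda>\<theta>. norm (apply_bcontfun \<xi> \<theta>)) ` {-\<tau>..0})"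
    by (auto intro!: bdd_aboveI2 norm_bounded)
  show "norm \<xi> \<le> (SUP \<theta>\<in>{-\<tau>..0}. norm (apply_bcontfun \<xi> \<theta>))"
  proof (rule norm_bound)
    fix \<theta>
    have "apply_bcontfun \<xi> \<theta> = apply_bcontfun \<xi> (max (-\<tau>) (min 0 \<theta>))"
      using assms(2) unfolding seg_space_def by blast
    then show "norm (apply_bcontfun \<xi> \<theta>) \<le> (SUP \<theta>\<in>{-\<tau>..0}. norm (apply_bcontfun \<xi> \<theta>))"
      using assms(1) by (auto intro!: cSUP_upper[OF _ bdd])
  qed
  show "(SUP \<theta>\<in>{-\<tau>..0}. norm (apply_bcontfun \<xi> \<theta>)) \<le> norm \<xi>"
    using assms(1) by (intro cSUP_least norm_bounded) auto
qed


section \<open>The Markov chain and the Brownian motion\<close>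

definition q_matrix :: "real ^ 's ^ 's \<Rightarrow> bool" where
  "q_matrix Q \<longleftrightarrow> (\<forall>i j. i \<noteq> j \<longrightarrow> 0 \<le> Q $ i $ j) \<and> (\<forall>i. (\<Sum>j\<in>UNIV. Q $ i $ j) = 0)"

text \<open>\<open>p h i j\<close> is the probability to be in \<open>j\<close> after time \<open>h\<close> when being in \<open>i\<close> now; the function
  \<open>a\<close> together with the finite set \<open>T\<close> prescribes the states at finitely many past times.\<close>

definition markov_chain ::
    "'w measure \<Rightarrow> (real \<Rightarrow> 's \<Rightarrow> 's \<Rightarrow> real) \<Rightarrow> (real \<Rightarrow> 'w \<Rightarrow> 's) \<Rightarrow> bool" where
  "markov_chain \<Omega> p X \<longleftrightarrow>
     (\<forall>t\<ge>0. X t \<in> measurable \<Omega> (count_space UNIV)) \<and>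
     (AE \<omega> in \<Omega>. \<forall>t\<ge>0. eventually (\<lambda>s. X s \<omega> = X t \<omega>) (at_right t)) \<and>
     (\<forall>t h i j T a. 0 \<le> t \<and> 0 \<le> h \<and> finite T \<and> T \<subseteq> {0..<t} \<and>
        0 < \<P>(\<omega> in \<Omega>. X t \<omega> = i \<and> (\<forall>s\<in>T. X s \<omega> = a s)) \<longrightarrow>
        \<P>(\<omega> in \<Omega>. X (t + h) \<omega> = j \<bar> X t \<omega> = i \<and> (\<forall>s\<in>T. X s \<omega> = a s)) = p h i j)"

definition markov_chain_family ::
    "'w measure \<Rightarrow> real ^ 's ^ 's \<Rightarrow> ('s \<Rightarrow> real \<Rightarrow> 'w \<Rightarrow> 's) \<Rightarrow> bool" where
  "markov_chain_family \<Omega> Q \<Lambda> \<longleftrightarrow> q_matrix Q \<and>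
     (\<exists>p. (\<forall>i j. ((\<lambda>h. (p h i j - (if i = j then 1 else 0)) / h) \<longlongrightarrow> Q $ i $ j) (at_right 0)) \<and>
          (\<forall>i. markov_chain \<Omega> p (\<Lambda> i) \<and> (AE \<omega> in \<Omega>. \<Lambda> i 0 \<omega> = i)))"

definition irreducible_chain :: "'w measure \<Rightarrow> ('s \<Rightarrow> real \<Rightarrow> 'w \<Rightarrow> 's) \<Rightarrow> bool" where
  "irreducible_chain \<Omega> \<Lambda> \<longleftrightarrow> (\<forall>i j. \<exists>t\<ge>0. 0 < \<P>(\<omega> in \<Omega>. \<Lambda> i t \<omega> = j))"

definition brownian_motion :: "'w measure \<Rightarrow> (real \<Rightarrow> 'w \<Rightarrow> real ^ 'm) \<Rightarrow> bool" where
  "brownian_motion \<Omega> W \<longleftrightarrow>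
     (\<forall>t\<ge>0. W t \<in> borel_measurable \<Omega>) \<and>
     (AE \<omega> in \<Omega>. W 0 \<omega> = 0 \<and> continuous_on {0..} (\<lambda>t. W t \<omega>)) \<and>
     (\<forall>s t l. 0 \<le> s \<and> s < t \<longrightarrow>
        distributed \<Omega> lborel (\<lambda>\<omega>. (W t \<omega> - W s \<omega>) $ l) (normal_density 0 (sqrt (t - s)))) \<and>
     (\<forall>(t :: nat \<Rightarrow> real) r. 0 \<le> t 0 \<and> strict_mono t \<longrightarrow>
        prob_space.indep_vars \<Omega> (\<lambda>_. borel) (\<lambda>(q, l) \<omega>. (W (t (Suc q)) \<omega> - W (t q) \<omega>) $ l)
          ({..<r} \<times> UNIV))"

definition indep_processes ::
    "'w measure \<Rightarrow> 'x measure \<Rightarrow> (real \<Rightarrow> 'w \<Rightarrow> 'x) \<Rightarrow> 'y measure \<Rightarrow> (real \<Rightarrow> 'w \<Rightarrow> 'y) \<Rightarrow> bool" where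
  "indep_processes \<Omega> M X N Z \<longleftrightarrow>
     prob_space.indep_set \<Omega>
       (sets (vimage_algebra (space \<Omega>) (\<lambda>\<omega>. \<lambda>t\<in>{0..}. X t \<omega>) (PiM {0..} (\<lambda>_. M))))
       (sets (vimage_algebra (space \<Omega>) (\<lambda>\<omega>. \<lambda>t\<in>{0..}. Z t \<omega>) (PiM {0..} (\<lambda>_. N))))"


section \<open>The Euler--Maruyama scheme\<close>

definition step_sizes :: "real \<Rightarrow> real set" where
  "step_sizes \<tau> = {\<tau> / real M | M :: nat. \<tau> < real M}"

text \<open>The linear interpolation \<open>Y\<^bsub>k\<delta>\<^esub>\<close>; see lemma \<open>em_segment_apply\<close> for the usual formula.  The
  minimum with \<open>-1\<close> puts the right end point \<open>0\<close> into the last interval \<open>[-\<delta>,0]\<close>.\<close>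

definition em_segment :: "real \<Rightarrow> real \<Rightarrow> (real \<Rightarrow> real ^ 'n) \<Rightarrow> nat \<Rightarrow> (real \<Rightarrow>\<^sub>C (real ^ 'n))" where
  "em_segment \<tau> \<delta> y k = Bcontfun (\<lambda>\<theta>.
     let s = max (-\<tau>) (min 0 \<theta>); l = min (-1) \<lfloor>s / \<delta>\<rfloor> in
       y ((real k + of_int l) * \<delta>)
       + ((s - of_int l * \<delta>) / \<delta>)
           *\<^sub>R (y ((real k + of_int l + 1) * \<delta>) - y ((real k + of_int l) * \<delta>)))"

text \<open>The scheme is a functional of the driving path \<open>w\<close>, the path \<open>\<kappa>\<close> of the chain and the initial
  segment \<open>\<xi>\<close>.  On \<open>(k\<delta>,(k+1)\<delta>]\<close> both integrands are frozen at time \<open>k\<delta>\<close>, so the Lebesgue integral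
  is a multiple of the time increment and the Ito integral (of a simple integrand) is
  the diffusion matrix applied to the increment of \<open>w\<close>.  \<open>em_upto k\<close> is the solution on
  \<open>[-\<tau>,k\<delta>]\<close>.\<close>

primrec em_upto :: "real \<Rightarrow> real \<Rightarrow> ((real \<Rightarrow>\<^sub>C (real ^ 'n)) \<Rightarrow> 's \<Rightarrow> real ^ 'n) \<Rightarrow>
    ('s \<Rightarrow> real ^ 'm ^ 'n) \<Rightarrow> (real \<Rightarrow> real ^ 'm) \<Rightarrow> (real \<Rightarrow> 's) \<Rightarrow> (real \<Rightarrow>\<^sub>C (real ^ 'n)) \<Rightarrow>
    nat \<Rightarrow> real \<Rightarrow> real ^ 'n" where
  "em_upto \<tau> \<delta> b \<sigma> w \<kappa> \<xi> 0 = apply_bcontfun \<xi>"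
| "em_upto \<tau> \<delta> b \<sigma> w \<kappa> \<xi> (Suc k) =
     (let y = em_upto \<tau> \<delta> b \<sigma> w \<kappa> \<xi> k; s = real k * \<delta> in
       (\<lambda>t. if t \<le> s then y t
            else y s + (t - s) *\<^sub>R b (em_segment \<tau> \<delta> y k) (\<kappa> s) + \<sigma> (\<kappa> s) *v (w t - w s)))"

definition em_process :: "real \<Rightarrow> real \<Rightarrow> ((real \<Rightarrow>\<^sub>C (real ^ 'n)) \<Rightarrow> 's \<Rightarrow> real ^ 'n) \<Rightarrow>
    ('s \<Rightarrow> real ^ 'm ^ 'n) \<Rightarrow> (real \<Rightarrow> real ^ 'm) \<Rightarrow> (real \<Rightarrow> 's) \<Rightarrow> (real \<Rightarrow>\<^sub>C (real ^ 'n)) \<Rightarrow>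
    real \<Rightarrow> real ^ 'n" where
  "em_process \<tau> \<delta> b \<sigma> w \<kappa> \<xi> t = em_upto \<tau> \<delta> b \<sigma> w \<kappa> \<xi> (nat \<lceil>t / \<delta>\<rceil>) t"

lemma em_segment_raw:
  fixes y :: "real \<Rightarrow> real ^ 'n" and M k :: nat
  assumes "\<tau> > 0" and M: "\<tau> < real M" "\<delta> = \<tau> / real M"
  defines "g \<equiv> \<lambda>l s. y ((real k + of_int l) * \<delta>)
       + ((s - of_int l * \<delta>) / \<delta>)
           *\<^sub>R (y ((real k + of_int l + 1) * \<delta>) - y ((real k + of_int l) * \<delta>))"
  shows "l \<in> {- int M..-1} \<Longrightarrow> s \<in> {of_int l * \<delta>..(of_int l + 1) * \<delta>} \<Longrightarrow>
           g (min (-1) \<lfloor>s / \<delta>\<rfloor>) s = g l s"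
    and "continuous_on {-\<tau>..0} (\<lambda>s. g (min (-1) \<lfloor>s / \<delta>\<rfloor>) s)"
proof -
  have d: "\<delta> > 0" using assms(1) M by simp
  have Md: "real M * \<delta> = \<tau>" using assms(1) M by simp
  show *: "g (min (-1) \<lfloor>s / \<delta>\<rfloor>) s = g l s"
    if l: "l \<in> {- int M..-1}" and s: "s \<in> {of_int l * \<delta>..(of_int l + 1) * \<delta>}" for l :: int and s
  proof (cases "s = (of_int l + 1) * \<delta>")
    case False
    then have "of_int l \<le> s / \<delta>" "s / \<delta> < of_int l + 1"
      using s d by (auto simp: field_simps)
    then have "\<lfloor>s / \<delta>\<rfloor> = l" by (simp add: floor_unique)
    then show ?thesis using l by simp
  next
    case True
    then have fl: "\<lfloor>s / \<delta>\<rfloor> = l + 1" using d by (simp add: floor_unique)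
    have gl: "g l s = y ((real k + of_int l + 1) * \<delta>)"
      using d True by (simp add: g_def field_simps)
    show ?thesis
    proof (cases "l = -1")
      case True
      then show ?thesis using fl by simp
    next
      case False
      then have "min (-1) \<lfloor>s / \<delta>\<rfloor> = l + 1" using fl l by simp
      moreover have "g (l + 1) s = y ((real k + of_int l + 1) * \<delta>)"
        using True by (simp add: g_def algebra_simps)
      ultimately show ?thesis using gl by simp
    qed
  qed
  let ?I = "\<lambda>l::int. {of_int l * \<delta>..(of_int l + 1) * \<delta>}"
  have cover: "{-\<tau>..0} = (\<Union>l\<in>{- int M..-1}. ?I l)"
  proof (intro subset_antisym subsetI)
    fix s assume s: "s \<in> {-\<tau>..0}"
    define l where "l = min (-1) \<lfloor>s / \<delta>\<rfloor>"
    have "- real M \<le> s / \<delta>" "s / \<delta> \<le> 0"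
      using s d Md by (auto simp: field_simps)
    then have "- int M \<le> \<lfloor>s / \<delta>\<rfloor>" by (simp add: le_floor_iff)
    moreover have "int M \<ge> 1" using M(1) assms(1) by linarith
    ultimately have "l \<in> {- int M..-1}" by (auto simp: l_def)
    moreover have "of_int l \<le> s / \<delta>" "s / \<delta> \<le> of_int l + 1"
      using \<open>s / \<delta> \<le> 0\<close> by (auto simp: l_def min_def) linarith+
    then have "s \<in> ?I l" using d by (auto simp: field_simps)
    ultimately show "s \<in> (\<Union>l\<in>{- int M..-1}. ?I l)" by blast
  next
    fix s assume "s \<in> (\<Union>l\<in>{- int M..-1}. ?I l)"
    then obtain l :: int where l: "- int M \<le> l" "l \<le> -1" "s \<in> ?I l" by auto
    have "- real M \<le> of_int l" "(of_int l :: real) + 1 \<le> 0" using l(1,2) by linarith+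
    have "- real M * \<delta> \<le> of_int l * \<delta>"
      using \<open>- real M \<le> of_int l\<close> d by (intro mult_right_mono) auto
    moreover have "(of_int l + 1) * \<delta> \<le> 0"
      using \<open>(of_int l :: real) + 1 \<le> 0\<close> d by (simp add: mult_le_0_iff)
    ultimately have "- real M * \<delta> \<le> of_int l * \<delta>" "(of_int l + 1) * \<delta> \<le> 0"
      by auto
    then show "s \<in> {-\<tau>..0}" using l(3) Md by simp
  qed
  show "continuous_on {-\<tau>..0} (\<lambda>s. g (min (-1) \<lfloor>s / \<delta>\<rfloor>) s)"
    unfolding cover
  proof (rule continuous_on_closed_Union)
    fix l :: int assume l: "l \<in> {- int M..-1}"
    have "continuous_on (?I l) (g l)"
      unfolding g_def by (intro continuous_intros) (use d in auto)
    then show "continuous_on (?I l) (\<lambda>s. g (min (-1) \<lfloor>s / \<delta>\<rfloor>) s)"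
      by (rule continuous_on_eq) (use *[OF l] in auto)
  qed auto
qed

lemma em_segment_apply_clamp:
  fixes y :: "real \<Rightarrow> real ^ 'n"
  assumes "\<tau> > 0" and "\<delta> \<in> step_sizes \<tau>"
  shows "apply_bcontfun (em_segment \<tau> \<delta> y k) = (\<lambda>\<theta>.
     let s = max (-\<tau>) (min 0 \<theta>); l = min (-1) \<lfloor>s / \<delta>\<rfloor> in
       y ((real k + of_int l) * \<delta>)
       + ((s - of_int l * \<delta>) / \<delta>)
           *\<^sub>R (y ((real k + of_int l + 1) * \<delta>) - y ((real k + of_int l) * \<delta>)))"
proof -
  obtain M :: nat where M: "\<tau> < real M" "\<delta> = \<tau> / real M"
    using assms(2) by (auto simp: step_sizes_def)
  show ?thesis
    unfolding em_segment_def Let_def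
    by (rule Bcontfun_inverse[OF bcontfun_clampI[OF assms(1) em_segment_raw(2)[OF assms(1) M]]])
qed

lemma em_segment_in_seg_space:
  fixes y :: "real \<Rightarrow> real ^ 'n"
  assumes "\<tau> > 0" and "\<delta> \<in> step_sizes \<tau>"
  shows "em_segment \<tau> \<delta> y k \<in> seg_space \<tau>"
  using assms(1) by (simp add: seg_space_def em_segment_apply_clamp[OF assms] Let_def)

lemma em_segment_apply:
  fixes y :: "real \<Rightarrow> real ^ 'n" and M :: nat and l :: int
  assumes "\<tau> > 0" and M: "\<tau> < real M" "\<delta> = \<tau> / real M"
    and l: "l \<in> {- int M..-1}" and \<theta>: "\<theta> \<in> {of_int l * \<delta>..(of_int l + 1) * \<delta>}"
  shows "apply_bcontfun (em_segment \<tau> \<delta> y k) \<theta> =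
       y ((real k + of_int l) * \<delta>)
       + ((\<theta> - of_int l * \<delta>) / \<delta>)
           *\<^sub>R (y ((real k + of_int l + 1) * \<delta>) - y ((real k + of_int l) * \<delta>))"
proof -
  have step: "\<delta> \<in> step_sizes \<tau>" using M by (auto simp: step_sizes_def)
  have d: "\<delta> > 0" and Md: "real M * \<delta> = \<tau>" using assms(1) M by simp_all
  have "- real M \<le> of_int l" "(of_int l :: real) + 1 \<le> 0" using l by auto
  have "- real M * \<delta> \<le> of_int l * \<delta>"
    using \<open>- real M \<le> of_int l\<close> d by (intro mult_right_mono) auto
  moreover have "(of_int l + 1) * \<delta> \<le> 0"
    using \<open>(of_int l :: real) + 1 \<le> 0\<close> d by (simp add: mult_le_0_iff)
  ultimately have "- real M * \<delta> \<le> of_int l * \<delta>" "(of_int l + 1) * \<delta> \<le> 0"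
    by auto
  then have clamp: "max (-\<tau>) (min 0 \<theta>) = \<theta>" using \<theta> Md by simp
  show ?thesis
    unfolding em_segment_apply_clamp[OF assms(1) step] Let_def clamp
    by (rule em_segment_raw(1)[OF assms(1) M l \<theta>])
qed

lemma em_segment_cong:
  assumes "\<delta> > 0" and "\<And>t. t \<le> real k * \<delta> \<Longrightarrow> y t = z t"
  shows "em_segment \<tau> \<delta> y k = em_segment \<tau> \<delta> z k"
proof -
  have "y ((real k + of_int (min (-1) r)) * \<delta>) = z ((real k + of_int (min (-1) r)) * \<delta>)"
       "y ((real k + of_int (min (-1) r) + 1) * \<delta>) = z ((real k + of_int (min (-1) r) + 1) * \<delta>)"
    for r :: int
  proof -
    have "(of_int (min (-1) r) :: real) \<le> -1" by (simp add: min_def)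
    then show "y ((real k + of_int (min (-1) r)) * \<delta>) = z ((real k + of_int (min (-1) r)) * \<delta>)"
       "y ((real k + of_int (min (-1) r) + 1) * \<delta>) = z ((real k + of_int (min (-1) r) + 1) * \<delta>)"
      using assms(1) by (auto intro!: assms(2) mult_right_mono)
  qed
  then show ?thesis by (simp only: em_segment_def Let_def)
qed

lemma em_upto_mono:
  assumes "\<delta> > 0" and "k \<le> j" and "t \<le> real k * \<delta>"
  shows "em_upto \<tau> \<delta> b \<sigma> w \<kappa> \<xi> j t = em_upto \<tau> \<delta> b \<sigma> w \<kappa> \<xi> k t"
  using assms(2)
proof (induction j rule: dec_induct)
  case (step j)
  have "real k * \<delta> \<le> real j * \<delta>" using step.hyps assms(1) by simp
  then show ?case using assms(3) step.IH by (simp add: Let_def)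
qed simp

lemma em_process_eq_em_upto:
  assumes "\<delta> > 0" and "t \<le> real k * \<delta>"
  shows "em_process \<tau> \<delta> b \<sigma> w \<kappa> \<xi> t = em_upto \<tau> \<delta> b \<sigma> w \<kappa> \<xi> k t"
proof -
  have "t / \<delta> \<le> real k" using assms by (simp add: field_simps)
  then have "\<lceil>t / \<delta>\<rceil> \<le> int k" by linarith
  then have "nat \<lceil>t / \<delta>\<rceil> \<le> k" by linarith
  moreover have "t / \<delta> \<le> real (nat \<lceil>t / \<delta>\<rceil>)" by linarith
  then have "t \<le> real (nat \<lceil>t / \<delta>\<rceil>) * \<delta>" using assms(1) by (simp add: field_simps)
  ultimately show ?thesis
    unfolding em_process_def using em_upto_mono[OF assms(1)] by metis
qed

lemma em_process_initial:
  assumes "\<delta> > 0" and "t \<le> 0"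
  shows "em_process \<tau> \<delta> b \<sigma> w \<kappa> \<xi> t = apply_bcontfun \<xi> t"
  using em_process_eq_em_upto[OF assms(1), of t 0] assms(2) by simp

text \<open>The defining equation of the scheme on each interval \<open>[k\<delta>,(k+1)\<delta>]\<close>.\<close>

lemma em_process_step:
  fixes \<tau> :: real and b :: "(real \<Rightarrow>\<^sub>C (real ^ 'n)) \<Rightarrow> 's \<Rightarrow> real ^ 'n"
    and \<sigma> :: "'s \<Rightarrow> real ^ 'm ^ 'n" and w :: "real \<Rightarrow> real ^ 'm" and \<kappa> :: "real \<Rightarrow> 's"
    and \<xi> :: "real \<Rightarrow>\<^sub>C (real ^ 'n)" and k :: nat
  assumes "\<delta> > 0" and "t \<in> {real k * \<delta>..real (Suc k) * \<delta>}"
  defines "Y \<equiv> em_process \<tau> \<delta> b \<sigma> w \<kappa> \<xi>" and "s \<equiv> real k * \<delta>"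
  shows "Y t = Y s + (t - s) *\<^sub>R b (em_segment \<tau> \<delta> Y k) (\<kappa> s) + \<sigma> (\<kappa> s) *v (w t - w s)"
proof (cases "t = s")
  case True
  then show ?thesis by simp
next
  case False
  let ?y = "em_upto \<tau> \<delta> b \<sigma> w \<kappa> \<xi> k"
  have seg: "em_segment \<tau> \<delta> Y k = em_segment \<tau> \<delta> ?y k"
    unfolding Y_def by (intro em_segment_cong em_process_eq_em_upto assms(1)) auto
  have "Y t = em_upto \<tau> \<delta> b \<sigma> w \<kappa> \<xi> (Suc k) t"
    unfolding Y_def using assms(2) by (intro em_process_eq_em_upto assms(1)) auto
  moreover have "Y s = ?y s"
    unfolding Y_def by (intro em_process_eq_em_upto assms(1)) (simp add: s_def)
  moreover have "\<not> t \<le> s" using False assms(2) by (simp add: s_def)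
  ultimately show ?thesis
    unfolding seg by (simp add: Let_def s_def[symmetric])
qed


section \<open>State space, transition laws and Wasserstein distance\<close>

text \<open>The \<open>\<sigma>\<close>-algebra is the product of the Borel \<open>\<sigma>\<close>-algebra of the (separable) path space and the
  power set of the finite set of states, which is the Borel \<open>\<sigma>\<close>-algebra of \<open>state_dist\<close>.\<close>

definition state_space :: "real \<Rightarrow> ((real \<Rightarrow>\<^sub>C (real ^ 'n)) \<times> 's) measure" where
  "state_space \<tau> = restrict_space borel (seg_space \<tau>) \<Otimes>\<^sub>M count_space UNIV"

definition state_dist ::
    "(real \<Rightarrow>\<^sub>C (real ^ 'n)) \<times> 's \<Rightarrow> (real \<Rightarrow>\<^sub>C (real ^ 'n)) \<times> 's \<Rightarrow> real" where
  "state_dist x y = norm (fst x - fst y) + (if snd x \<noteq> snd y then 1 else 0)"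

definition em_law :: "'w measure \<Rightarrow> (real \<Rightarrow> 'w \<Rightarrow> real ^ 'm) \<Rightarrow> ('s \<Rightarrow> real \<Rightarrow> 'w \<Rightarrow> 's) \<Rightarrow> real \<Rightarrow>
    ((real \<Rightarrow>\<^sub>C (real ^ 'n)) \<Rightarrow> 's \<Rightarrow> real ^ 'n) \<Rightarrow> ('s \<Rightarrow> real ^ 'm ^ 'n) \<Rightarrow> real \<Rightarrow> nat \<Rightarrow>
    (real \<Rightarrow>\<^sub>C (real ^ 'n)) \<times> 's \<Rightarrow> ((real \<Rightarrow>\<^sub>C (real ^ 'n)) \<times> 's) measure" where
  "em_law \<Omega> W \<Lambda> \<tau> b \<sigma> \<delta> k = (\<lambda>(\<xi>, i). distr \<Omega> (state_space \<tau>) (\<lambda>\<omega>.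
     (em_segment \<tau> \<delta> (em_process \<tau> \<delta> b \<sigma> (\<lambda>t. W t \<omega>) (\<lambda>t. \<Lambda> i t \<omega>) \<xi>) k,
      \<Lambda> i (real k * \<delta>) \<omega>)))"

definition prob_measures :: "real \<Rightarrow> ((real \<Rightarrow>\<^sub>C (real ^ 'n)) \<times> 's) measure set" where
  "prob_measures \<tau> = {\<nu>. prob_space \<nu> \<and> sets \<nu> = sets (state_space \<tau>)}"

definition first_moment :: "((real \<Rightarrow>\<^sub>C (real ^ 'n)) \<times> 's::finite) measure \<Rightarrow> ennreal" where
  "first_moment \<nu> =
     (\<Sum>i\<in>UNIV. \<integral>\<^sup>+x. ennreal (norm (fst x)) * indicator (UNIV \<times> {i}) x \<partial>\<nu>)"

definition prob_measures0 :: "real \<Rightarrow> ((real \<Rightarrow>\<^sub>C (real ^ 'n)) \<times> 's::finite) measure set" where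
  "prob_measures0 \<tau> = {\<nu> \<in> prob_measures \<tau>. first_moment \<nu> < \<infinity>}"

definition couplings :: "'x measure \<Rightarrow> 'x measure \<Rightarrow> ('x \<times> 'x) measure set" where
  "couplings \<mu> \<nu> = {\<pi>. prob_space \<pi> \<and> sets \<pi> = sets (\<mu> \<Otimes>\<^sub>M \<nu>) \<and>
     distr \<pi> \<mu> fst = \<mu> \<and> distr \<pi> \<nu> snd = \<nu>}"

definition wasserstein :: "((real \<Rightarrow>\<^sub>C (real ^ 'n)) \<times> 's) measure \<Rightarrow>
    ((real \<Rightarrow>\<^sub>C (real ^ 'n)) \<times> 's) measure \<Rightarrow> ennreal" where
  "wasserstein \<mu> \<nu> =
     (INF \<pi>\<in>couplings \<mu> \<nu>. \<integral>\<^sup>+z. ennreal (state_dist (fst z) (snd z)) \<partial>\<pi>)"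


section \<open>The spectral quantity\<close>

definition spec :: "real ^ 's ^ 's \<Rightarrow> complex set" where
  "spec A = {\<gamma>. \<exists>v :: complex ^ 's. v \<noteq> 0 \<and> (\<chi> i j. complex_of_real (A $ i $ j)) *v v = \<gamma> *s v}"

definition Q1 :: "real \<Rightarrow> real ^ 's ^ 's \<Rightarrow> ('s \<Rightarrow> real) \<Rightarrow> ('s \<Rightarrow> real) \<Rightarrow> real ^ 's ^ 's" where
  "Q1 \<tau> Q \<alpha> \<beta> = Q + (\<chi> i j. if i = j then \<alpha> i + exp (- Min (range \<alpha>) * \<tau>) * \<beta> i else 0)"

definition eta1 :: "real \<Rightarrow> real ^ 's ^ 's \<Rightarrow> ('s \<Rightarrow> real) \<Rightarrow> ('s \<Rightarrow> real) \<Rightarrow> real" where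
  "eta1 \<tau> Q \<alpha> \<beta> = - Max (Re ` spec (Q1 \<tau> Q \<alpha> \<beta>))"

end

theory Submission
  imports Defs
begin


text \<open>The noise of the scheme is additive.  If two copies are driven by the same Brownian path and see the
  same chain, then the noise cancels in their difference, and in a supremum norm of the last \<open>\<tau> / \<delta> + 1\<close>
  grid values, weighted by the age of a value, one step in state \<open>i\<close> has the Lipschitz constant
  \<open>exp (\<delta> (f i + O(\<delta>)) / 2)\<close> with \<open>f i = \<alpha> i + exp (- \<alpha>' \<tau>) \<beta> i\<close> and \<open>\<alpha>' = Min (range \<alpha>)\<close>
  (\<open>wdist_window_step\<close>).  Some \<open>f i\<close> may be positive; only the average along the chain has to be
  negative.  This is what the spectral condition provides: \<open>Q + diag f\<close> has nonnegative off-diagonal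
  entries and no eigenvalue in \<open>[0,\<infinity>)\<close>, hence there are positive weights \<open>u\<close> with \<open>Q u + f u / 2 < 0\<close>
  (\<open>spectral_weights\<close>).  The distance of the two copies, multiplied by the weight of the current state,
  therefore decays in mean at an exponential rate that is the same for all small steps
  (\<open>weights_decay\<close>, \<open>diag_dist_decay\<close>).

  Copies that start in different states are first let run with independent chains and the same Brownian
  path.  By irreducibility there is a time \<open>T\<close>, a multiple of \<open>\<tau>\<close> and thus on every grid, such that
  the chains meet before \<open>T\<close> with a probability bounded below (\<open>unequal_states_le\<close>).  Until then
  the copies must not drift apart.  Their weighted heights are bounded through a comparison, along the
  same chain, with the scheme started from zero (\<open>height_moment\<close>), and that scheme is bounded on \<open>[0,T]\<close> by
  Gronwall's inequality and Doob's maximal inequality, uniformly in the step (\<open>moment_from_zero\<close>).  So a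
  Lyapunov function, equal to the weighted distance where the states agree and to the sum of the
  heights plus a large constant elsewhere, contracts over every block of length \<open>T\<close> by a factor
  that is independent of the step (\<open>lyap_decay\<close>, \<open>window_contraction\<close>).

  The laws are treated through random maps: one step applies a map that is determined by a
  Brownian increment and by a random map of the finite state space with independent values, which
  realises both independence before and agreement after the meeting of two chains.  Running all starting
  points with one stream of such maps gives a coupling, and with it the Wasserstein bound
  (\<open>wasserstein_law_le\<close>).  Adding new maps at the beginning instead of the end makes the iterates from a
  fixed point converge almost surely, and the law of the limit is invariant
  (\<open>bwd_lim_fixed_point\<close>, \<open>inv_measure_invariant\<close>).  Uniqueness among all invariant probability
  measures, with or without a first moment, follows by comparing the masses of closed sets
  (\<open>invariant_closed_le\<close>).

  It remains to see that the law of the scheme is the law of the iterated maps.  The chain is given by its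
  transition rates and is independent of the Brownian motion; conditioning on its path on the grid turns
  the scheme into a function of independent increments, which has the same step-by-step transition
  (\<open>nn_integral_window_path\<close>).\<close>

section \<open>The spectral condition\<close>

lemma finite_ex_minimizer:
  fixes f :: "'s::finite \<Rightarrow> real"
  shows "\<exists>i. \<forall>k. f i \<le> f k"
proof -
  have "Min (range f) \<in> range f" by (intro Min_in) auto
  then obtain i where "f i = Min (range f)" by fastforce
  then have "f i \<le> f k" for k by (simp add: Min_le)
  then show ?thesis by blast
qed

lemma shifted_det_is_poly:
  fixes B :: "complex ^ 's ^ 's"
  shows "\<exists>p. \<forall>\<gamma>. poly p \<gamma> = det (mat \<gamma> - B)"
proof
  let ?p = "\<Sum>\<pi> | \<pi> permutes (UNIV :: 's set). [:of_int (sign \<pi>):] *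
     (\<Prod>i\<in>UNIV. [: - B $ i $ \<pi> i, if i = \<pi> i then 1 else 0 :])"
  show "\<forall>\<gamma>. poly ?p \<gamma> = det (mat \<gamma> - B)"
  proof
    fix \<gamma>
    have "poly [: - B $ i $ \<pi> i, if i = \<pi> i then 1 else 0 :] \<gamma> = (mat \<gamma> - B) $ i $ \<pi> i" for i \<pi>
      by (simp add: mat_def)
    then show "poly ?p \<gamma> = det (mat \<gamma> - B)"
      by (simp add: det_def poly_sum poly_prod del: poly_pCons)
  qed
qed

text \<open>The maximum in the definition of \<^const>\<open>eta1\<close> is only meaningful for a finite spectrum.
  No eigenvalue exceeds the sum of the absolute values of all entries, so the characteristic polynomial
  is not zero.\<close>

lemma finite_spec:
  fixes A :: "real ^ 's ^ 's"
  shows "finite (spec A)"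
proof -
  define B :: "complex ^ 's ^ 's" where "B = (\<chi> i j. complex_of_real (A $ i $ j))"
  obtain p where p: "\<And>\<gamma>. poly p \<gamma> = det (mat \<gamma> - B)"
    using shifted_det_is_poly[of B] by auto
  have ker: "det (mat \<gamma> - B) = 0 \<longleftrightarrow> (\<exists>v. v \<noteq> 0 \<and> B *v v = \<gamma> *s v)" for \<gamma>
  proof -
    have "mat \<gamma> *v v = \<gamma> *s v" for v :: "complex ^ 's"
      by (simp add: vec_eq_iff matrix_vector_mult_def mat_def if_distrib[of "\<lambda>x. x * _"] cong: if_cong)
    then have "(mat \<gamma> - B) *v v = 0 \<longleftrightarrow> B *v v = \<gamma> *s v" for v
      by (auto simp: matrix_vector_mult_diff_rdistrib)
    then show ?thesis
      using invertible_det_nz[of "mat \<gamma> - B"] invertible_left_inverse[of "mat \<gamma> - B"]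
        matrix_left_invertible_ker[of "mat \<gamma> - B"] by metis
  qed
  define K where "K = (\<Sum>i\<in>UNIV. \<Sum>j\<in>UNIV. norm (B $ i $ j))"
  have K0: "K \<ge> 0" by (simp add: K_def sum_nonneg)
  have "p \<noteq> 0"
  proof
    assume "p = 0"
    then have "det (mat (of_real (K + 1)) - B) = 0" using p[of "of_real (K + 1)"] by simp
    then obtain v where v: "v \<noteq> 0" "B *v v = of_real (K + 1) *s v" using ker by blast
    obtain i where i: "\<And>j. norm (v $ j) \<le> norm (v $ i)"
      using finite_ex_minimizer[of "\<lambda>j. - norm (v $ j)"] by auto
    have pos: "norm (v $ i) > 0"
    proof (rule ccontr)
      assume "\<not> norm (v $ i) > 0"
      then have "v $ j = 0" for j using i[of j] by simp
      then show False using v(1) by (simp add: vec_eq_iff)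
    qed
    have "(K + 1) * norm (v $ i) = norm (\<Sum>j\<in>UNIV. B $ i $ j * v $ j)"
    proof -
      have "(\<Sum>j\<in>UNIV. B $ i $ j * v $ j) = of_real (K + 1) * v $ i"
        using v(2) by (simp add: vec_eq_iff matrix_vector_mult_def del: of_real_add)
      then show ?thesis using K0 by (simp only: norm_mult norm_of_real abs_of_nonneg add_nonneg_nonneg zero_le_one)
    qed
    also have "\<dots> \<le> (\<Sum>j\<in>UNIV. norm (B $ i $ j) * norm (v $ i))"
      using i by (intro sum_norm_le) (simp add: norm_mult mult_left_mono)
    also have "\<dots> = (\<Sum>j\<in>UNIV. norm (B $ i $ j)) * norm (v $ i)" by (simp add: sum_distrib_right)
    also have "\<dots> \<le> K * norm (v $ i)"
      unfolding K_def by (intro mult_right_mono member_le_sum) (auto intro: sum_nonneg)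
    finally show False using pos by simp
  qed
  then have "finite {\<gamma>. poly p \<gamma> = 0}" by (rule poly_roots_finite)
  moreover have "spec A = {\<gamma>. poly p \<gamma> = 0}"
    by (auto simp: spec_def p ker B_def[symmetric])
  ultimately show ?thesis by simp
qed

lemma eta1_pos_imp_no_nonneg_real_eigenvalue:
  assumes "eta1 \<tau> Q \<alpha> \<beta> > 0" and "s \<ge> 0" and "Q1 \<tau> Q \<alpha> \<beta> *v w = s *s w"
  shows "w = 0"
proof (rule ccontr)
  let ?A = "Q1 \<tau> Q \<alpha> \<beta>"
  assume w: "w \<noteq> 0"
  have "complex_of_real s \<in> spec ?A"
    unfolding spec_def
  proof (intro CollectI exI conjI)
    let ?v = "\<chi> i. complex_of_real (w $ i)"
    show "?v \<noteq> 0" using w by (simp add: vec_eq_iff)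
    have "(\<Sum>j\<in>UNIV. ?A $ i $ j * w $ j) = s * w $ i" for i
      using assms(3) by (simp add: vec_eq_iff matrix_vector_mult_def)
    then show "(\<chi> i j. complex_of_real (?A $ i $ j)) *v ?v = complex_of_real s *s ?v"
      by (simp add: vec_eq_iff matrix_vector_mult_def flip: of_real_mult of_real_sum)
  qed
  then have "s \<le> Max (Re ` spec ?A)"
    using finite_spec[of ?A] by (intro Max_ge) force+
  then show False using assms(1,2) by (simp add: eta1_def)
qed

lemma continuous_on_det_real:
  fixes F :: "'a::topological_space \<Rightarrow> real ^ 's ^ 's"
  assumes "\<And>i j. continuous_on S (\<lambda>s. F s $ i $ j)"
  shows "continuous_on S (\<lambda>s. det (F s))"
  unfolding det_def by (intro continuous_intros assms)

text \<open>If a matrix with nonnegative off-diagonal entries has no eigenvalue in \<open>[0,\<infinity>)\<close>, then minus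
  its inverse maps positive vectors to positive vectors.  The solution \<open>v\<close> of \<open>(s - A) v = 1\<close>
  depends continuously on \<open>s \<ge> 0\<close>, is positive for large \<open>s\<close>, and can never touch the boundary of
  the positive cone: if \<open>v \<ge> 0\<close> and \<open>v\<^sub>i = 0\<close>, then row \<open>i\<close> of the equation has a left-hand side
  \<open>\<le> 0\<close>.  Hence it is still positive at \<open>s = 0\<close>.\<close>

lemma metzler_positive_vector:
  fixes A :: "real ^ 's ^ 's"
  assumes metz: "\<And>i j. i \<noteq> j \<Longrightarrow> A $ i $ j \<ge> 0"
    and noev: "\<And>s w. s \<ge> 0 \<Longrightarrow> A *v w = s *s w \<Longrightarrow> w = 0"
  shows "\<exists>v. (\<forall>i. v $ i > 0) \<and> (\<forall>i. (A *v v) $ i < 0)"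
proof -
  define B where "B s = mat s - A" for s
  have Bv: "(B s *v w) $ i = s * w $ i - (A *v w) $ i" for s w i
  proof -
    have "mat s *v w = s *s w"
      by (simp add: vec_eq_iff matrix_vector_mult_def mat_def if_distrib[of "\<lambda>x. x * _"] cong: if_cong)
    then show ?thesis by (simp add: B_def matrix_vector_mult_diff_rdistrib)
  qed
  have det: "det (B s) \<noteq> 0" if "s \<ge> 0" for s
  proof -
    have "w = 0" if "B s *v w = 0" for w
    proof (rule noev[OF \<open>s \<ge> 0\<close>])
      have "s * w $ i - (A *v w) $ i = 0" for i using that Bv[of s w i] by simp
      then show "A *v w = s *s w" by (simp add: vec_eq_iff)
    qed
    then show ?thesis
      using invertible_det_nz[of "B s"] invertible_left_inverse[of "B s"] matrix_left_invertible_ker[of "B s"]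
      by metis
  qed
  define v :: "real \<Rightarrow> real ^ 's" where
    "v s = (\<chi> k. det (\<chi> i j. if j = k then 1 else B s $ i $ j) / det (B s))" for s
  have sol: "B s *v v s = (\<chi> i. 1)" if "s \<ge> 0" for s
  proof -
    have "v s = (\<chi> k. det (\<chi> i j. if j = k then (\<chi> i. 1) $ i else B s $ i $ j) / det (B s))"
      by (simp add: v_def cong: if_cong)
    then show ?thesis using cramer[OF det[OF that], of "v s" "\<chi> i. 1"] by blast
  qed
  have eq: "s * v s $ i = 1 + (\<Sum>j\<in>UNIV. A $ i $ j * v s $ j)" if "s \<ge> 0" for s i
  proof -
    have "(B s *v v s) $ i = 1" by (simp only: sol[OF that] vec_lambda_beta)
    then have "s * v s $ i = 1 + (A *v v s) $ i" using Bv[of s "v s" i] by simp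
    then show ?thesis by (simp add: matrix_vector_mult_def)
  qed
  have strict: "v s $ i > 0" if s: "s \<ge> 0" and nn: "\<And>j. v s $ j \<ge> 0" for s i
  proof (rule ccontr)
    assume "\<not> v s $ i > 0"
    then have 0: "v s $ i = 0" using nn[of i] by simp
    have "A $ i $ j * v s $ j \<ge> 0" for j
      using metz[of i j] nn[of j] 0 by (cases "j = i") auto
    then have "(\<Sum>j\<in>UNIV. A $ i $ j * v s $ j) \<ge> 0" by (intro sum_nonneg) auto
    then show False using eq[OF s, of i] 0 by simp
  qed
  define s1 where "s1 = 1 + (\<Sum>i\<in>UNIV. \<Sum>j\<in>UNIV. \<bar>A $ i $ j\<bar>)"
  have s1: "s1 \<ge> 0" by (simp add: s1_def sum_nonneg add_nonneg_nonneg)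
  have large: "v s1 $ j \<ge> 0" for j
  proof (rule ccontr)
    assume neg: "\<not> v s1 $ j \<ge> 0"
    obtain i where i: "\<And>k. v s1 $ i \<le> v s1 $ k"
      using finite_ex_minimizer[of "\<lambda>j. v s1 $ j"] by auto
    have vi: "v s1 $ i < 0" using i[of j] neg by simp
    have "(\<Sum>j\<in>UNIV. A $ i $ j) * v s1 $ i \<le> (\<Sum>j\<in>UNIV. A $ i $ j * v s1 $ j)"
      unfolding sum_distrib_right
    proof (rule sum_mono)
      fix j show "A $ i $ j * v s1 $ i \<le> A $ i $ j * v s1 $ j"
        using metz[of i j] i[of j] by (cases "i = j") (auto intro: mult_left_mono)
    qed
    then have *: "(s1 - (\<Sum>j\<in>UNIV. A $ i $ j)) * v s1 $ i \<ge> 1"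
      using eq[OF s1, of i] by (simp add: algebra_simps)
    have "(\<Sum>j\<in>UNIV. A $ i $ j) \<le> (\<Sum>j\<in>UNIV. \<bar>A $ i $ j\<bar>)" by (intro sum_mono) auto
    also have "\<dots> \<le> s1 - 1"
      unfolding s1_def
      by (simp, rule member_le_sum[of i UNIV "\<lambda>i. \<Sum>j\<in>UNIV. \<bar>A $ i $ j\<bar>"]) (auto intro: sum_nonneg)
    finally have "s1 - (\<Sum>j\<in>UNIV. A $ i $ j) \<ge> 0" by simp
    from mult_nonneg_nonpos[OF this, of "v s1 $ i"] * vi show False by simp
  qed
  define S where "S = {0..s1}"
  have cont: "continuous_on S (\<lambda>s. v s $ k)" for k
  proof -
    have B: "continuous_on S (\<lambda>s. B s $ i $ j)" for i j
      unfolding B_def by (cases "i = j") (auto simp: mat_def intro!: continuous_intros)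
    have "continuous_on S (\<lambda>s. if j = k then 1 else B s $ i $ j)" for i j
      using B by (cases "j = k") auto
    then have "continuous_on S (\<lambda>s. det (\<chi> i j. if j = k then 1 else B s $ i $ j))"
      by (intro continuous_on_det_real) simp
    moreover have "continuous_on S (\<lambda>s. det (B s))" by (intro continuous_on_det_real B)
    ultimately show ?thesis
      by (simp add: v_def) (intro continuous_on_divide, auto simp: S_def det)
  qed
  define T where "T = {s\<in>S. \<forall>k. v s $ k > 0}"
  have T': "T = {s\<in>S. \<forall>k. v s $ k \<ge> 0}"
    using strict by (auto simp: T_def S_def less_imp_le)
  have "openin (top_of_set S) T"
  proof -
    have "T = S \<inter> (\<Inter>k. S \<inter> (\<lambda>s. v s $ k) -` {0<..})" by (auto simp: T_def)
    also have "openin (top_of_set S) (S \<inter> (\<Inter>k. S \<inter> (\<lambda>s. v s $ k) -` {0<..}))"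
      by (intro openin_Int openin_Inter openin_subtopology_self)
         (auto intro!: continuous_openin_preimage_gen cont)
    finally show ?thesis .
  qed
  moreover have "closedin (top_of_set S) T"
  proof -
    have "T = (\<Inter>k. S \<inter> (\<lambda>s. v s $ k) -` {0..})" by (auto simp: T')
    also have "closedin (top_of_set S) (\<Inter>k. S \<inter> (\<lambda>s. v s $ k) -` {0..})"
      by (intro closedin_Inter) (auto intro!: continuous_closedin_preimage cont)
    finally show ?thesis .
  qed
  moreover have "connected S" by (simp add: S_def)
  moreover have "s1 \<in> T" using large s1 by (auto simp: T' S_def)
  ultimately have "T = S" using connected_clopen by blast
  then have "0 \<in> T" using s1 by (simp add: S_def)
  then have "v 0 $ k > 0" for k by (simp add: T_def)
  moreover have "(A *v v 0) $ k < 0" for k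
    using eq[of 0 k] by (simp add: matrix_vector_mult_def)
  ultimately show ?thesis by blast
qed

text \<open>Since the rows of \<open>Q\<close> sum to zero, the smallest entry of the positive vector \<open>v\<close> witnesses that
  some \<open>\<alpha> i\<close> is negative.  The second claim concerns \<open>u = sqrt v\<close>; the tangent inequality
  \<open>2 u\<^sub>i u\<^sub>j \<le> v\<^sub>j + v\<^sub>i\<close> turns \<open>Q v + f v < 0\<close> into \<open>Q u + f u / 2 < 0\<close>.  The square root is what lets
  first moments of distances, rather than second moments, be controlled.\<close>

lemma spectral_weights:
  fixes Q :: "real ^ 's ^ 's"
  assumes Q: "q_matrix Q" and eta: "eta1 \<tau> Q \<alpha> \<beta> > 0" and \<beta>: "\<And>i. \<beta> i \<ge> 0"
  shows "Min (range \<alpha>) < 0"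
    and "\<exists>u. (\<forall>i. u i > 0) \<and> (\<forall>i. (\<Sum>j\<in>UNIV. Q $ i $ j * u j)
            + (\<alpha> i + exp (- Min (range \<alpha>) * \<tau>) * \<beta> i) / 2 * u i < 0)"
proof -
  define f where "f i = \<alpha> i + exp (- Min (range \<alpha>) * \<tau>) * \<beta> i" for i
  have Qnn: "Q $ i $ j \<ge> 0" if "i \<noteq> j" for i j using Q that by (simp add: q_matrix_def)
  have Q0: "(\<Sum>j\<in>UNIV. Q $ i $ j) = 0" for i using Q by (simp add: q_matrix_def)
  obtain v where v: "\<And>i. v $ i > 0" "\<And>i. (Q1 \<tau> Q \<alpha> \<beta> *v v) $ i < 0"
    using metzler_positive_vector[of "Q1 \<tau> Q \<alpha> \<beta>"] eta1_pos_imp_no_nonneg_real_eigenvalue[OF eta] Qnn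
    by (force simp: Q1_def)
  have Q1v: "(\<Sum>j\<in>UNIV. Q $ i $ j * v $ j) + f i * v $ i < 0" for i
  proof -
    have "(Q1 \<tau> Q \<alpha> \<beta> *v v) $ i = (\<Sum>j\<in>UNIV. Q $ i $ j * v $ j + (if i = j then f i else 0) * v $ j)"
      by (auto simp: Q1_def f_def matrix_vector_mult_def algebra_simps intro!: sum.cong)
    also have "\<dots> = (\<Sum>j\<in>UNIV. Q $ i $ j * v $ j) + f i * v $ i"
      by (simp add: sum.distrib if_distrib[of "\<lambda>x. x * _"] cong: if_cong)
    finally show ?thesis using v(2)[of i] by simp
  qed
  obtain i where i: "\<And>k. v $ i \<le> v $ k"
    using finite_ex_minimizer[of "\<lambda>j. v $ j"] by auto
  have "(\<Sum>j\<in>UNIV. Q $ i $ j) * v $ i \<le> (\<Sum>j\<in>UNIV. Q $ i $ j * v $ j)"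
    unfolding sum_distrib_right
  proof (rule sum_mono)
    fix j show "Q $ i $ j * v $ i \<le> Q $ i $ j * v $ j"
      using Qnn[of i j] i[of j] by (cases "i = j") (auto intro: mult_left_mono)
  qed
  then have "f i * v $ i < 0" using Q1v[of i] Q0 by simp
  then have "f i < 0" using v(1)[of i] by (auto simp: mult_less_0_iff)
  then have "\<alpha> i < 0" using \<beta>[of i] by (simp add: f_def) (smt (verit) exp_gt_zero mult_nonneg_nonneg)
  moreover have "Min (range \<alpha>) \<le> \<alpha> i" by (intro Min_le) auto
  ultimately show "Min (range \<alpha>) < 0" by linarith
  define u where "u i = sqrt (v $ i)" for i
  have u: "u i > 0" "u i * u i = v $ i" for i using v(1)[of i] by (auto simp: u_def)
  have "(\<Sum>j\<in>UNIV. Q $ i $ j * u j) + f i / 2 * u i < 0" for i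
  proof -
    have "2 * u i * (\<Sum>j\<in>UNIV. Q $ i $ j * u j) = (\<Sum>j\<in>UNIV. Q $ i $ j * (2 * u i * u j))"
      by (simp add: sum_distrib_left algebra_simps)
    also have "\<dots> \<le> (\<Sum>j\<in>UNIV. Q $ i $ j * (v $ j + v $ i))"
    proof (rule sum_mono)
      fix j
      have "2 * u i * u j \<le> v $ j + v $ i"
        using zero_le_power2[of "u i - u j"] u(2)[of i] u(2)[of j] by (simp add: power2_eq_square algebra_simps)
      then show "Q $ i $ j * (2 * u i * u j) \<le> Q $ i $ j * (v $ j + v $ i)"
        using Qnn[of i j] u(2)[of i] by (cases "i = j") (auto intro: mult_left_mono simp: mult.assoc)
    qed
    also have "\<dots> = (\<Sum>j\<in>UNIV. Q $ i $ j * v $ j) + (\<Sum>j\<in>UNIV. Q $ i $ j) * v $ i"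
      by (simp add: algebra_simps sum.distrib sum_distrib_left)
    also have "\<dots> < - f i * v $ i" using Q1v[of i] Q0 by simp
    finally have "2 * u i * ((\<Sum>j\<in>UNIV. Q $ i $ j * u j) + f i / 2 * u i) < 0"
      by (simp add: u(2)[symmetric] algebra_simps)
    then show ?thesis using u(1)[of i] by (auto simp: mult_less_0_iff)
  qed
  then show "\<exists>u. (\<forall>i. u i > 0) \<and> (\<forall>i. (\<Sum>j\<in>UNIV. Q $ i $ j * u j)
            + (\<alpha> i + exp (- Min (range \<alpha>) * \<tau>) * \<beta> i) / 2 * u i < 0)"
    using u(1) unfolding f_def by blast
qed

section \<open>Iterated random maps\<close>

text \<open>The newest map is applied last and uses the head of the stream, so that lengthening the
  iteration by one step leaves the last maps unchanged.  For a fixed number of steps this has the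
  same law as the forward iteration, but as a process in \<open>k\<close> it can converge almost surely,
  which is how the invariant law will be found.\<close>

primrec riter :: "('x \<Rightarrow> 'a \<Rightarrow> 'x) \<Rightarrow> nat \<Rightarrow> 'x \<Rightarrow> 'a stream \<Rightarrow> 'x" where
  "riter F 0 x s = x"
| "riter F (Suc k) x s = F (riter F k x (stl s)) (shd s)"

definition iter_expect :: "'a measure \<Rightarrow> ('x \<Rightarrow> 'a \<Rightarrow> 'x) \<Rightarrow> nat \<Rightarrow> ('x \<Rightarrow> ennreal) \<Rightarrow> 'x \<Rightarrow> ennreal" where
  "iter_expect N F k g x = (\<integral>\<^sup>+s. g (riter F k x s) \<partial>stream_space N)"

definition pair_map :: "('x \<Rightarrow> 'a \<Rightarrow> 'x) \<Rightarrow> 'x \<times> 'x \<Rightarrow> 'a \<Rightarrow> 'x \<times> 'x" where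
  "pair_map F z a = (F (fst z) a, F (snd z) a)"

lemma riter_semiconj:
  assumes "\<And>x a. h (F x a) = G (h x) a"
  shows "h (riter F k x s) = riter G k (h x) s"
  by (induction k arbitrary: s) (simp_all add: assms)

lemma riter_pair_map: "riter (pair_map F) k z s = (riter F k (fst z) s, riter F k (snd z) s)"
  by (induction k arbitrary: s) (simp_all add: pair_map_def)

lemma riter_invariant:
  assumes "J 0 x" and "\<And>l y a. J l y \<Longrightarrow> J (Suc l) (F y a)"
  shows "J k (riter F k x s)"
  by (induction k arbitrary: s) (simp_all add: assms)

lemma iter_expect_semiconj:
  assumes "\<And>x a. h (F x a) = G (h x) a"
  shows "iter_expect N F k (\<lambda>x. g (h x)) x = iter_expect N G k g (h x)"
  unfolding iter_expect_def by (subst riter_semiconj[of h F G]) (simp_all add: assms)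

locale random_maps = prob_space N for N :: "'a measure" +
  fixes S :: "'x measure" and F :: "'x \<Rightarrow> 'a \<Rightarrow> 'x"
  assumes space_noise: "space N = UNIV"
    and space_state: "space S = UNIV"
    and measurable_map: "case_prod F \<in> S \<Otimes>\<^sub>M N \<rightarrow>\<^sub>M S"
begin

lemma measurable_map'[measurable (raw)]:
  "f \<in> K \<rightarrow>\<^sub>M S \<Longrightarrow> g \<in> K \<rightarrow>\<^sub>M N \<Longrightarrow> (\<lambda>x. F (f x) (g x)) \<in> K \<rightarrow>\<^sub>M S"
  using measurable_compose[OF measurable_Pair measurable_map, of f K g] by simp

lemma prob_stream: "prob_space (stream_space N)"
  by (rule prob_space_stream_space)

lemma measurable_riter: "(\<lambda>(x, s). riter F k x s) \<in> S \<Otimes>\<^sub>M stream_space N \<rightarrow>\<^sub>M S"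
proof (induction k)
  case (Suc k)
  have "(\<lambda>z. riter F k (fst z) (stl (snd z))) \<in> S \<Otimes>\<^sub>M stream_space N \<rightarrow>\<^sub>M S"
    using measurable_compose[OF _ Suc, of "\<lambda>z. (fst z, stl (snd z))"] by simp
  then show ?case by (simp add: case_prod_beta')
qed simp

lemma measurable_riter'[measurable (raw)]:
  "f \<in> K \<rightarrow>\<^sub>M S \<Longrightarrow> g \<in> K \<rightarrow>\<^sub>M stream_space N \<Longrightarrow> (\<lambda>x. riter F k (f x) (g x)) \<in> K \<rightarrow>\<^sub>M S"
  using measurable_compose[OF measurable_Pair measurable_riter, of f K g] by simp

lemma measurable_start[measurable]: "(\<lambda>_. x) \<in> K \<rightarrow>\<^sub>M S"
  by (simp add: space_state)

lemma measurable_step_expect[measurable]: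
  assumes [measurable]: "g \<in> borel_measurable S"
  shows "(\<lambda>y. \<integral>\<^sup>+a. g (F y a) \<partial>N) \<in> borel_measurable S"
  by (rule borel_measurable_nn_integral) measurable

lemma measurable_iter_expect[measurable]:
  assumes [measurable]: "g \<in> borel_measurable S"
  shows "iter_expect N F k g \<in> borel_measurable S"
proof -
  interpret st: prob_space "stream_space N" by (rule prob_stream)
  show ?thesis unfolding iter_expect_def[abs_def]
    by (rule st.borel_measurable_nn_integral) measurable
qed

lemma iter_expect_0: "iter_expect N F 0 g x = g x"
proof -
  interpret st: prob_space "stream_space N" by (rule prob_stream)
  show ?thesis by (simp add: iter_expect_def st.emeasure_space_1)
qed

lemma iter_expect_Suc:
  assumes [measurable]: "g \<in> borel_measurable S"
  shows "iter_expect N F (Suc k) g x = iter_expect N F k (\<lambda>y. \<integral>\<^sup>+a. g (F y a) \<partial>N) x"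
proof -
  interpret st: prob_space "stream_space N" by (rule prob_stream)
  interpret pair_sigma_finite "stream_space N" N ..
  have "iter_expect N F (Suc k) g x = (\<integral>\<^sup>+a. \<integral>\<^sup>+s. g (F (riter F k x s) a) \<partial>stream_space N \<partial>N)"
    unfolding iter_expect_def by (subst nn_integral_stream_space) simp_all
  also have "\<dots> = (\<integral>\<^sup>+s. \<integral>\<^sup>+a. g (F (riter F k x s) a) \<partial>N \<partial>stream_space N)"
    by (rule Fubini') measurable
  finally show ?thesis by (simp add: iter_expect_def)
qed

lemma iter_expect_add:
  assumes [measurable]: "g \<in> borel_measurable S"
  shows "iter_expect N F (k + n) g x = iter_expect N F n (iter_expect N F k g) x"
  using assms
proof (induction k arbitrary: g)
  case 0
  then show ?case by (simp add: iter_expect_0)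
next
  case (Suc k)
  note [measurable] = Suc.prems
  show ?case using Suc.IH[of "\<lambda>y. \<integral>\<^sup>+a. g (F y a) \<partial>N"]
    by (simp add: iter_expect_Suc)
qed

lemma iter_expect_mono:
  "(\<And>s. g (riter F k x s) \<le> h (riter F k x s)) \<Longrightarrow> iter_expect N F k g x \<le> iter_expect N F k h x"
  unfolding iter_expect_def by (intro nn_integral_mono) auto

lemma iter_expect_cmult:
  assumes [measurable]: "g \<in> borel_measurable S"
  shows "iter_expect N F k (\<lambda>y. c * g y) x = c * iter_expect N F k g x"
  unfolding iter_expect_def by (intro nn_integral_cmult) measurable

lemma iter_expect_plus:
  assumes [measurable]: "g \<in> borel_measurable S" "h \<in> borel_measurable S"
  shows "iter_expect N F k (\<lambda>y. g y + h y) x = iter_expect N F k g x + iter_expect N F k h x"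
  unfolding iter_expect_def by (intro nn_integral_add) measurable

lemma iter_expect_const: "iter_expect N F k (\<lambda>_. c) x = c"
proof -
  interpret st: prob_space "stream_space N" by (rule prob_stream)
  show ?thesis by (simp add: iter_expect_def st.emeasure_space_1)
qed

lemma iter_expect_geometric:
  assumes [measurable]: "g \<in> borel_measurable S" and "\<And>x. iter_expect N F n g x \<le> c * g x"
  shows "iter_expect N F (k * n) g x \<le> c ^ k * g x"
proof (induction k)
  case (Suc k)
  have "iter_expect N F (Suc k * n) g x = iter_expect N F (k * n) (iter_expect N F n g) x"
    by (simp add: iter_expect_add)
  also have "\<dots> \<le> iter_expect N F (k * n) (\<lambda>y. c * g y) x" by (intro iter_expect_mono assms)
  also have "\<dots> \<le> c * (c ^ k * g x)" by (simp add: iter_expect_cmult Suc.IH mult_left_mono)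
  finally show ?case by (simp add: mult.assoc)
qed (simp add: iter_expect_0)

lemma iter_expect_step_geometric:
  assumes [measurable]: "g \<in> borel_measurable S" and "\<And>x. (\<integral>\<^sup>+a. g (F x a) \<partial>N) \<le> c * g x"
  shows "iter_expect N F k g x \<le> c ^ k * g x"
  using iter_expect_geometric[of g 1 c k x] assms iter_expect_Suc[of g 0] by (simp add: iter_expect_0)

lemma iter_expect_step_additive:
  assumes [measurable]: "g \<in> borel_measurable S" and "\<And>x. (\<integral>\<^sup>+a. g (F x a) \<partial>N) \<le> g x + c"
  shows "iter_expect N F k g x \<le> g x + of_nat k * c"
proof (induction k)
  case (Suc k)
  have "iter_expect N F (Suc k) g x \<le> iter_expect N F k (\<lambda>y. g y + c) x"
    by (simp add: iter_expect_Suc iter_expect_mono assms)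
  also have "\<dots> \<le> (g x + of_nat k * c) + c"
    by (simp add: iter_expect_plus iter_expect_const add_right_mono Suc.IH)
  finally show ?case by (simp add: distrib_right add_ac)
qed (simp add: iter_expect_0)

lemma random_maps_pair: "random_maps N (S \<Otimes>\<^sub>M S) (pair_map F)"
proof
  show "space (S \<Otimes>\<^sub>M S) = UNIV" by (simp add: space_pair_measure space_state)
  show "case_prod (pair_map F) \<in> (S \<Otimes>\<^sub>M S) \<Otimes>\<^sub>M N \<rightarrow>\<^sub>M S \<Otimes>\<^sub>M S"
    unfolding pair_map_def[abs_def] case_prod_beta' by measurable
qed (fact space_noise)

text \<open>Starting the iteration one step earlier replaces the initial point by its image under the
  random map that is applied first.\<close>

lemma nn_integral_riter_consecutive:
  assumes [measurable]: "g \<in> borel_measurable (S \<Otimes>\<^sub>M S)"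
  shows "(\<integral>\<^sup>+s. g (riter F k x s, riter F (Suc k) x s) \<partial>stream_space N)
    = (\<integral>\<^sup>+a. iter_expect N (pair_map F) k g (x, F x a) \<partial>N)"
  using assms
proof (induction k arbitrary: g)
  case 0
  note [measurable] = 0
  interpret st: prob_space "stream_space N" by (rule prob_stream)
  interpret pr: random_maps N "S \<Otimes>\<^sub>M S" "pair_map F" by (rule random_maps_pair)
  show ?case
    by (subst nn_integral_stream_space) (simp_all add: pr.iter_expect_0 st.emeasure_space_1)
next
  case (Suc k)
  note [measurable] = Suc.prems
  interpret st: prob_space "stream_space N" by (rule prob_stream)
  interpret pr: random_maps N "S \<Otimes>\<^sub>M S" "pair_map F" by (rule random_maps_pair)
  interpret pair_sigma_finite "stream_space N" N ..
  have "(\<integral>\<^sup>+s. g (riter F (Suc k) x s, riter F (Suc (Suc k)) x s) \<partial>stream_space N)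
      = (\<integral>\<^sup>+a. \<integral>\<^sup>+s. g (pair_map F (riter F k x s, riter F (Suc k) x s) a) \<partial>stream_space N \<partial>N)"
    by (subst nn_integral_stream_space) (simp_all add: pair_map_def del: riter.simps, simp)
  also have "\<dots> = (\<integral>\<^sup>+s. \<integral>\<^sup>+a. g (pair_map F (riter F k x s, riter F (Suc k) x s) a) \<partial>N \<partial>stream_space N)"
    unfolding pair_map_def by (rule Fubini') measurable
  also have "\<dots> = (\<integral>\<^sup>+a. iter_expect N (pair_map F) k (\<lambda>z. \<integral>\<^sup>+a. g (pair_map F z a) \<partial>N) (x, F x a) \<partial>N)"
    by (rule Suc.IH) simp
  finally show ?case by (simp add: pr.iter_expect_Suc)
qed

end

text \<open>An upper bound that holds without measurability of the integrand.\<close>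

lemma nn_integral_distr_le:
  assumes T: "T \<in> M \<rightarrow>\<^sub>M N"
  shows "(\<integral>\<^sup>+x. f x \<partial>distr M N T) \<le> (\<integral>\<^sup>+x. f (T x) \<partial>M)"
  unfolding nn_integral_def[of "distr M N T"]
proof (rule SUP_least, clarify)
  fix g assume g: "simple_function (distr M N T) g" "g \<le> f"
  have [measurable]: "g \<in> borel_measurable (distr M N T)"
    using g(1) by (rule borel_measurable_simple_function)
  have "integral\<^sup>S (distr M N T) g = (\<integral>\<^sup>+x. g x \<partial>distr M N T)"
    by (rule nn_integral_eq_simple_integral[symmetric, OF g(1)])
  also have "\<dots> = (\<integral>\<^sup>+x. g (T x) \<partial>M)" by (rule nn_integral_distr[OF T]) simp
  also have "\<dots> \<le> (\<integral>\<^sup>+x. f (T x) \<partial>M)" using g(2) by (intro nn_integral_mono) (auto simp: le_fun_def)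
  finally show "integral\<^sup>S (distr M N T) g \<le> (\<integral>\<^sup>+x. f (T x) \<partial>M)" .
qed

section \<open>The scheme as a Markov recursion on grid windows\<close>

text \<open>Entry \<open>q\<close> of a window is the value \<open>q\<close> steps before the present one; only the entries up to
  the delay \<open>M\<close> matter, and those beyond \<open>M\<close> are kept at zero.\<close>

definition interp :: "real \<Rightarrow> real \<Rightarrow> (nat \<Rightarrow> real ^ 'n) \<Rightarrow> (real \<Rightarrow>\<^sub>C (real ^ 'n))" where
  "interp \<tau> \<delta> x = em_segment \<tau> \<delta> (\<lambda>t. x (nat \<lfloor>- t / \<delta> + 1 / 2\<rfloor>)) 0"

definition grid_window :: "real \<Rightarrow> nat \<Rightarrow> (real \<Rightarrow>\<^sub>C (real ^ 'n)) \<Rightarrow> nat \<Rightarrow> real ^ 'n" where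
  "grid_window \<delta> M \<xi> q = (if q \<le> M then apply_bcontfun \<xi> (- real q * \<delta>) else 0)"

definition window_step :: "real \<Rightarrow> real \<Rightarrow> nat \<Rightarrow> ((real \<Rightarrow>\<^sub>C (real ^ 'n)) \<Rightarrow> 's \<Rightarrow> real ^ 'n) \<Rightarrow>
    ('s \<Rightarrow> real ^ 'm ^ 'n) \<Rightarrow> (nat \<Rightarrow> real ^ 'n) \<Rightarrow> 's \<Rightarrow> real ^ 'm \<Rightarrow> nat \<Rightarrow> real ^ 'n" where
  "window_step \<tau> \<delta> M b \<sigma> x i z q =
     (if q = 0 then x 0 + \<delta> *\<^sub>R b (interp \<tau> \<delta> x) i + \<sigma> i *v z
      else if q \<le> M then x (q - 1) else 0)"

definition em_window :: "real \<Rightarrow> real \<Rightarrow> nat \<Rightarrow> ((real \<Rightarrow>\<^sub>C (real ^ 'n)) \<Rightarrow> 's \<Rightarrow> real ^ 'n) \<Rightarrow>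
    ('s \<Rightarrow> real ^ 'm ^ 'n) \<Rightarrow> (real \<Rightarrow> real ^ 'm) \<Rightarrow> (real \<Rightarrow> 's) \<Rightarrow> (real \<Rightarrow>\<^sub>C (real ^ 'n)) \<Rightarrow>
    nat \<Rightarrow> nat \<Rightarrow> real ^ 'n" where
  "em_window \<tau> \<delta> M b \<sigma> w \<kappa> \<xi> k q =
     (if q \<le> M then em_process \<tau> \<delta> b \<sigma> w \<kappa> \<xi> ((real k - real q) * \<delta>) else 0)"

text \<open>A weighted supremum distance of windows; see \<open>wdist_window_step\<close> for the choice of \<open>r\<close>.\<close>

definition wdist :: "nat \<Rightarrow> real \<Rightarrow> (nat \<Rightarrow> real ^ 'n) \<Rightarrow> (nat \<Rightarrow> real ^ 'n) \<Rightarrow> real" where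
  "wdist M r x y = Max ((\<lambda>q. r ^ q * norm (x q - y q)) ` {..M})"

lemma wdist_le_iff: "wdist M r x y \<le> c \<longleftrightarrow> (\<forall>q\<le>M. r ^ q * norm (x q - y q) \<le> c)"
  unfolding wdist_def by (subst Max_le_iff) auto

lemma wdist_ge: "q \<le> M \<Longrightarrow> r ^ q * norm (x q - y q) \<le> wdist M r x y"
  using wdist_le_iff[of M r x y "wdist M r x y"] by simp

lemma wdist_nonneg: "0 \<le> r \<Longrightarrow> 0 \<le> wdist M r x y"
  using wdist_ge[of 0 M r x y] by (simp add: order_trans[OF norm_ge_zero])

lemma wdist_commute: "wdist M r x y = wdist M r y x"
  by (simp add: wdist_def norm_minus_commute)

lemma wdist_triangle:
  assumes "0 \<le> r"
  shows "wdist M r x z \<le> wdist M r x y + wdist M r y z"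
  unfolding wdist_le_iff
proof (intro allI impI)
  fix q assume q: "q \<le> M"
  have "r ^ q * norm (x q - z q) \<le> r ^ q * (norm (x q - y q) + norm (y q - z q))"
    using assms norm_triangle_ineq[of "x q - y q" "y q - z q"] by (intro mult_left_mono) auto
  also have "\<dots> \<le> wdist M r x y + wdist M r y z"
    using wdist_ge[OF q, of r x y] wdist_ge[OF q, of r y z] by (simp add: distrib_left)
  finally show "r ^ q * norm (x q - z q) \<le> wdist M r x y + wdist M r y z" .
qed

lemma measurable_window_entry[measurable]:
  "(\<lambda>x. x q) \<in> borel_measurable (borel :: (nat \<Rightarrow> real ^ 'n) measure)"
  by (rule borel_measurable_continuous_onI) (rule continuous_on_product_coordinates)

lemma continuous_on_eval_bcontfun: "continuous_on UNIV (\<lambda>\<xi> :: 'a::topological_space \<Rightarrow>\<^sub>C 'b::real_normed_vector. apply_bcontfun \<xi> t)"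
  by (rule linear_continuous_on, rule bounded_linear_intro[of _ 1]) (simp_all add: norm_bounded)

lemma measurable_wdist[measurable (raw)]:
  fixes f g :: "'a \<Rightarrow> nat \<Rightarrow> real ^ 'n"
  assumes [measurable]: "f \<in> borel_measurable K" "g \<in> borel_measurable K"
  shows "(\<lambda>x. wdist M r (f x) (g x)) \<in> borel_measurable K"
  unfolding wdist_def by measurable

locale delay_grid =
  fixes \<tau> \<delta> :: real and M :: nat
  assumes delay_pos: "\<tau> > 0" and delay_less: "\<tau> < real M" and step_eq: "\<delta> = \<tau> / real M"
begin

lemma step_pos: "\<delta> > 0" and M_step: "real M * \<delta> = \<tau>" and M_pos: "M > 0"
  using delay_pos delay_less by (auto simp: step_eq)

lemma step_size: "\<delta> \<in> step_sizes \<tau>"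
  using delay_less by (auto simp: step_sizes_def step_eq)

lemma window_index:
  assumes "s \<in> {-\<tau>..0}"
  defines "l \<equiv> min (-1) \<lfloor>s / \<delta>\<rfloor>"
  shows "nat (- l) \<le> M" "nat (- l - 1) \<le> M" "0 \<le> (s - of_int l * \<delta>) / \<delta>" "(s - of_int l * \<delta>) / \<delta> \<le> 1"
    "l \<le> -1"
proof -
  have s: "- real M \<le> s / \<delta>" "s / \<delta> \<le> 0"
    using assms(1) step_pos M_step by (auto simp: field_simps)
  have "- int M \<le> \<lfloor>s / \<delta>\<rfloor>" using s(1) by (simp add: le_floor_iff)
  then have l: "- int M \<le> l" using M_pos by (auto simp: l_def)
  show l1: "l \<le> -1" by (simp add: l_def)
  show "nat (- l) \<le> M" "nat (- l - 1) \<le> M" using l l1 by auto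
  have "of_int l \<le> s / \<delta>" "s / \<delta> \<le> of_int l + 1"
    using s(2) by (auto simp: l_def min_def) linarith+
  then show "0 \<le> (s - of_int l * \<delta>) / \<delta>" "(s - of_int l * \<delta>) / \<delta> \<le> 1"
    using step_pos by (auto simp: field_simps)
qed

lemma clamp_mem: "max (-\<tau>) (min 0 \<theta>) \<in> {-\<tau>..0}"
  using delay_pos by auto

lemma interp_apply:
  "apply_bcontfun (interp \<tau> \<delta> x) \<theta> =
     (let s = max (-\<tau>) (min 0 \<theta>); l = min (-1) \<lfloor>s / \<delta>\<rfloor> in
       x (nat (- l)) + ((s - of_int l * \<delta>) / \<delta>) *\<^sub>R (x (nat (- l - 1)) - x (nat (- l))))"
proof -
  have "\<lfloor>- (of_int l * \<delta>) / \<delta> + 1 / 2\<rfloor> = - l" for l :: int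
    using step_pos by (simp add: floor_eq_iff)
  moreover have "\<lfloor>- ((of_int l + 1) * \<delta>) / \<delta> + 1 / 2\<rfloor> = - l - 1" for l :: int
    using step_pos by (simp add: floor_eq_iff)
  ultimately show ?thesis
    unfolding interp_def em_segment_apply_clamp[OF delay_pos step_size] Let_def by simp
qed

lemma em_segment_eq_interp:
  "em_segment \<tau> \<delta> y k = interp \<tau> \<delta> (\<lambda>q. if q \<le> M then y ((real k - real q) * \<delta>) else 0)"
proof (rule bcontfun_eqI)
  fix \<theta>
  define s where "s = max (-\<tau>) (min 0 \<theta>)"
  define l where "l = min (-1) \<lfloor>s / \<delta>\<rfloor>"
  have s: "s \<in> {-\<tau>..0}" unfolding s_def by (rule clamp_mem)
  have l: "nat (- l) \<le> M" "nat (- l - 1) \<le> M" "l \<le> -1"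
    using window_index[OF s] by (simp_all add: l_def)
  then have r: "real (nat (- l)) = - of_int l" "real (nat (- l - 1)) = - of_int l - 1" by auto
  show "apply_bcontfun (em_segment \<tau> \<delta> y k) \<theta>
      = apply_bcontfun (interp \<tau> \<delta> (\<lambda>q. if q \<le> M then y ((real k - real q) * \<delta>) else 0)) \<theta>"
    unfolding em_segment_apply_clamp[OF delay_pos step_size] interp_apply Let_def s_def[symmetric]
      l_def[symmetric]
    by (simp add: l r algebra_simps)
qed

lemma interp_in_seg_space: "interp \<tau> \<delta> x \<in> seg_space \<tau>"
  unfolding interp_def by (rule em_segment_in_seg_space[OF delay_pos step_size])

lemma interp_at_0: "apply_bcontfun (interp \<tau> \<delta> x) 0 = x 0"
  using step_pos delay_pos by (simp add: interp_apply Let_def)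

lemma norm_interp_diff_le:
  assumes "\<And>q. q \<le> M \<Longrightarrow> norm (x q - y q) \<le> c"
  shows "norm (interp \<tau> \<delta> x - interp \<tau> \<delta> y) \<le> c"
proof (rule norm_bound)
  fix \<theta>
  define s where "s = max (-\<tau>) (min 0 \<theta>)"
  define l where "l = min (-1) \<lfloor>s / \<delta>\<rfloor>"
  define t where "t = (s - of_int l * \<delta>) / \<delta>"
  have s: "s \<in> {-\<tau>..0}" unfolding s_def by (rule clamp_mem)
  note l = window_index[OF s, folded l_def, folded t_def]
  have "apply_bcontfun (interp \<tau> \<delta> x - interp \<tau> \<delta> y) \<theta>
      = (1 - t) *\<^sub>R (x (nat (- l)) - y (nat (- l))) + t *\<^sub>R (x (nat (- l - 1)) - y (nat (- l - 1)))"
  proof -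
    have "u + t *\<^sub>R (v - u) - (u' + t *\<^sub>R (v' - u')) = (1 - t) *\<^sub>R (u - u') + t *\<^sub>R (v - v')"
      for u v u' v' :: "real ^ 'n"
      by (simp add: algebra_simps)
    then show ?thesis
      by (simp only: minus_bcontfun.rep_eq interp_apply Let_def s_def[symmetric] l_def[symmetric] t_def[symmetric])
  qed
  also have "norm \<dots> \<le> (1 - t) * c + t * c"
    using l(3,4) assms[OF l(1)] assms[OF l(2)]
    by (intro order_trans[OF norm_triangle_ineq] add_mono) (auto intro: mult_left_mono)
  finally show "norm (apply_bcontfun (interp \<tau> \<delta> x - interp \<tau> \<delta> y) \<theta>) \<le> c" by (simp add: algebra_simps)
qed

lemma interp_zero: "interp \<tau> \<delta> (\<lambda>_. 0) = 0"
  by (rule bcontfun_eqI) (simp add: interp_apply Let_def)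

lemma norm_interp_diff_le_wdist:
  assumes "0 < r" "r \<le> 1"
  shows "norm (interp \<tau> \<delta> x - interp \<tau> \<delta> y) \<le> wdist M r x y / r ^ M"
proof (rule norm_interp_diff_le)
  fix q assume q: "q \<le> M"
  have "r ^ M * norm (x q - y q) \<le> r ^ q * norm (x q - y q)"
    using assms q by (intro mult_right_mono power_decreasing) auto
  also have "\<dots> \<le> wdist M r x y" by (rule wdist_ge[OF q])
  finally show "norm (x q - y q) \<le> wdist M r x y / r ^ M" using assms by (simp add: field_simps)
qed

lemma wdist_grid_window_le:
  assumes "0 \<le> r" "r \<le> 1"
  shows "wdist M r (grid_window \<delta> M \<xi>) (grid_window \<delta> M \<eta>) \<le> norm (\<xi> - \<eta>)"
  unfolding wdist_le_iff
proof (intro allI impI)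
  fix q assume q: "q \<le> M"
  have "r ^ q * norm (grid_window \<delta> M \<xi> q - grid_window \<delta> M \<eta> q)
      \<le> 1 * norm (apply_bcontfun (\<xi> - \<eta>) (- real q * \<delta>))"
    using assms q by (intro mult_mono power_le_one) (auto simp: grid_window_def)
  also have "\<dots> \<le> norm (\<xi> - \<eta>)" using norm_bounded[of "\<xi> - \<eta>"] by (simp del: minus_bcontfun.rep_eq)
  finally show "r ^ q * norm (grid_window \<delta> M \<xi> q - grid_window \<delta> M \<eta> q) \<le> norm (\<xi> - \<eta>)" .
qed

lemma grid_window_zero: "grid_window \<delta> M 0 = (\<lambda>_. 0)"
  by (auto simp: grid_window_def)

lemma continuous_interp: "continuous_on UNIV (interp \<tau> \<delta>)"
  unfolding continuous_on_def
proof (intro ballI)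
  fix x :: "nat \<Rightarrow> real ^ 'n"
  have ent: "((\<lambda>y. y q) \<longlongrightarrow> x q) (at x)" for q
  proof -
    have "continuous_on UNIV (\<lambda>y :: nat \<Rightarrow> real ^ 'n. y q)" by (rule continuous_on_product_coordinates)
    then show ?thesis by (simp add: continuous_on_def)
  qed
  have "((\<lambda>y. \<Sum>q\<le>M. norm (y q - x q)) \<longlongrightarrow> (\<Sum>q\<le>M. norm (x q - x q))) (at x)"
    by (intro tendsto_intros ent)
  then have lim: "((\<lambda>y. \<Sum>q\<le>M. norm (y q - x q)) \<longlongrightarrow> 0) (at x)" by simp
  have le: "norm (interp \<tau> \<delta> y - interp \<tau> \<delta> x) \<le> (\<Sum>q\<le>M. norm (y q - x q))" for y
  proof (rule norm_interp_diff_le)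
    fix q assume "q \<le> M"
    then show "norm (y q - x q) \<le> (\<Sum>q\<le>M. norm (y q - x q))"
      by (intro member_le_sum) auto
  qed
  have "((\<lambda>y. interp \<tau> \<delta> y - interp \<tau> \<delta> x) \<longlongrightarrow> 0) (at x)"
    by (rule Lim_null_comparison[OF always_eventually lim]) (use le in auto)
  then show "(interp \<tau> \<delta> \<longlongrightarrow> interp \<tau> \<delta> x) (at x)"
    by (rule LIM_zero_cancel)
qed

lemma grid_window_measurable[measurable]:
  "grid_window \<delta> M \<in> borel_measurable (borel :: (real \<Rightarrow>\<^sub>C (real ^ 'n)) measure)"
proof (rule measurable_coordinatewise_then_product)
  fix q
  show "(\<lambda>\<xi>. grid_window \<delta> M \<xi> q) \<in> borel_measurable (borel :: (real \<Rightarrow>\<^sub>C (real ^ 'n)) measure)"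
    by (rule borel_measurable_continuous_onI) (cases "q \<le> M", simp_all add: grid_window_def continuous_on_eval_bcontfun)
qed

lemma em_window_0: "em_window \<tau> \<delta> M b \<sigma> w \<kappa> \<xi> 0 = grid_window \<delta> M \<xi>"
  using step_pos by (auto simp: em_window_def grid_window_def em_process_initial mult_le_0_iff)

lemma em_segment_em_process:
  "em_segment \<tau> \<delta> (em_process \<tau> \<delta> b \<sigma> w \<kappa> \<xi>) k = interp \<tau> \<delta> (em_window \<tau> \<delta> M b \<sigma> w \<kappa> \<xi> k)"
  unfolding em_segment_eq_interp em_window_def[abs_def] ..

lemma em_window_Suc:
  "em_window \<tau> \<delta> M b \<sigma> w \<kappa> \<xi> (Suc k) =
     window_step \<tau> \<delta> M b \<sigma> (em_window \<tau> \<delta> M b \<sigma> w \<kappa> \<xi> k) (\<kappa> (real k * \<delta>))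
       (w (real (Suc k) * \<delta>) - w (real k * \<delta>))"
proof
  fix q
  have mem: "real (Suc k) * \<delta> \<in> {real k * \<delta>..real (Suc k) * \<delta>}" using step_pos by simp
  have "(real (Suc k) - real q) = real k - real (q - 1)" if "q \<noteq> 0" using that by auto
  then show "em_window \<tau> \<delta> M b \<sigma> w \<kappa> \<xi> (Suc k) q =
     window_step \<tau> \<delta> M b \<sigma> (em_window \<tau> \<delta> M b \<sigma> w \<kappa> \<xi> k) (\<kappa> (real k * \<delta>))
       (w (real (Suc k) * \<delta>) - w (real k * \<delta>)) q"
    using em_process_step[OF step_pos mem, of \<tau> b \<sigma> w \<kappa> \<xi>]
    by (cases "q = 0") (auto simp: window_step_def em_window_def em_segment_em_process algebra_simps)
qed

text \<open>The same noise drives both windows and cancels in their difference, so that the Lipschitz constant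
  is \<open>exp (\<delta> (\<alpha> + exp (- a \<tau>) \<beta> + O(\<delta>)) / 2)\<close>.  The weight \<open>exp (a q \<delta> / 2)\<close> of an entry of age \<open>q\<close>
  balances two effects.  An entry that grows older by one step costs the factor \<open>exp (a \<delta> / 2)\<close>, which
  because of \<open>a \<le> \<alpha>\<close> is no larger than the factor for the new entry; and the unweighted supremum
  norm in the one-sided Lipschitz condition exceeds the weighted one at most by \<open>exp (- a \<tau> / 2)\<close>.\<close>

lemma wdist_window_step:
  fixes b :: "(real \<Rightarrow>\<^sub>C (real ^ 'n)) \<Rightarrow> 's \<Rightarrow> real ^ 'n"
  assumes mono: "\<And>\<xi> \<eta>. \<xi> \<in> seg_space \<tau> \<Longrightarrow> \<eta> \<in> seg_space \<tau> \<Longrightarrow>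
          2 * ((apply_bcontfun \<xi> 0 - apply_bcontfun \<eta> 0) \<bullet> (b \<xi> i - b \<eta> i))
            \<le> \<alpha> * (norm (apply_bcontfun \<xi> 0 - apply_bcontfun \<eta> 0))\<^sup>2 + \<beta> * (norm (\<xi> - \<eta>))\<^sup>2"
    and lip: "\<And>\<xi> \<eta>. \<xi> \<in> seg_space \<tau> \<Longrightarrow> \<eta> \<in> seg_space \<tau> \<Longrightarrow>
          norm (b \<xi> i - b \<eta> i) \<le> L * norm (\<xi> - \<eta>)"
    and \<beta>: "\<beta> \<ge> 0" and a: "a \<le> \<alpha>" "a \<le> 0"
  defines "r \<equiv> exp (a * \<delta> / 2)"
  shows "wdist M r (window_step \<tau> \<delta> M b \<sigma> x i z) (window_step \<tau> \<delta> M b \<sigma> y i z)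
     \<le> exp (\<delta> / 2 * (\<alpha> + (\<beta> + \<delta> * L\<^sup>2) * exp (- a * \<tau> - a * \<delta>))) * wdist M r x y"
proof -
  have r: "0 < r" "r \<le> 1" using a(2) step_pos by (auto simp: r_def mult_nonpos_nonneg)
  define D where "D = wdist M r x y"
  have D: "D \<ge> 0" using r by (simp add: D_def wdist_nonneg)
  define X where "X = \<delta> * (\<beta> + \<delta> * L\<^sup>2) * exp (- a * \<tau>)"
  have X: "X \<ge> 0" using step_pos \<beta> by (simp add: X_def)
  define c where "c = exp (\<delta> / 2 * (\<alpha> + (\<beta> + \<delta> * L\<^sup>2) * exp (- a * \<tau> - a * \<delta>)))"
  have c2: "c\<^sup>2 = exp (\<delta> * \<alpha>) * exp (X * exp (- a * \<delta>))"
  proof -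
    have "exp (- a * \<tau> - a * \<delta>) = exp (- a * \<tau>) * exp (- a * \<delta>)" by (simp add: mult_exp_exp)
    then have "2 * (\<delta> / 2 * (\<alpha> + (\<beta> + \<delta> * L\<^sup>2) * exp (- a * \<tau> - a * \<delta>))) = \<delta> * \<alpha> + X * exp (- a * \<delta>)"
      by (simp add: X_def distrib_left mult.assoc)
    then show ?thesis by (simp only: c_def exp_double[symmetric] exp_add)
  qed
  have rM: "r ^ M = exp (a * \<tau> / 2)"
    unfolding r_def exp_of_nat_mult[symmetric] using M_step by (simp add: algebra_simps)
  define Ix where "Ix = interp \<tau> \<delta> x"
  define Iy where "Iy = interp \<tau> \<delta> y"
  define N where "N = norm (Ix - Iy)"
  have "N \<le> D / r ^ M" unfolding N_def D_def Ix_def Iy_def by (rule norm_interp_diff_le_wdist[OF r])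
  then have "N \<le> D * exp (- a * \<tau> / 2)" by (simp add: rM exp_minus field_simps)
  then have "N\<^sup>2 \<le> (D * exp (- a * \<tau> / 2))\<^sup>2" by (intro power_mono) (auto simp: N_def)
  also have "\<dots> = exp (- a * \<tau>) * D\<^sup>2" by (simp add: power_mult_distrib flip: exp_double)
  finally have N2: "N\<^sup>2 \<le> exp (- a * \<tau>) * D\<^sup>2" .
  define z0 where "z0 = x 0 - y 0"
  define B where "B = b Ix i - b Iy i"
  have seg: "Ix \<in> seg_space \<tau>" "Iy \<in> seg_space \<tau>" by (simp_all add: Ix_def Iy_def interp_in_seg_space)
  have z0: "norm z0 \<le> D" using wdist_ge[of 0 M r x y] by (simp add: z0_def D_def)
  have B: "norm B \<le> L * N" unfolding B_def N_def by (rule lip[OF seg])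
  have inn: "2 * (z0 \<bullet> B) \<le> \<alpha> * (norm z0)\<^sup>2 + \<beta> * N\<^sup>2"
    using mono[OF seg] by (simp add: Ix_def Iy_def interp_at_0 z0_def N_def B_def)
  have "(norm (z0 + \<delta> *\<^sub>R B))\<^sup>2 = (norm z0)\<^sup>2 + \<delta> * (2 * (z0 \<bullet> B)) + \<delta>\<^sup>2 * (norm B)\<^sup>2"
    unfolding power2_norm_eq_inner
    by (simp add: inner_add_left inner_add_right inner_commute[of B z0] power2_eq_square algebra_simps)
  also have "\<dots> \<le> (norm z0)\<^sup>2 + \<delta> * (\<alpha> * (norm z0)\<^sup>2 + \<beta> * N\<^sup>2) + \<delta>\<^sup>2 * (L * N)\<^sup>2"
    using inn B step_pos by (intro add_mono mult_left_mono power_mono) auto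
  also have "\<dots> = (1 + \<delta> * \<alpha>) * (norm z0)\<^sup>2 + \<delta> * (\<beta> + \<delta> * L\<^sup>2) * N\<^sup>2"
    by (simp add: algebra_simps power2_eq_square)
  also have "\<dots> \<le> exp (\<delta> * \<alpha>) * (norm z0)\<^sup>2 + \<delta> * (\<beta> + \<delta> * L\<^sup>2) * (exp (- a * \<tau>) * D\<^sup>2)"
    using N2 step_pos \<beta> exp_ge_add_one_self[of "\<delta> * \<alpha>"] by (intro add_mono mult_right_mono mult_left_mono) auto
  also have "\<dots> \<le> exp (\<delta> * \<alpha>) * D\<^sup>2 + X * D\<^sup>2"
    using z0 by (auto simp: X_def mult.assoc intro!: mult_left_mono power_mono)
  also have "\<dots> \<le> exp (\<delta> * \<alpha>) * D\<^sup>2 + exp (\<delta> * \<alpha>) * exp (- a * \<delta>) * X * D\<^sup>2"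
  proof -
    have "1 \<le> exp (\<delta> * \<alpha>) * exp (- a * \<delta>)"
      using a(1) step_pos by (simp add: mult_exp_exp algebra_simps)
    then have "1 * (X * D\<^sup>2) \<le> exp (\<delta> * \<alpha>) * exp (- a * \<delta>) * (X * D\<^sup>2)"
      using X by (intro mult_right_mono) auto
    then show ?thesis by (simp add: algebra_simps)
  qed
  also have "\<dots> = exp (\<delta> * \<alpha>) * (1 + X * exp (- a * \<delta>)) * D\<^sup>2" by (simp add: algebra_simps)
  also have "\<dots> \<le> exp (\<delta> * \<alpha>) * exp (X * exp (- a * \<delta>)) * D\<^sup>2"
    by (intro mult_right_mono mult_left_mono exp_ge_add_one_self) auto
  also have "\<dots> = (c * D)\<^sup>2" by (simp add: c2 power_mult_distrib)
  finally have new: "norm (z0 + \<delta> *\<^sub>R B) \<le> c * D"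
    by (rule power2_le_imp_le) (intro mult_nonneg_nonneg D, simp add: c_def)
  have rc: "r \<le> c"
  proof -
    have "a * \<delta> / 2 \<le> \<delta> / 2 * \<alpha>" using a(1) step_pos by (simp add: mult.commute)
    also have "\<dots> \<le> \<delta> / 2 * (\<alpha> + (\<beta> + \<delta> * L\<^sup>2) * exp (- a * \<tau> - a * \<delta>))"
      using step_pos \<beta> by (intro mult_left_mono) auto
    finally show ?thesis by (simp add: r_def c_def)
  qed
  show ?thesis
    unfolding c_def[symmetric] D_def[symmetric] wdist_le_iff
  proof (intro allI impI)
    fix q assume q: "q \<le> M"
    let ?x = "window_step \<tau> \<delta> M b \<sigma> x i z" and ?y = "window_step \<tau> \<delta> M b \<sigma> y i z"
    show "r ^ q * norm (?x q - ?y q) \<le> c * D"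
    proof (cases "q = 0")
      case True
      then have "?x q - ?y q = z0 + \<delta> *\<^sub>R B"
        by (simp add: window_step_def z0_def B_def Ix_def Iy_def algebra_simps)
      then show ?thesis using new True by simp
    next
      case False
      then have "r ^ q * norm (?x q - ?y q) = r * (r ^ (q - 1) * norm (x (q - 1) - y (q - 1)))"
        using q by (cases q) (auto simp: window_step_def)
      also have "\<dots> \<le> r * D" unfolding D_def using r q by (intro mult_left_mono wdist_ge) auto
      also have "\<dots> \<le> c * D" using rc D by (rule mult_right_mono)
      finally show ?thesis .
    qed
  qed
qed

end

section \<open>Contraction and moments of the discrete scheme\<close>

text \<open>A nonnegative potential that turns Doob's maximal inequality into a one-step estimate: if \<open>m\<close>
  is the running maximum of \<open>norm S\<close>, then one step of \<open>S\<close> increases the potential at most by a linear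
  term in the increment, which has mean zero, and by its square.\<close>

definition doob_potential :: "real ^ 'n \<Rightarrow> real \<Rightarrow> real" where
  "doob_potential S m = m\<^sup>2 / 2 - \<bar>m\<bar> * norm S + (norm S)\<^sup>2"

lemma doob_potential_ge: "m\<^sup>2 / 4 \<le> doob_potential S m"
proof -
  have "doob_potential S m - m\<^sup>2 / 4 = (\<bar>m\<bar> / 2 - norm S)\<^sup>2"
    by (simp add: doob_potential_def power2_eq_square algebra_simps)
  then show ?thesis by (smt (verit) zero_le_power2)
qed

lemma doob_potential_step:
  "doob_potential (S + D) (max \<bar>m\<bar> (norm (S + D)))
     \<le> doob_potential S m + (2 *\<^sub>R S - (\<bar>m\<bar> / norm S) *\<^sub>R S) \<bullet> D + (norm D)\<^sup>2"
proof -
  let ?m = "\<bar>m\<bar>" and ?r' = "norm (S + D)"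
  have sq: "?r'\<^sup>2 = (norm S)\<^sup>2 + 2 * (S \<bullet> D) + (norm D)\<^sup>2"
    unfolding power2_norm_eq_inner by (simp add: inner_add_left inner_add_right inner_commute)
  have conv: "norm S + (S \<bullet> D) / norm S \<le> ?r'"
  proof (cases "S = 0")
    case False
    have "(norm S)\<^sup>2 + S \<bullet> D = S \<bullet> (S + D)"
      by (simp add: power2_norm_eq_inner inner_add_right)
    also have "\<dots> \<le> norm S * ?r'" by (rule norm_cauchy_schwarz)
    finally have "((norm S)\<^sup>2 + S \<bullet> D) / norm S \<le> norm S * ?r' / norm S"
      by (rule divide_right_mono) simp
    then show ?thesis using False by (simp add: add_divide_distrib power2_eq_square)
  qed simp
  have "doob_potential (S + D) (max ?m ?r') \<le> m\<^sup>2 / 2 - ?m * ?r' + ?r'\<^sup>2"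
  proof (cases "?r' \<le> ?m")
    case True
    then show ?thesis by (simp add: doob_potential_def max_absorb1)
  next
    case False
    then have "doob_potential (S + D) (max ?m ?r') = ?r'\<^sup>2 / 2"
      by (simp add: doob_potential_def max_absorb2 power2_eq_square)
    moreover have "0 \<le> (?m - ?r')\<^sup>2 / 2" by simp
    ultimately show ?thesis by (simp add: power2_eq_square algebra_simps)
  qed
  also have "\<dots> \<le> m\<^sup>2 / 2 - ?m * (norm S + (S \<bullet> D) / norm S) + ?r'\<^sup>2"
    using mult_left_mono[OF conv, of ?m] by simp
  also have "\<dots> = doob_potential S m + (2 *\<^sub>R S - (?m / norm S) *\<^sub>R S) \<bullet> D + (norm D)\<^sup>2"
    unfolding sq doob_potential_def by (simp add: inner_diff_left algebra_simps)
  finally show ?thesis .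
qed

abbreviation together :: "('x \<times> 's) \<times> ('x \<times> 's) \<Rightarrow> bool" where
  "together z \<equiv> snd (fst z) = snd (snd z)"

abbreviation apart :: "('x \<times> 's) \<times> ('x \<times> 's) \<Rightarrow> bool" where
  "apart z \<equiv> snd (fst z) \<noteq> snd (snd z)"

text \<open>One step is driven by a random map of the finite state space, whose values at different states
  are independent, and by the increment of the driving path.  Applying the same random map
  to two states moves two chains independently until they meet and together afterwards.\<close>

locale em_chain = delay_grid \<tau> \<delta> M for \<tau> \<delta> :: real and M :: nat +
  fixes b :: "(real \<Rightarrow>\<^sub>C (real ^ 'n)) \<Rightarrow> 's::finite \<Rightarrow> real ^ 'n"
    and \<sigma> :: "'s \<Rightarrow> real ^ 'm ^ 'n"
    and L :: real
    and P :: "'s \<Rightarrow> 's pmf"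
    and \<gamma> :: "(real ^ 'm) measure"
  assumes L_pos: "L > 0"
    and lipschitz: "\<And>i \<xi> \<eta>. \<xi> \<in> seg_space \<tau> \<Longrightarrow> \<eta> \<in> seg_space \<tau> \<Longrightarrow>
          norm (b \<xi> i - b \<eta> i) \<le> L * norm (\<xi> - \<eta>)"
    and increment_prob: "prob_space \<gamma>"
    and increment_sets: "sets \<gamma> = sets borel"
    and increment_integrable: "\<And>c. integrable \<gamma> (\<lambda>z. c \<bullet> z)"
    and increment_mean: "\<And>c. (\<integral>z. c \<bullet> z \<partial>\<gamma>) = 0"
    and increment_square_integrable: "integrable \<gamma> (\<lambda>z. (norm z)\<^sup>2)"
    and increment_square: "(\<integral>z. (norm z)\<^sup>2 \<partial>\<gamma>) \<le> real CARD('m) * \<delta>"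
begin

abbreviation next_window :: "(nat \<Rightarrow> real ^ 'n) \<Rightarrow> 's \<Rightarrow> real ^ 'm \<Rightarrow> nat \<Rightarrow> real ^ 'n" where
  "next_window \<equiv> window_step \<tau> \<delta> M b \<sigma>"

definition noise :: "(('s \<Rightarrow> 's) \<times> (real ^ 'm)) measure" where
  "noise = measure_pmf (Pi_pmf UNIV undefined P) \<Otimes>\<^sub>M \<gamma>"

definition states :: "((nat \<Rightarrow> real ^ 'n) \<times> 's) measure" where
  "states = borel \<Otimes>\<^sub>M count_space UNIV"

definition em_map :: "(nat \<Rightarrow> real ^ 'n) \<times> 's \<Rightarrow> ('s \<Rightarrow> 's) \<times> (real ^ 'm) \<Rightarrow> (nat \<Rightarrow> real ^ 'n) \<times> 's" where
  "em_map p a = (next_window (fst p) (snd p) (snd a), fst a (snd p))"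

abbreviation pair_expect :: "nat \<Rightarrow> (((nat \<Rightarrow> real ^ 'n) \<times> 's) \<times> ((nat \<Rightarrow> real ^ 'n) \<times> 's) \<Rightarrow> ennreal) \<Rightarrow>
    ((nat \<Rightarrow> real ^ 'n) \<times> 's) \<times> ((nat \<Rightarrow> real ^ 'n) \<times> 's) \<Rightarrow> ennreal" where
  "pair_expect \<equiv> iter_expect noise (pair_map em_map)"

sublocale increment: prob_space \<gamma> by (rule increment_prob)

sublocale joint: pair_prob_space "measure_pmf (Pi_pmf UNIV undefined P)" \<gamma> ..

declare increment_sets[measurable_cong]

lemma sets_states[measurable_cong]: "sets states = sets (borel \<Otimes>\<^sub>M count_space UNIV)"
  by (simp add: states_def)

lemma sets_noise[measurable_cong]: "sets noise = sets (count_space UNIV \<Otimes>\<^sub>M borel)"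
  unfolding noise_def by (rule sets_pair_measure_cong) (simp_all add: increment_sets)

lemma space_increment: "space \<gamma> = UNIV"
  using sets_eq_imp_space_eq[OF increment_sets] by simp

lemma space_noise: "space noise = UNIV"
  by (simp add: noise_def space_pair_measure space_increment)

lemma space_states: "space states = UNIV"
  by (simp add: states_def space_pair_measure)

lemma prob_noise: "prob_space noise"
  unfolding noise_def by (rule joint.prob_space_axioms)

lemma continuous_drift: "continuous_on UNIV (\<lambda>x. b (interp \<tau> \<delta> x) i)"
proof (rule continuous_on_compose2[OF _ continuous_interp])
  have "L-lipschitz_on (seg_space \<tau>) (\<lambda>\<xi>. b \<xi> i)"
    using lipschitz L_pos by (intro lipschitz_onI) (auto simp: dist_norm)
  then show "continuous_on (seg_space \<tau>) (\<lambda>\<xi>. b \<xi> i)" by (rule lipschitz_on_continuous_on)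
qed (auto simp: interp_in_seg_space)

lemma measurable_drift[measurable]: "(\<lambda>x. b (interp \<tau> \<delta> x) i) \<in> borel_measurable borel"
  by (rule borel_measurable_continuous_onI) (rule continuous_drift)

lemma measurable_diffusion[measurable]: "(\<lambda>z. \<sigma> i *v z) \<in> borel_measurable borel"
  by (rule borel_measurable_continuous_onI) (intro linear_continuous_on matrix_vector_mul_bounded_linear)

lemma measurable_window_step_fixed:
  "(\<lambda>w. next_window (fst w) i (snd w)) \<in> borel_measurable (borel \<Otimes>\<^sub>M borel)"
proof (rule measurable_coordinatewise_then_product)
  fix q
  show "(\<lambda>w. next_window (fst w) i (snd w) q)
      \<in> borel_measurable ((borel :: (nat \<Rightarrow> real ^ 'n) measure) \<Otimes>\<^sub>M (borel :: (real ^ 'm) measure))"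
    unfolding window_step_def by measurable
qed

lemma measurable_window_step[measurable (raw)]:
  assumes [measurable]: "f \<in> borel_measurable K" "g \<in> K \<rightarrow>\<^sub>M count_space UNIV" "h \<in> borel_measurable K"
  shows "(\<lambda>w. next_window (f w) (g w) (h w)) \<in> borel_measurable K"
proof (rule measurable_compose_countable[where g = g])
  fix i
  show "(\<lambda>w. next_window (f w) i (h w)) \<in> borel_measurable K"
    using measurable_compose[OF _ measurable_window_step_fixed, of "\<lambda>w. (f w, h w)" K i] by simp
qed simp

lemma measurable_em_map: "case_prod em_map \<in> states \<Otimes>\<^sub>M noise \<rightarrow>\<^sub>M states"
proof -
  have "(\<lambda>w. (fst (snd w)) (snd (fst w))) \<in> states \<Otimes>\<^sub>M noise \<rightarrow>\<^sub>M count_space UNIV"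
  proof (rule measurable_compose_countable[where g = "\<lambda>w. snd (fst w)" and f = "\<lambda>i w. fst (snd w) i"])
    fix i
    show "(\<lambda>w. fst (snd w) i) \<in> states \<Otimes>\<^sub>M noise \<rightarrow>\<^sub>M count_space UNIV"
      by (rule measurable_compose[of "\<lambda>w. fst (snd w)" _ "count_space UNIV"]) measurable
  qed measurable
  then show ?thesis
    unfolding em_map_def case_prod_beta' by measurable
qed

sublocale random_maps noise states em_map
  by (intro random_maps.intro prob_noise random_maps_axioms.intro space_noise space_states measurable_em_map)

lemma nn_integral_noise_map:
  "(\<integral>\<^sup>+a. h (fst a i) \<partial>noise) = (\<Sum>j\<in>UNIV. h j * ennreal (pmf (P i) j))"
proof -
  have "(\<integral>\<^sup>+a. h (fst a i) \<partial>noise) = (\<integral>\<^sup>+\<theta>. h (\<theta> i) \<partial>measure_pmf (Pi_pmf UNIV undefined P))"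
  proof -
    have [measurable]: "(\<lambda>a. h (fst a i)) \<in> borel_measurable (measure_pmf (Pi_pmf UNIV undefined P) \<Otimes>\<^sub>M \<gamma>)"
      by (rule measurable_compose[OF measurable_fst]) simp
    show ?thesis
      unfolding noise_def
      by (subst increment.nn_integral_fst[symmetric]) (simp_all add: increment.emeasure_space_1)
  qed
  also have "\<dots> = (\<integral>\<^sup>+j. h j \<partial>map_pmf (\<lambda>\<theta>. \<theta> i) (Pi_pmf UNIV undefined P))" by simp
  also have "\<dots> = (\<integral>\<^sup>+j. h j \<partial>P i)" by (subst Pi_pmf_component) simp_all
  also have "\<dots> = (\<Sum>j\<in>UNIV. h j * ennreal (pmf (P i) j))"
    by (rule nn_integral_measure_pmf_support) simp_all
  finally show ?thesis .
qed

subsection \<open>Doob's inequality and moments on bounded time intervals\<close>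

text \<open>The scheme, augmented by the accumulated noise and the running maximum of its norm.\<close>

definition doob_map :: "((nat \<Rightarrow> real ^ 'n) \<times> 's) \<times> ((real ^ 'n) \<times> real) \<Rightarrow> ('s \<Rightarrow> 's) \<times> (real ^ 'm) \<Rightarrow>
    ((nat \<Rightarrow> real ^ 'n) \<times> 's) \<times> ((real ^ 'n) \<times> real)" where
  "doob_map e a = (em_map (fst e) a,
     (let S = fst (snd e) + \<sigma> (snd (fst e)) *v snd a in (S, max \<bar>snd (snd e)\<bar> (norm S))))"

lemma random_maps_doob: "random_maps noise (states \<Otimes>\<^sub>M borel) doob_map"
proof (intro random_maps.intro prob_noise random_maps_axioms.intro space_noise)
  show "space (states \<Otimes>\<^sub>M borel :: (((nat \<Rightarrow> real ^ 'n) \<times> 's) \<times> ((real ^ 'n) \<times> real)) measure) = UNIV"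
    by (simp add: space_pair_measure space_states)
  have [measurable]: "(\<lambda>w. \<sigma> (snd (fst (fst w))) *v snd (snd w))
      \<in> borel_measurable ((states \<Otimes>\<^sub>M (borel :: ((real ^ 'n) \<times> real) measure)) \<Otimes>\<^sub>M noise)"
    by (rule measurable_compose_countable[where g = "\<lambda>w. snd (fst (fst w))"
          and f = "\<lambda>i w. \<sigma> i *v snd (snd w)"]) measurable
  have [measurable]: "fst \<in> borel_measurable (borel :: ((real ^ 'n) \<times> real) measure)"
    "snd \<in> borel_measurable (borel :: ((real ^ 'n) \<times> real) measure)"
    by (auto intro!: borel_measurable_continuous_onI continuous_intros)
  show "case_prod doob_map \<in> (states \<Otimes>\<^sub>M borel) \<Otimes>\<^sub>M noise \<rightarrow>\<^sub>M states \<Otimes>\<^sub>M borel"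
    unfolding doob_map_def case_prod_beta' Let_def by measurable
qed

lemma nn_integral_doob_potential:
  assumes s: "\<And>i z. norm (\<sigma> i *v z) \<le> s * norm z" "0 \<le> s"
  shows "(\<integral>\<^sup>+a. ennreal (doob_potential (fst (snd (doob_map e a))) (snd (snd (doob_map e a)))) \<partial>noise)
    \<le> ennreal (doob_potential (fst (snd e)) (snd (snd e))) + ennreal (s\<^sup>2 * real CARD('m) * \<delta>)"
proof -
  obtain x i S m where e: "e = ((x, i), (S, m))" by (metis surj_pair)
  define c where "c = transpose (\<sigma> i) *v (2 *\<^sub>R S - (\<bar>m\<bar> / norm S) *\<^sub>R S)"
  have W0: "doob_potential S m \<ge> 0"
    using doob_potential_ge[of m S] by (smt (verit) divide_nonneg_nonneg zero_le_power2)
  define f where "f z = doob_potential S m + c \<bullet> z + s\<^sup>2 * (norm z)\<^sup>2" for z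
  have bnd: "doob_potential (S + \<sigma> i *v z) (max \<bar>m\<bar> (norm (S + \<sigma> i *v z))) \<le> f z" for z
  proof -
    have "(norm (\<sigma> i *v z))\<^sup>2 \<le> (s * norm z)\<^sup>2" using s by (intro power_mono) auto
    moreover have "(2 *\<^sub>R S - (\<bar>m\<bar> / norm S) *\<^sub>R S) \<bullet> (\<sigma> i *v z) = c \<bullet> z"
      unfolding c_def by (simp add: dot_lmul_matrix[symmetric] transpose_matrix_vector)
    ultimately show ?thesis
      using doob_potential_step[of S "\<sigma> i *v z" m] by (simp add: f_def power_mult_distrib)
  qed
  have f0: "0 \<le> f z" for z
    using bnd[of z] doob_potential_ge[of "max \<bar>m\<bar> (norm (S + \<sigma> i *v z))" "S + \<sigma> i *v z"]
    by (smt (verit) divide_nonneg_nonneg zero_le_power2)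
  have int: "integrable \<gamma> f" unfolding f_def
    using increment_integrable increment_square_integrable
    by (intro Bochner_Integration.integrable_add) (simp_all add: increment.integrable_const)
  have "(\<integral>\<^sup>+a. ennreal (doob_potential (fst (snd (doob_map e a))) (snd (snd (doob_map e a)))) \<partial>noise)
      \<le> (\<integral>\<^sup>+a. ennreal (f (snd a)) \<partial>noise)"
    using bnd by (intro nn_integral_mono) (auto simp: e doob_map_def Let_def intro!: ennreal_leI)
  also have "\<dots> = (\<integral>\<^sup>+z. ennreal (f z) \<partial>\<gamma>)"
  proof -
    have [measurable]: "f \<in> borel_measurable borel" using int increment_sets
      by (metis borel_measurable_integrable measurable_cong_sets)
    show ?thesis
      unfolding noise_def
      by (subst increment.nn_integral_fst[symmetric]) (simp_all add: measure_pmf.emeasure_space_1)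
  qed
  also have "\<dots> = ennreal (\<integral>z. f z \<partial>\<gamma>)" using f0 by (intro nn_integral_eq_integral int) auto
  also have "(\<integral>z. f z \<partial>\<gamma>) = doob_potential S m + s\<^sup>2 * (\<integral>z. (norm z)\<^sup>2 \<partial>\<gamma>)"
    unfolding f_def using increment_integrable increment_square_integrable increment_mean[of c]
    by (subst Bochner_Integration.integral_add)
       (auto simp: increment.integrable_const increment.prob_space)
  also have "ennreal \<dots> \<le> ennreal (doob_potential S m + s\<^sup>2 * real CARD('m) * \<delta>)"
    using increment_square by (intro ennreal_leI) (auto simp: mult.assoc intro: mult_left_mono)
  also have "\<dots> = ennreal (doob_potential S m) + ennreal (s\<^sup>2 * real CARD('m) * \<delta>)"
    using W0 step_pos by (intro ennreal_plus) auto
  finally show ?thesis by (simp add: e)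
qed

end

context em_chain begin

text \<open>Up to a bounded time the scheme started from zero is controlled by the running maximum \<open>m\<close> of
  the accumulated noise \<open>S\<close>: the difference \<open>x 0 - S\<close> obeys a discrete Gronwall inequality, and the
  form of the invariant is chosen such that \<open>K + norm (x q)\<close> grows exactly by the factor
  \<open>1 + L \<delta>\<close>.\<close>

lemma moment_from_zero:
  assumes s: "\<And>i z. norm (\<sigma> i *v z) \<le> s * norm z" "0 \<le> s"
    and K: "\<And>i. norm (b 0 i) \<le> L * K" "0 \<le> K"
    and r: "0 \<le> r" "r \<le> 1"
  shows "iter_expect noise em_map k (\<lambda>p. ennreal (wdist M r (fst p) (\<lambda>_. 0))) (\<lambda>_. 0, i)
    \<le> ennreal (exp (L * \<delta> * real k) * (K + 1 + s\<^sup>2 * real CARD('m) * \<delta> * real k))"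
proof -
  interpret D: random_maps noise "states \<Otimes>\<^sub>M borel" doob_map by (rule random_maps_doob)
  define G where "G = 1 + L * \<delta>"
  have G: "G \<ge> 1" using L_pos step_pos by (simp add: G_def)
  define J where "J l e \<longleftrightarrow> 0 \<le> snd (snd e) \<and> norm (fst (snd e)) \<le> snd (snd e) \<and>
      (\<forall>q\<le>M. norm (fst (fst e) q) \<le> G ^ l * (K + snd (snd e)) - K) \<and>
      norm (fst (fst e) 0 - fst (snd e)) \<le> (G ^ l - 1) * (K + snd (snd e))"
    for l :: nat and e :: "((nat \<Rightarrow> real ^ 'n) \<times> 's) \<times> ((real ^ 'n) \<times> real)"
  have J_step: "J (Suc l) (doob_map e a)" if J: "J l e" for l e a
  proof -
    obtain x i S m where e: "e = ((x, i), (S, m))" by (metis surj_pair)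
    define S' where "S' = S + \<sigma> i *v snd a"
    define m' where "m' = max m (norm S')"
    have m: "0 \<le> m" "norm S \<le> m" and x: "\<And>q. q \<le> M \<Longrightarrow> norm (x q) \<le> G ^ l * (K + m) - K"
      and d: "norm (x 0 - S) \<le> (G ^ l - 1) * (K + m)"
      using J by (auto simp: J_def e)
    have m': "m \<le> m'" "norm S' \<le> m'" by (auto simp: m'_def)
    have Gl: "1 \<le> G ^ l" using G by simp
    have "norm (interp \<tau> \<delta> x - interp \<tau> \<delta> (\<lambda>_. 0)) \<le> G ^ l * (K + m) - K"
      by (rule norm_interp_diff_le) (simp add: x)
    then have "norm (interp \<tau> \<delta> x) \<le> G ^ l * (K + m) - K" by (simp add: interp_zero)
    moreover have "norm (b (interp \<tau> \<delta> x) i) \<le> norm (b 0 i) + norm (b (interp \<tau> \<delta> x) i - b 0 i)"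
      by (metis add.commute diff_add_cancel norm_triangle_ineq)
    moreover have "norm (b (interp \<tau> \<delta> x) i - b 0 i) \<le> L * norm (interp \<tau> \<delta> x)"
      using lipschitz[of "interp \<tau> \<delta> x" 0 i] interp_in_seg_space[of x]
        interp_in_seg_space[of "\<lambda>_. 0 :: real ^ 'n"] by (simp add: interp_zero)
    ultimately have "norm (b (interp \<tau> \<delta> x) i) \<le> L * K + L * (G ^ l * (K + m) - K)"
      using K(1)[of i] L_pos by (smt (verit) mult_left_mono)
    then have drift: "norm (b (interp \<tau> \<delta> x) i) \<le> L * (G ^ l * (K + m))" by (simp add: algebra_simps)
    have *: "G ^ Suc l * (K + m) \<le> G ^ Suc l * (K + m')" "(G ^ Suc l - 1) * (K + m) \<le> (G ^ Suc l - 1) * (K + m')"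
      using m' G by (auto intro!: mult_left_mono simp: one_le_power mult_ge1_I)
    have "norm (x 0 + \<delta> *\<^sub>R b (interp \<tau> \<delta> x) i - S) \<le> norm (x 0 - S) + norm (\<delta> *\<^sub>R b (interp \<tau> \<delta> x) i)"
      using norm_triangle_ineq[of "x 0 - S" "\<delta> *\<^sub>R b (interp \<tau> \<delta> x) i"] by (simp add: algebra_simps)
    also have "\<dots> \<le> (G ^ l - 1) * (K + m) + \<delta> * (L * (G ^ l * (K + m)))"
      using d drift step_pos by (intro add_mono) (auto intro: mult_left_mono)
    also have "\<dots> = (G ^ Suc l - 1) * (K + m)" by (simp add: G_def algebra_simps)
    finally have new: "norm (x 0 + \<delta> *\<^sub>R b (interp \<tau> \<delta> x) i - S) \<le> (G ^ Suc l - 1) * (K + m')"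
      using * by simp
    let ?x0 = "x 0 + \<delta> *\<^sub>R b (interp \<tau> \<delta> x) i + \<sigma> i *v snd a"
    have new': "norm (?x0 - S') \<le> (G ^ Suc l - 1) * (K + m')"
      using new by (simp add: S'_def algebra_simps)
    have "norm ?x0 \<le> norm (?x0 - S') + norm S'" by (metis diff_add_cancel norm_triangle_ineq)
    also have "\<dots> \<le> (G ^ Suc l - 1) * (K + m') + m'" using new' m' by simp
    also have "\<dots> = G ^ Suc l * (K + m') - K" by (simp add: algebra_simps)
    finally have head: "norm ?x0 \<le> G ^ Suc l * (K + m') - K" .
    have tail: "norm (x q) \<le> G ^ Suc l * (K + m') - K" if "q \<le> M" for q
    proof -
      have "G ^ l * (K + m) \<le> G ^ Suc l * (K + m)"
        using G Gl m K(2) by (intro mult_right_mono power_increasing) auto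
      then show ?thesis using x[OF that] * by simp
    qed
    have "doob_map e a = ((next_window x i (snd a), fst a i), (S', m'))"
      using m(1) by (simp add: e doob_map_def em_map_def S'_def m'_def Let_def)
    moreover have "norm (next_window x i (snd a) q) \<le> G ^ Suc l * (K + m') - K" if "q \<le> M" for q
      using head tail[of "q - 1"] that by (auto simp: window_step_def)
    ultimately show ?thesis
      using new' m m' by (auto simp: J_def window_step_def)
  qed
  define W where "W e = ennreal (doob_potential (fst (snd e)) (snd (snd e)))"
    for e :: "((nat \<Rightarrow> real ^ 'n) \<times> 's) \<times> ((real ^ 'n) \<times> real)"
  define C where "C = s\<^sup>2 * real CARD('m) * \<delta>"
  have C: "C \<ge> 0" using step_pos by (simp add: C_def)
  define E where "E = exp (L * \<delta> * real k)"
  let ?e = "((\<lambda>_. 0 :: real ^ 'n, i), (0 :: real ^ 'n, 0 :: real))"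
  have [measurable]: "fst \<in> borel_measurable (borel :: ((real ^ 'n) \<times> real) measure)"
    "snd \<in> borel_measurable (borel :: ((real ^ 'n) \<times> real) measure)"
    by (auto intro!: borel_measurable_continuous_onI continuous_intros)
  have W_meas[measurable]: "W \<in> borel_measurable (states \<Otimes>\<^sub>M borel)"
    unfolding W_def doob_potential_def by measurable
  have path: "ennreal (wdist M r (fst (fst (riter doob_map k ?e t))) (\<lambda>_. 0))
      \<le> ennreal E * W (riter doob_map k ?e t) + ennreal (E * (K + 1))" for t
  proof -
    define e where "e = riter doob_map k ?e t"
    define m where "m = snd (snd e)"
    have "J k e" unfolding e_def
    proof (rule riter_invariant[where J = J])
      show "J 0 ?e" by (simp add: J_def)
    qed (rule J_step)
    then have m: "0 \<le> m" and x: "\<And>q. q \<le> M \<Longrightarrow> norm (fst (fst e) q) \<le> G ^ k * (K + m) - K"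
      by (auto simp: J_def m_def)
    have "G ^ k \<le> exp (L * \<delta>) ^ k"
      using G exp_ge_add_one_self[of "L * \<delta>"] by (intro power_mono) (auto simp: G_def)
    also have "\<dots> = E" by (simp add: E_def exp_of_nat_mult[symmetric] mult.commute)
    finally have GE: "G ^ k \<le> E" .
    have W0: "m\<^sup>2 / 4 \<le> doob_potential (fst (snd e)) m" by (rule doob_potential_ge)
    have "m \<le> 1 + m\<^sup>2 / 4"
      using zero_le_power2[of "m / 2 - 1"] by (simp add: power2_eq_square algebra_simps)
    then have mW: "m \<le> 1 + doob_potential (fst (snd e)) m" using W0 by simp
    have "wdist M r (fst (fst e)) (\<lambda>_. 0) \<le> G ^ k * (K + m)"
      unfolding wdist_le_iff
    proof (intro allI impI)
      fix q assume "q \<le> M"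
      have "r ^ q * norm (fst (fst e) q - 0) \<le> 1 * norm (fst (fst e) q)"
        using r by (intro mult_mono) (auto intro: power_le_one)
      then show "r ^ q * norm (fst (fst e) q - 0) \<le> G ^ k * (K + m)"
        using x[OF \<open>q \<le> M\<close>] K(2) by simp
    qed
    also have "\<dots> \<le> E * (K + (1 + doob_potential (fst (snd e)) m))"
      using GE mW m K(2) G by (intro mult_mono) (auto simp: E_def)
    also have "\<dots> = E * doob_potential (fst (snd e)) m + E * (K + 1)" by (simp add: algebra_simps)
    finally have "ennreal (wdist M r (fst (fst e)) (\<lambda>_. 0))
        \<le> ennreal (E * doob_potential (fst (snd e)) m + E * (K + 1))" by (rule ennreal_leI)
    also have "\<dots> = ennreal E * W e + ennreal (E * (K + 1))"
      using W0 K(2) order_trans[OF _ W0, of 0]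
      by (simp add: W_def m_def[symmetric] E_def ennreal_plus ennreal_mult)
    finally show ?thesis by (simp add: e_def)
  qed
  have "iter_expect noise em_map k (\<lambda>p. ennreal (wdist M r (fst p) (\<lambda>_. 0))) (\<lambda>_. 0, i)
      = iter_expect noise doob_map k (\<lambda>e. ennreal (wdist M r (fst (fst e)) (\<lambda>_. 0))) ?e"
    using iter_expect_semiconj[of fst doob_map em_map noise k "\<lambda>p. ennreal (wdist M r (fst p) (\<lambda>_. 0))" ?e]
    by (simp add: doob_map_def)
  also have "\<dots> \<le> iter_expect noise doob_map k (\<lambda>e. ennreal E * W e + ennreal (E * (K + 1))) ?e"
    using path by (intro D.iter_expect_mono)
  also have "\<dots> = ennreal E * iter_expect noise doob_map k W ?e + ennreal (E * (K + 1))"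
    by (simp add: D.iter_expect_plus D.iter_expect_cmult D.iter_expect_const)
  also have "iter_expect noise doob_map k W ?e \<le> W ?e + of_nat k * ennreal C"
    by (rule D.iter_expect_step_additive[OF W_meas])
       (unfold W_def C_def, rule nn_integral_doob_potential[OF s])
  also have "W ?e = 0" by (simp add: W_def doob_potential_def)
  also have "ennreal E * (0 + of_nat k * ennreal C) + ennreal (E * (K + 1))
      = ennreal (E * (real k * C) + E * (K + 1))"
    using C K(2) by (simp add: E_def ennreal_plus ennreal_mult ennreal_of_nat_eq_real_of_nat)
  also have "E * (real k * C) + E * (K + 1) = E * (K + 1 + C * real k)" by (simp add: algebra_simps)
  finally show ?thesis
    by (simp add: E_def C_def add_right_mono mult_left_mono)
qed

subsection \<open>Mixing of the pair chain\<close>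

lemma nn_integral_noise_map_pair:
  assumes "i \<noteq> j"
  shows "(\<integral>\<^sup>+a. h (fst a i) (fst a j) \<partial>noise)
    = (\<Sum>i'\<in>UNIV. \<Sum>j'\<in>UNIV. h i' j' * ennreal (pmf (P i) i' * pmf (P j) j'))"
proof -
  let ?A = "UNIV - {i}"
  have "map_pmf (\<lambda>\<theta>. (\<theta> i, \<theta> j)) (Pi_pmf UNIV undefined P)
      = map_pmf (\<lambda>\<theta>. (\<theta> i, \<theta> j)) (Pi_pmf (insert i ?A) undefined P)" by (simp add: insert_absorb)
  also have "\<dots> = map_pmf (\<lambda>(y, f). (y, f j)) (pair_pmf (P i) (Pi_pmf ?A undefined P))"
    using assms by (subst Pi_pmf_insert) (auto simp: pmf.map_comp o_def case_prod_beta' intro!: pmf.map_cong)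
  also have "\<dots> = pair_pmf (P i) (map_pmf (\<lambda>f. f j) (Pi_pmf ?A undefined P))"
    by (simp add: pair_map_pmf2 case_prod_beta' apsnd_def map_prod_def)
  also have "map_pmf (\<lambda>f. f j) (Pi_pmf ?A undefined P) = P j"
    using assms by (subst Pi_pmf_component) auto
  finally have law: "map_pmf (\<lambda>\<theta>. (\<theta> i, \<theta> j)) (Pi_pmf UNIV undefined P) = pair_pmf (P i) (P j)" .
  have "(\<integral>\<^sup>+a. h (fst a i) (fst a j) \<partial>noise) = (\<integral>\<^sup>+\<theta>. h (\<theta> i) (\<theta> j) \<partial>measure_pmf (Pi_pmf UNIV undefined P))"
  proof -
    have [measurable]: "(\<lambda>a. h (fst a i) (fst a j))
        \<in> borel_measurable (measure_pmf (Pi_pmf UNIV undefined P) \<Otimes>\<^sub>M \<gamma>)"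
      by (rule measurable_compose[OF measurable_fst]) simp
    show ?thesis
      unfolding noise_def
      by (subst increment.nn_integral_fst[symmetric]) (simp_all add: increment.emeasure_space_1)
  qed
  also have "\<dots> = (\<integral>\<^sup>+w. h (fst w) (snd w) \<partial>map_pmf (\<lambda>\<theta>. (\<theta> i, \<theta> j)) (Pi_pmf UNIV undefined P))" by simp
  also have "\<dots> = (\<Sum>w\<in>UNIV. h (fst w) (snd w) * ennreal (pmf (pair_pmf (P i) (P j)) w))"
    unfolding law by (rule nn_integral_measure_pmf_support) simp_all
  also have "\<dots> = (\<Sum>w\<in>UNIV \<times> UNIV. h (fst w) (snd w) * ennreal (pmf (P i) (fst w) * pmf (P j) (snd w)))"
    by (intro sum.cong) (auto simp: pmf_pair)
  also have "\<dots> = (\<Sum>i'\<in>UNIV. \<Sum>j'\<in>UNIV. h i' j' * ennreal (pmf (P i) i' * pmf (P j) j'))"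
    by (simp add: sum.cartesian_product case_prod_beta')
  finally show ?thesis .
qed

lemma iter_expect_equal_states:
  "pair_expect k (\<lambda>z. of_bool (together z)) ((x, i), (y, i)) = 1"
proof -
  interpret pr: random_maps noise "states \<Otimes>\<^sub>M states" "pair_map em_map" by (rule random_maps_pair)
  have "snd (fst (riter (pair_map em_map) k ((x, i), (y, i)) t)) = snd (snd (riter (pair_map em_map) k ((x, i), (y, i)) t))" for t
    by (rule riter_invariant[where J = "\<lambda>_ z. together z"]) (auto simp: pair_map_def em_map_def)
  then have "pair_expect k (\<lambda>z. of_bool (together z)) ((x, i), (y, i))
      = pair_expect k (\<lambda>z. 1) ((x, i), (y, i))"
    by (simp add: iter_expect_def)
  then show ?thesis by (simp add: pr.iter_expect_const)
qed

lemma measurable_equal_states[measurable]: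
  "(\<lambda>z. of_bool (together z) :: ennreal) \<in> borel_measurable (states \<Otimes>\<^sub>M states)"
proof -
  have "Measurable.pred (states \<Otimes>\<^sub>M states) (\<lambda>z. together z)" by measurable
  then show ?thesis unfolding of_bool_def by measurable
qed

text \<open>Before they meet the two chains are independent, and after that they agree; hence they agree at
  time \<open>k\<close> at least as often as independent chains would.\<close>

lemma equal_states_ge:
  fixes p :: "nat \<Rightarrow> 's \<Rightarrow> 's \<Rightarrow> real"
  assumes p0: "\<And>i j. p 0 i j = of_bool (i = j)"
    and pS: "\<And>k i j. p (Suc k) i j = (\<Sum>l\<in>UNIV. pmf (P i) l * p k l j)"
  shows "ennreal (\<Sum>l\<in>UNIV. p k i l * p k j l)
    \<le> pair_expect k (\<lambda>z. of_bool (together z)) ((x, i), (y, j))"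
proof (induction k arbitrary: x i y j)
  case 0
  interpret pr: random_maps noise "states \<Otimes>\<^sub>M states" "pair_map em_map" by (rule random_maps_pair)
  have "p 0 i l * p 0 j l = (if l = i then of_bool (i = j) else 0)" for l by (auto simp: p0)
  then have "(\<Sum>l\<in>UNIV. p 0 i l * p 0 j l) = of_bool (i = j)" by simp
  then show ?case by (simp add: pr.iter_expect_0)
next
  case (Suc k)
  interpret pr: random_maps noise "states \<Otimes>\<^sub>M states" "pair_map em_map" by (rule random_maps_pair)
  have p_nn: "0 \<le> p k i j" for k i j
    by (induction k arbitrary: i) (auto simp: p0 pS intro!: sum_nonneg)
  have p_sum: "(\<Sum>j\<in>UNIV. p k i j) = 1" for k i
  proof (induction k arbitrary: i)
    case (Suc k)
    have "(\<Sum>j\<in>UNIV. p (Suc k) i j) = (\<Sum>l\<in>UNIV. pmf (P i) l * (\<Sum>j\<in>UNIV. p k l j))"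
      unfolding pS sum_distrib_left by (rule sum.swap)
    also have "\<dots> = 1" by (simp add: Suc sum_pmf_eq_1)
    finally show ?case .
  qed (simp add: p0 of_bool_def)
  show ?case
  proof (cases "i = j")
    case True
    have "p (Suc k) i l \<le> 1" for l
      using member_le_sum[of l UNIV "p (Suc k) i"] p_nn p_sum[of "Suc k" i] by simp
    then have "(\<Sum>l\<in>UNIV. p (Suc k) i l * p (Suc k) i l) \<le> (\<Sum>l\<in>UNIV. p (Suc k) i l)"
      using p_nn by (intro sum_mono) (simp add: mult_left_le)
    then show ?thesis
      using True by (simp only: iter_expect_equal_states p_sum ennreal_le_1)
  next
    case False
    let ?h = "\<lambda>i' j'. ennreal (\<Sum>l\<in>UNIV. p k i' l * p k j' l)"
    have "(\<Sum>l\<in>UNIV. p (Suc k) i l * p (Suc k) j l)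
        = (\<Sum>l\<in>UNIV. \<Sum>i'\<in>UNIV. \<Sum>j'\<in>UNIV. (pmf (P i) i' * p k i' l) * (pmf (P j) j' * p k j' l))"
      by (simp add: pS sum_product)
    also have "\<dots> = (\<Sum>i'\<in>UNIV. \<Sum>l\<in>UNIV. \<Sum>j'\<in>UNIV. (pmf (P i) i' * p k i' l) * (pmf (P j) j' * p k j' l))"
      by (rule sum.swap)
    also have "\<dots> = (\<Sum>i'\<in>UNIV. \<Sum>j'\<in>UNIV. \<Sum>l\<in>UNIV. (pmf (P i) i' * p k i' l) * (pmf (P j) j' * p k j' l))"
      by (intro sum.cong refl sum.swap)
    also have "\<dots> = (\<Sum>i'\<in>UNIV. \<Sum>j'\<in>UNIV. (\<Sum>l\<in>UNIV. p k i' l * p k j' l) * (pmf (P i) i' * pmf (P j) j'))"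
      by (simp add: sum_distrib_left algebra_simps)
    finally have eq: "(\<Sum>l\<in>UNIV. p (Suc k) i l * p (Suc k) j l)
        = (\<Sum>i'\<in>UNIV. \<Sum>j'\<in>UNIV. (\<Sum>l\<in>UNIV. p k i' l * p k j' l) * (pmf (P i) i' * pmf (P j) j'))" .
    have nn: "0 \<le> (\<Sum>l\<in>UNIV. p k i' l * p k j' l)" for i' j' using p_nn by (intro sum_nonneg) simp
    have "ennreal (\<Sum>l\<in>UNIV. p (Suc k) i l * p (Suc k) j l)
        = (\<Sum>i'\<in>UNIV. \<Sum>j'\<in>UNIV. ?h i' j' * ennreal (pmf (P i) i' * pmf (P j) j'))"
      unfolding eq using nn by (simp add: sum_nonneg flip: ennreal_mult)
    also have "\<dots> = (\<integral>\<^sup>+a. ?h (fst a i) (fst a j) \<partial>noise)"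
      by (rule nn_integral_noise_map_pair[OF False, symmetric])
    also have "\<dots> \<le> (\<integral>\<^sup>+a. pair_expect k
        (\<lambda>z. of_bool (together z)) (pair_map em_map ((x, i), (y, j)) a) \<partial>noise)"
      by (rule nn_integral_mono) (simp add: pair_map_def em_map_def Suc.IH)
    also have "\<dots> = pair_expect (Suc 0) (pair_expect k
        (\<lambda>z. of_bool (together z))) ((x, i), (y, j))"
      by (simp add: pr.iter_expect_Suc pr.iter_expect_0)
    also have "\<dots> = pair_expect (k + Suc 0)
        (\<lambda>z. of_bool (together z)) ((x, i), (y, j))"
      by (rule pr.iter_expect_add[symmetric]) measurable
    finally show ?thesis by simp
  qed
qed

lemma unequal_states_le:
  fixes p :: "nat \<Rightarrow> 's \<Rightarrow> 's \<Rightarrow> real"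
  assumes p0: "\<And>i j. p 0 i j = of_bool (i = j)"
    and pS: "\<And>k i j. p (Suc k) i j = (\<Sum>l\<in>UNIV. pmf (P i) l * p k l j)"
    and e: "\<And>i j. e \<le> p k i j" "0 \<le> e"
  shows "pair_expect k (\<lambda>z. of_bool (apart z)) z
    \<le> ennreal (1 - e\<^sup>2)"
proof -
  interpret pr: random_maps noise "states \<Otimes>\<^sub>M states" "pair_map em_map" by (rule random_maps_pair)
  obtain x i y j where z: "z = ((x, i), (y, j))" by (metis surj_pair)
  let ?E = "pair_expect k"
  have [measurable]: "(\<lambda>z. of_bool (apart z) :: ennreal) \<in> borel_measurable (states \<Otimes>\<^sub>M states)"
  proof -
    have "Measurable.pred (states \<Otimes>\<^sub>M states) (\<lambda>z. apart z)" by measurable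
    then show ?thesis unfolding of_bool_def by measurable
  qed
  have "?E (\<lambda>z. of_bool (apart z)) z + ?E (\<lambda>z. of_bool (together z)) z
      = ?E (\<lambda>z. of_bool (apart z) + of_bool (together z)) z"
    by (rule pr.iter_expect_plus[symmetric]) measurable
  also have "(\<lambda>z. of_bool (apart z) + of_bool (together z) :: ennreal) = (\<lambda>_. 1)"
    by auto
  finally have sum1: "?E (\<lambda>z. of_bool (apart z)) z
      + ?E (\<lambda>z. of_bool (together z)) z = 1"
    by (simp add: pr.iter_expect_const)
  have "e\<^sup>2 \<le> p k i i * p k j i"
    unfolding power2_eq_square using e by (intro mult_mono) (auto intro: order_trans)
  also have "\<dots> \<le> (\<Sum>l\<in>UNIV. p k i l * p k j l)"
    using e order_trans[OF e(2) e(1)] by (intro member_le_sum[of i UNIV "\<lambda>l. p k i l * p k j l"]) auto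
  finally have "ennreal (e\<^sup>2) \<le> ?E (\<lambda>z. of_bool (together z)) z"
    unfolding z by (intro order_trans[OF ennreal_leI equal_states_ge[of p, OF p0 pS]])
  then have "?E (\<lambda>z. of_bool (apart z)) z + ennreal (e\<^sup>2)
      \<le> ?E (\<lambda>z. of_bool (apart z)) z + ?E (\<lambda>z. of_bool (together z)) z"
    by (rule add_left_mono)
  then have *: "?E (\<lambda>z. of_bool (apart z)) z + ennreal (e\<^sup>2) \<le> 1"
    unfolding sum1 .
  have "?E (\<lambda>z. of_bool (apart z)) z
      \<le> ?E (\<lambda>z. of_bool (apart z)) z + ennreal (e\<^sup>2)" by simp
  then have "?E (\<lambda>z. of_bool (apart z)) z \<noteq> \<top>"
    using * by (metis ennreal_one_neq_top order_trans top.extremum_uniqueI)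
  then obtain a where a: "0 \<le> a" "?E (\<lambda>z. of_bool (apart z)) z = ennreal a"
    by (cases "?E (\<lambda>z. of_bool (apart z)) z") auto
  have "ennreal (a + e\<^sup>2) = ennreal a + ennreal (e\<^sup>2)" using a(1) by (intro ennreal_plus) auto
  then have "ennreal (a + e\<^sup>2) \<le> ennreal 1" using * a(2) by simp
  then have "a + e\<^sup>2 \<le> 1" by (subst (asm) ennreal_le_iff) auto
  then show ?thesis unfolding a(2) by (intro ennreal_leI) simp
qed

end

subsection \<open>A Lyapunov function for the coupled chain\<close>

text \<open>The weights \<open>u\<close> come from the spectral condition; \<open>decay\<close> says that they absorb, on average over
  one step of the chain, the Lipschitz constants \<open>c\<close> of the windows.\<close>

locale em_lyapunov = em_chain \<tau> \<delta> M b \<sigma> L P \<gamma>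
  for \<tau> \<delta> :: real and M :: nat and b :: "(real \<Rightarrow>\<^sub>C (real ^ 'n)) \<Rightarrow> 's::finite \<Rightarrow> real ^ 'n"
    and \<sigma> :: "'s \<Rightarrow> real ^ 'm ^ 'n" and L :: real and P :: "'s \<Rightarrow> 's pmf"
    and \<gamma> :: "(real ^ 'm) measure" +
  fixes r s K U \<rho> :: real and u c :: "'s \<Rightarrow> real"
  assumes r: "0 < r" "r \<le> 1"
    and diffusion_bound: "\<And>i z. norm (\<sigma> i *v z) \<le> s * norm z" "0 \<le> s"
    and drift_at_0: "\<And>i. norm (b 0 i) \<le> L * K" "0 \<le> K"
    and step_lipschitz: "\<And>x y i z. wdist M r (next_window x i z) (next_window y i z)
          \<le> c i * wdist M r x y"
    and c_pos: "\<And>i. 0 < c i"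
    and u_pos: "\<And>i. 0 < u i" and u_le: "\<And>i. u i \<le> U"
    and \<rho>: "0 < \<rho>" "\<rho> \<le> 1"
    and decay: "\<And>i. c i * (\<Sum>j\<in>UNIV. pmf (P i) j * u j) \<le> \<rho> * u i"
begin

sublocale pair: random_maps noise "states \<Otimes>\<^sub>M states" "pair_map em_map"
  by (rule random_maps_pair)

lemma U_pos: "0 < U"
  using u_pos u_le by (meson less_le_trans)

lemma wdist_nonneg': "0 \<le> wdist M r x y"
  using r by (simp add: wdist_nonneg)

text \<open>The value \<open>\<top>\<close> off the diagonal makes the one-step estimate hold for all pairs of states.\<close>

definition diag_dist :: "((nat \<Rightarrow> real ^ 'n) \<times> 's) \<times> ((nat \<Rightarrow> real ^ 'n) \<times> 's) \<Rightarrow> ennreal" where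
  "diag_dist z = (if together z
     then ennreal (u (snd (fst z)) * wdist M r (fst (fst z)) (fst (snd z))) else \<top>)"

lemma measurable_fst_states[measurable]: "fst \<in> borel_measurable states"
  unfolding states_def by measurable

lemma measurable_snd_states[measurable]: "snd \<in> states \<rightarrow>\<^sub>M count_space UNIV"
  unfolding states_def by measurable

lemma measurable_weight[measurable (raw)]:
  assumes [measurable]: "g \<in> N \<rightarrow>\<^sub>M count_space UNIV"
  shows "(\<lambda>w. u (g w)) \<in> borel_measurable N"
  by (rule measurable_compose[OF assms]) simp

lemma measurable_diag_dist[measurable]: "diag_dist \<in> borel_measurable (states \<Otimes>\<^sub>M states)"
  unfolding diag_dist_def by measurable

lemma nn_integral_weight_next:
  "(\<integral>\<^sup>+a. ennreal (u (fst a i) * (c i * D)) \<partial>noise) \<le> ennreal (\<rho> * (u i * D))" if "0 \<le> D"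
proof -
  have "(\<integral>\<^sup>+a. ennreal (u (fst a i) * (c i * D)) \<partial>noise)
      = (\<Sum>j\<in>UNIV. ennreal (u j * (c i * D)) * ennreal (pmf (P i) j))"
    by (rule nn_integral_noise_map)
  also have "\<dots> = ennreal (\<Sum>j\<in>UNIV. u j * (c i * D) * pmf (P i) j)"
    using that u_pos c_pos by (simp add: less_imp_le flip: ennreal_mult)
  also have "(\<Sum>j\<in>UNIV. u j * (c i * D) * pmf (P i) j) = c i * (\<Sum>j\<in>UNIV. pmf (P i) j * u j) * D"
    by (simp add: sum_distrib_left sum_distrib_right algebra_simps)
  also have "ennreal \<dots> \<le> ennreal (\<rho> * u i * D)"
    by (intro ennreal_leI mult_right_mono decay that)
  finally show ?thesis by (simp add: mult.assoc)
qed

lemma diag_dist_step: "(\<integral>\<^sup>+a. diag_dist (pair_map em_map z a) \<partial>noise) \<le> ennreal \<rho> * diag_dist z"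
proof (cases "together z")
  case False
  then show ?thesis using \<rho> by (simp add: diag_dist_def ennreal_mult_top)
next
  case True
  obtain x i y where z: "z = ((x, i), (y, i))" using True by (metis prod.collapse)
  have "(\<integral>\<^sup>+a. diag_dist (pair_map em_map z a) \<partial>noise) \<le> (\<integral>\<^sup>+a. ennreal (u (fst a i) * (c i * wdist M r x y)) \<partial>noise)"
    using step_lipschitz[of x i _ y] u_pos
    by (intro nn_integral_mono)
       (auto simp: z diag_dist_def pair_map_def em_map_def less_imp_le intro!: ennreal_leI mult_left_mono)
  also have "\<dots> \<le> ennreal (\<rho> * (u i * wdist M r x y))"
    by (rule nn_integral_weight_next[OF wdist_nonneg'])
  also have "\<dots> = ennreal \<rho> * diag_dist z"
    using \<rho> u_pos[of i] wdist_nonneg'[of x y] by (simp add: z diag_dist_def ennreal_mult)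
  finally show ?thesis .
qed

lemma diag_dist_decay:
  "pair_expect k diag_dist z \<le> ennreal (\<rho> ^ k) * diag_dist z"
  using pair.iter_expect_step_geometric[OF measurable_diag_dist diag_dist_step, of k z] \<rho>
  by (simp add: ennreal_power)

text \<open>A moment bound uniform in the step size for times up to \<open>T\<close>: compare with the solution started
  from zero and driven by the same noise.\<close>

definition moment_bound :: "real \<Rightarrow> real" where
  "moment_bound T = U * (exp (L * T) * (K + 1 + s\<^sup>2 * real CARD('m) * T))"

definition height :: "(nat \<Rightarrow> real ^ 'n) \<times> 's \<Rightarrow> real" where
  "height p = u (snd p) * wdist M r (fst p) (\<lambda>_. 0)"

lemma height_nonneg: "0 \<le> height p"
  using u_pos[of "snd p"] wdist_nonneg'[of "fst p" "\<lambda>_. 0"] by (simp add: height_def)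

lemma measurable_height[measurable]: "height \<in> borel_measurable states"
  unfolding height_def by measurable

lemma height_moment:
  assumes T: "real k * \<delta> \<le> T"
  shows "iter_expect noise em_map k (\<lambda>p. ennreal (height p)) p \<le> ennreal (\<rho> ^ k * height p + moment_bound T)"
proof -
  obtain x i where p: "p = (x, i)" by (cases p)
  let ?z = "((x, i), ((\<lambda>_. 0), i))"
  let ?g = "\<lambda>p. ennreal (wdist M r (fst p) (\<lambda>_. 0 :: real ^ 'n))"
  have g[measurable]: "?g \<in> borel_measurable states" by measurable
  have path: "ennreal (height (fst (riter (pair_map em_map) k ?z t)))
      \<le> diag_dist (riter (pair_map em_map) k ?z t) + ennreal U * ?g (snd (riter (pair_map em_map) k ?z t))" for t
  proof -
    obtain x' i' y' j' where e: "riter (pair_map em_map) k ?z t = ((x', i'), (y', j'))" by (metis surj_pair)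
    have "u i' * wdist M r x' (\<lambda>_. 0) \<le> u i' * (wdist M r x' y' + wdist M r y' (\<lambda>_. 0))"
      using r u_pos[of i'] by (intro mult_left_mono wdist_triangle) auto
    also have "\<dots> \<le> u i' * wdist M r x' y' + U * wdist M r y' (\<lambda>_. 0)"
      using u_le[of i'] wdist_nonneg'[of y' "\<lambda>_. 0"] by (simp add: distrib_left mult_right_mono)
    finally have "ennreal (u i' * wdist M r x' (\<lambda>_. 0))
        \<le> ennreal (u i' * wdist M r x' y' + U * wdist M r y' (\<lambda>_. 0))" by (rule ennreal_leI)
    also have "\<dots> = ennreal (u i' * wdist M r x' y') + ennreal U * ennreal (wdist M r y' (\<lambda>_. 0))"
      using U_pos u_pos[of i'] wdist_nonneg'[of y' "\<lambda>_. 0"] wdist_nonneg'[of x' y']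
      by (simp add: ennreal_plus ennreal_mult)
    finally show ?thesis by (cases "i' = j'") (simp_all add: e height_def diag_dist_def)
  qed
  have "iter_expect noise em_map k (\<lambda>p. ennreal (height p)) (x, i)
      = pair_expect k (\<lambda>z. ennreal (height (fst z))) ?z"
    using iter_expect_semiconj[of fst "pair_map em_map" em_map noise k "\<lambda>p. ennreal (height p)" ?z]
    by (simp add: pair_map_def)
  also have "\<dots> \<le> pair_expect k (\<lambda>z. diag_dist z + ennreal U * ?g (snd z)) ?z"
    using path by (rule pair.iter_expect_mono)
  also have "\<dots> = pair_expect k diag_dist ?z
      + ennreal U * pair_expect k (\<lambda>z. ?g (snd z)) ?z"
    by (simp add: pair.iter_expect_plus pair.iter_expect_cmult)
  also have "pair_expect k (\<lambda>z. ?g (snd z)) ?z = iter_expect noise em_map k ?g (\<lambda>_. 0, i)"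
    using iter_expect_semiconj[of snd "pair_map em_map" em_map noise k ?g ?z] by (simp add: pair_map_def)
  also have "pair_expect k diag_dist ?z + ennreal U * iter_expect noise em_map k ?g (\<lambda>_. 0, i)
      \<le> ennreal (\<rho> ^ k * height p) + ennreal (moment_bound T)"
  proof (rule add_mono)
    have "pair_expect k diag_dist ?z \<le> ennreal (\<rho> ^ k) * diag_dist ?z"
      by (rule diag_dist_decay)
    also have "\<dots> = ennreal (\<rho> ^ k * height p)"
      using \<rho> height_nonneg[of p] by (simp add: p height_def diag_dist_def ennreal_mult)
    finally show "pair_expect k diag_dist ?z \<le> ennreal (\<rho> ^ k * height p)" .
    have "exp (L * \<delta> * real k) * (K + 1 + s\<^sup>2 * real CARD('m) * \<delta> * real k)
        \<le> exp (L * T) * (K + 1 + s\<^sup>2 * real CARD('m) * T)"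
    proof (rule mult_mono)
      have "L * \<delta> * real k \<le> L * T" using T L_pos by (simp add: mult.assoc mult.commute[of \<delta>])
      then show "exp (L * \<delta> * real k) \<le> exp (L * T)" by simp
      have "s\<^sup>2 * real CARD('m) * (real k * \<delta>) \<le> s\<^sup>2 * real CARD('m) * T" using T by (intro mult_left_mono) auto
      then show "K + 1 + s\<^sup>2 * real CARD('m) * \<delta> * real k \<le> K + 1 + s\<^sup>2 * real CARD('m) * T"
        by (simp add: algebra_simps)
    qed (use drift_at_0 step_pos in auto)
    then have "iter_expect noise em_map k ?g (\<lambda>_. 0, i) \<le> ennreal (exp (L * T) * (K + 1 + s\<^sup>2 * real CARD('m) * T))"
      using r by (intro order_trans[OF moment_from_zero[OF diffusion_bound drift_at_0, of r k i]] ennreal_leI) auto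
    then have "ennreal U * iter_expect noise em_map k ?g (\<lambda>_. 0, i)
        \<le> ennreal U * ennreal (exp (L * T) * (K + 1 + s\<^sup>2 * real CARD('m) * T))" by (rule mult_left_mono) simp
    also have "\<dots> = ennreal (moment_bound T)" using U_pos by (simp add: moment_bound_def ennreal_mult')
    finally show "ennreal U * iter_expect noise em_map k ?g (\<lambda>_. 0, i) \<le> ennreal (moment_bound T)" .
  qed
  also have "\<dots> = ennreal (\<rho> ^ k * height p + moment_bound T)"
  proof (rule ennreal_plus[symmetric])
    show "0 \<le> \<rho> ^ k * height p" using \<rho> height_nonneg by simp
    have "0 \<le> T" using T step_pos by (smt (verit) mult_nonneg_nonneg of_nat_0_le_iff)
    then show "0 \<le> moment_bound T" using U_pos drift_at_0 by (simp add: moment_bound_def)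
  qed
  finally show ?thesis by (simp add: p)
qed

text \<open>Off the diagonal the distance is replaced by the sum of the heights, which is no smaller, plus a
  large constant \<open>B\<close>.  Over one block of \<open>n\<close> steps, of fixed physical length \<open>T\<close>, the heights
  contract up to an additive constant, and this constant is compensated by the decrease
  of \<open>B\<close> times the probability that the two chains have not met.\<close>

definition lyap :: "real \<Rightarrow> ((nat \<Rightarrow> real ^ 'n) \<times> 's) \<times> ((nat \<Rightarrow> real ^ 'n) \<times> 's) \<Rightarrow> real" where
  "lyap B z = (if together z then u (snd (fst z)) * wdist M r (fst (fst z)) (fst (snd z))
     else height (fst z) + height (snd z) + B)"

lemma lyap_nonneg: "0 \<le> B \<Longrightarrow> 0 \<le> lyap B z"
  by (simp add: lyap_def less_imp_le[OF u_pos] height_nonneg wdist_nonneg')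

lemma lyap_le: "lyap B z \<le> height (fst z) + height (snd z) + B" if "0 \<le> B"
proof (cases "together z")
  case True
  have "u (snd (fst z)) * wdist M r (fst (fst z)) (fst (snd z))
      \<le> u (snd (fst z)) * (wdist M r (fst (fst z)) (\<lambda>_. 0) + wdist M r (\<lambda>_. 0) (fst (snd z)))"
    using r u_pos by (intro mult_left_mono wdist_triangle) (auto simp: less_imp_le)
  then show ?thesis
    using True that by (simp add: lyap_def height_def distrib_left wdist_commute[of _ _ "\<lambda>_. 0"])
qed (simp add: lyap_def)

lemma measurable_lyap[measurable]: "lyap B \<in> borel_measurable (states \<Otimes>\<^sub>M states)"
  unfolding lyap_def by measurable

lemma lyap_diagonal:
  assumes "together z"
  shows "pair_expect k (\<lambda>z. ennreal (lyap B z)) z \<le> ennreal (\<rho> ^ k * lyap B z)"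
proof -
  have "pair_expect k (\<lambda>z. ennreal (lyap B z)) z \<le> pair_expect k diag_dist z"
    by (intro pair.iter_expect_mono) (simp add: lyap_def diag_dist_def)
  also have "\<dots> \<le> ennreal (\<rho> ^ k) * diag_dist z" by (rule diag_dist_decay)
  also have "\<dots> = ennreal (\<rho> ^ k * lyap B z)"
    using assms \<rho> by (simp add: lyap_def diag_dist_def ennreal_mult')
  finally show ?thesis .
qed

lemma lyap_off_diagonal:
  assumes T: "real k * \<delta> \<le> T" and B: "0 \<le> B" and e: "0 \<le> e"
    and mix: "pair_expect k (\<lambda>z. of_bool (apart z)) z \<le> ennreal e"
  shows "pair_expect k (\<lambda>z. ennreal (lyap B z)) z
    \<le> ennreal (\<rho> ^ k * (height (fst z) + height (snd z)) + 2 * moment_bound T + B * e)"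
proof -
  let ?E = "pair_expect k"
  have [measurable]: "(\<lambda>z. of_bool (apart z) :: ennreal) \<in> borel_measurable (states \<Otimes>\<^sub>M states)"
  proof -
    have "Measurable.pred (states \<Otimes>\<^sub>M states) (\<lambda>z. apart z)" by measurable
    then show ?thesis unfolding of_bool_def by measurable
  qed
  have "?E (\<lambda>z. ennreal (lyap B z)) z
      \<le> ?E (\<lambda>z. (ennreal (height (fst z)) + ennreal (height (snd z))) + ennreal B * of_bool (apart z)) z"
  proof (rule pair.iter_expect_mono)
    fix t
    let ?w = "riter (pair_map em_map) k z t"
    have "lyap B ?w \<le> height (fst ?w) + height (snd ?w) + B * of_bool (snd (fst ?w) \<noteq> snd (snd ?w))"
      using lyap_le[of 0 ?w] by (auto simp: lyap_def)
    then have "ennreal (lyap B ?w) \<le> ennreal (height (fst ?w) + height (snd ?w) + B * of_bool (snd (fst ?w) \<noteq> snd (snd ?w)))"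
      by (rule ennreal_leI)
    also have "\<dots> = (ennreal (height (fst ?w)) + ennreal (height (snd ?w))) + ennreal B * of_bool (snd (fst ?w) \<noteq> snd (snd ?w))"
      using height_nonneg[of "fst ?w"] height_nonneg[of "snd ?w"] B by (auto simp: ennreal_plus of_bool_def)
    finally show "ennreal (lyap B ?w) \<le> (ennreal (height (fst ?w)) + ennreal (height (snd ?w)))
        + ennreal B * of_bool (snd (fst ?w) \<noteq> snd (snd ?w))" .
  qed
  also have "\<dots> = (?E (\<lambda>z. ennreal (height (fst z))) z + ?E (\<lambda>z. ennreal (height (snd z))) z)
      + ennreal B * ?E (\<lambda>z. of_bool (apart z)) z"
    by (simp add: pair.iter_expect_plus pair.iter_expect_cmult)
  also have "?E (\<lambda>z. ennreal (height (fst z))) z = iter_expect noise em_map k (\<lambda>p. ennreal (height p)) (fst z)"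
    by (rule iter_expect_semiconj) (simp add: pair_map_def)
  also have "?E (\<lambda>z. ennreal (height (snd z))) z = iter_expect noise em_map k (\<lambda>p. ennreal (height p)) (snd z)"
    by (rule iter_expect_semiconj) (simp add: pair_map_def)
  also have "(iter_expect noise em_map k (\<lambda>p. ennreal (height p)) (fst z)
        + iter_expect noise em_map k (\<lambda>p. ennreal (height p)) (snd z))
      + ennreal B * ?E (\<lambda>z. of_bool (apart z)) z
      \<le> (ennreal (\<rho> ^ k * height (fst z) + moment_bound T) + ennreal (\<rho> ^ k * height (snd z) + moment_bound T))
        + ennreal B * ennreal e"
    by (intro add_mono height_moment T mult_left_mono mix) simp
  also have "\<dots> = ennreal ((\<rho> ^ k * height (fst z) + moment_bound T) + (\<rho> ^ k * height (snd z) + moment_bound T) + B * e)"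
  proof -
    have "0 \<le> T" using T step_pos by (smt (verit) mult_nonneg_nonneg of_nat_0_le_iff)
    then have "0 \<le> moment_bound T" using U_pos drift_at_0 by (simp add: moment_bound_def)
    then have nn: "0 \<le> \<rho> ^ k * height p + moment_bound T" for p using \<rho> height_nonneg[of p] by simp
    have "ennreal v + ennreal w + ennreal B * ennreal e = ennreal (v + w + B * e)" if "0 \<le> v" "0 \<le> w" for v w
      using B e that by (simp add: ennreal_plus ennreal_mult)
    from this[OF nn nn] show ?thesis .
  qed
  finally show ?thesis by (simp add: algebra_simps)
qed

theorem lyap_decay:
  assumes n: "0 < n" "real n * \<delta> = T" and e: "0 < e" "e \<le> 1"
    and mix: "\<And>z. pair_expect n (\<lambda>z. of_bool (apart z)) z \<le> ennreal (1 - e)"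
  \<comment> \<open>In a block \<open>B\<close> is lost with probability at least \<open>e\<close>: one half of \<open>B e\<close> pays for the additive constant
    \<open>2 * moment_bound T\<close>, the other half yields the factor \<open>1 - e / 2\<close>.\<close>
  defines "B \<equiv> 4 * moment_bound T / e" and "q \<equiv> max (\<rho> ^ n) (1 - e / 2)"
  shows "pair_expect k (\<lambda>z. ennreal (lyap B z)) z \<le> ennreal (2 * q ^ (k div n) * lyap B z)"
proof -
  have T: "0 \<le> T" using n step_pos by (metis mult_nonneg_nonneg of_nat_0_le_iff less_imp_le)
  have mb: "0 \<le> moment_bound T" using U_pos drift_at_0 T by (simp add: moment_bound_def)
  have B: "0 \<le> B" using mb e by (simp add: B_def)
  have Be: "B * e = 4 * moment_bound T" using e by (simp add: B_def)
  have q: "0 \<le> q" "\<rho> ^ n \<le> q" "1 - e / 2 \<le> q" using e by (auto simp: q_def)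
  have block: "pair_expect n (\<lambda>z. ennreal (lyap B z)) z \<le> ennreal q * ennreal (lyap B z)" for z
  proof (cases "together z")
    case True
    have "pair_expect n (\<lambda>z. ennreal (lyap B z)) z \<le> ennreal (\<rho> ^ n * lyap B z)"
      by (rule lyap_diagonal[OF True])
    also have "\<dots> \<le> ennreal (q * lyap B z)" using q lyap_nonneg[OF B] by (intro ennreal_leI mult_right_mono)
    finally show ?thesis using q by (simp add: ennreal_mult')
  next
    case False
    have "pair_expect n (\<lambda>z. ennreal (lyap B z)) z
      \<le> ennreal (\<rho> ^ n * (height (fst z) + height (snd z)) + 2 * moment_bound T + B * (1 - e))"
      using n e by (intro lyap_off_diagonal B mix) auto
    also have "\<rho> ^ n * (height (fst z) + height (snd z)) + 2 * moment_bound T + B * (1 - e)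
        = \<rho> ^ n * (height (fst z) + height (snd z)) + (1 - e / 2) * B"
      using Be by (simp add: algebra_simps)
    also have "\<rho> ^ n * (height (fst z) + height (snd z)) + (1 - e / 2) * B
        \<le> q * (height (fst z) + height (snd z)) + q * B"
      using q B height_nonneg by (intro add_mono mult_right_mono) auto
    also have "\<dots> = q * lyap B z" using False by (simp add: lyap_def algebra_simps)
    finally show ?thesis using q by (simp add: ennreal_mult' ennreal_leI)
  qed
  have rest: "pair_expect j (\<lambda>z. ennreal (lyap B z)) z \<le> ennreal 2 * ennreal (lyap B z)" if "j < n" for j z
  proof (cases "together z")
    case True
    have "pair_expect j (\<lambda>z. ennreal (lyap B z)) z \<le> ennreal (\<rho> ^ j * lyap B z)"
      by (rule lyap_diagonal[OF True])
    also have "\<dots> \<le> ennreal (2 * lyap B z)"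
      using \<rho> lyap_nonneg[OF B] power_le_one[of \<rho> j] by (intro ennreal_leI mult_right_mono) auto
    finally show ?thesis by (simp add: ennreal_mult')
  next
    case False
    have jT: "real j * \<delta> \<le> T" using that n step_pos by (metis less_imp_le mult_right_mono of_nat_le_iff)
    have "pair_expect j (\<lambda>z. of_bool (apart z)) z
        \<le> pair_expect j (\<lambda>z. 1) z"
      by (rule pair.iter_expect_mono) simp
    then have "pair_expect j (\<lambda>z. of_bool (apart z)) z \<le> ennreal 1"
      by (simp add: pair.iter_expect_const)
    then have "pair_expect j (\<lambda>z. ennreal (lyap B z)) z
      \<le> ennreal (\<rho> ^ j * (height (fst z) + height (snd z)) + 2 * moment_bound T + B * 1)"
      by (intro lyap_off_diagonal B jT) auto
    also have "\<dots> \<le> ennreal (2 * lyap B z)"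
    proof (rule ennreal_leI)
      have "\<rho> ^ j * (height (fst z) + height (snd z)) \<le> 2 * (height (fst z) + height (snd z))"
        using \<rho> height_nonneg[of "fst z"] height_nonneg[of "snd z"] power_le_one[of \<rho> j]
        by (intro mult_right_mono) auto
      moreover have "2 * moment_bound T \<le> B"
        using Be B e mb mult_left_mono[of e 1 B] by simp
      ultimately show "\<rho> ^ j * (height (fst z) + height (snd z)) + 2 * moment_bound T + B * 1 \<le> 2 * lyap B z"
        using False by (simp add: lyap_def)
    qed
    finally show ?thesis by (simp add: ennreal_mult')
  qed
  have meas: "(\<lambda>z. ennreal (lyap B z)) \<in> borel_measurable (states \<Otimes>\<^sub>M states)" by measurable
  have "pair_expect k (\<lambda>z. ennreal (lyap B z)) z
      = pair_expect (k mod n + k div n * n) (\<lambda>z. ennreal (lyap B z)) z"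
    by simp
  also have "\<dots> = pair_expect (k div n * n)
      (pair_expect (k mod n) (\<lambda>z. ennreal (lyap B z))) z"
    by (rule pair.iter_expect_add[OF meas])
  also have "\<dots> \<le> pair_expect (k div n * n) (\<lambda>z. ennreal 2 * ennreal (lyap B z)) z"
    using n by (intro pair.iter_expect_mono rest) simp
  also have "\<dots> = ennreal 2 * pair_expect (k div n * n) (\<lambda>z. ennreal (lyap B z)) z"
    by (rule pair.iter_expect_cmult[OF meas])
  also have "\<dots> \<le> ennreal 2 * (ennreal q ^ (k div n) * ennreal (lyap B z))"
    by (intro mult_left_mono pair.iter_expect_geometric meas block) simp
  also have "\<dots> = ennreal (2 * q ^ (k div n) * lyap B z)"
    using q lyap_nonneg[OF B] by (simp add: ennreal_mult ennreal_power mult.assoc)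
  finally show ?thesis .
qed

end

section \<open>Wasserstein contraction and invariant measures\<close>

text \<open>Whatever contraction holds for the coupled window chain passes to the laws on the path space, and
  yields a unique invariant measure there.\<close>

locale em_ergodic = em_chain \<tau> \<delta> M b \<sigma> L P \<gamma>
  for \<tau> \<delta> :: real and M :: nat and b :: "(real \<Rightarrow>\<^sub>C (real ^ 'n)) \<Rightarrow> 's::finite \<Rightarrow> real ^ 'n"
    and \<sigma> :: "'s \<Rightarrow> real ^ 'm ^ 'n" and L :: real and P :: "'s \<Rightarrow> 's pmf"
    and \<gamma> :: "(real ^ 'm) measure" +
  fixes C q :: real
  assumes C: "0 \<le> C" and q: "0 < q" "q < 1"
    and contraction: "\<And>k z. pair_expect k
        (\<lambda>z. ennreal (wdist M 1 (fst (fst z)) (fst (snd z)) + of_bool (apart z))) z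
      \<le> ennreal (C * (1 + wdist M 1 (fst (fst z)) (\<lambda>_. 0) + wdist M 1 (fst (snd z)) (\<lambda>_. 0)) * q ^ k)"
begin

sublocale pair: random_maps noise "states \<Otimes>\<^sub>M states" "pair_map em_map"
  by (rule random_maps_pair)

sublocale st: prob_space "stream_space noise" by (rule prob_stream)

definition win_dist :: "((nat \<Rightarrow> real ^ 'n) \<times> 's) \<times> ((nat \<Rightarrow> real ^ 'n) \<times> 's) \<Rightarrow> real" where
  "win_dist z = wdist M 1 (fst (fst z)) (fst (snd z)) + of_bool (apart z)"

definition win_norm :: "(nat \<Rightarrow> real ^ 'n) \<times> 's \<Rightarrow> real" where
  "win_norm p = wdist M 1 (fst p) (\<lambda>_. 0)"

lemma contraction':
  "pair_expect k (\<lambda>z. ennreal (win_dist z)) z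
    \<le> ennreal (C * (1 + win_norm (fst z) + win_norm (snd z)) * q ^ k)"
  using contraction[of k z] by (simp add: win_dist_def win_norm_def)

lemma win_norm_nonneg: "0 \<le> win_norm p" by (simp add: win_norm_def wdist_nonneg)

lemma win_dist_nonneg: "0 \<le> win_dist z" by (simp add: win_dist_def wdist_nonneg)

lemma measurable_fst_states[measurable]: "fst \<in> borel_measurable states"
  unfolding states_def by measurable

lemma measurable_snd_states[measurable]: "snd \<in> states \<rightarrow>\<^sub>M count_space UNIV"
  unfolding states_def by measurable

lemma measurable_win_norm[measurable]: "win_norm \<in> borel_measurable states"
  unfolding win_norm_def by measurable

lemma measurable_win_dist[measurable]: "win_dist \<in> borel_measurable (states \<Otimes>\<^sub>M states)"
proof -
  have [measurable]: "Measurable.pred (states \<Otimes>\<^sub>M states) (\<lambda>z. apart z)" by measurable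
  show ?thesis unfolding win_dist_def of_bool_def by measurable
qed

definition to_window :: "(real \<Rightarrow>\<^sub>C (real ^ 'n)) \<times> 's \<Rightarrow> (nat \<Rightarrow> real ^ 'n) \<times> 's" where
  "to_window x = (grid_window \<delta> M (fst x), snd x)"

definition to_segment :: "(nat \<Rightarrow> real ^ 'n) \<times> 's \<Rightarrow> (real \<Rightarrow>\<^sub>C (real ^ 'n)) \<times> 's" where
  "to_segment p = (interp \<tau> \<delta> (fst p), snd p)"

lemma space_state_space: "space (state_space \<tau>) = seg_space \<tau> \<times> UNIV"
  by (simp add: state_space_def space_pair_measure space_restrict_space)

lemma measurable_fst_state_space[measurable]:
  "fst \<in> borel_measurable (state_space \<tau> :: ((real \<Rightarrow>\<^sub>C (real ^ 'n)) \<times> 's) measure)"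
  unfolding state_space_def
  by (rule measurable_compose[OF measurable_fst]) (rule measurable_restrict_space1, simp)

lemma measurable_snd_state_space[measurable]: "snd \<in> state_space \<tau> \<rightarrow>\<^sub>M count_space UNIV"
  unfolding state_space_def by measurable

lemma measurable_to_window[measurable]: "to_window \<in> state_space \<tau> \<rightarrow>\<^sub>M states"
  unfolding to_window_def states_def by measurable

lemma measurable_to_segment[measurable]: "to_segment \<in> states \<rightarrow>\<^sub>M state_space \<tau>"
proof -
  have "interp \<tau> \<delta> \<in> borel \<rightarrow>\<^sub>M (restrict_space borel (seg_space \<tau>) :: (real \<Rightarrow>\<^sub>C (real ^ 'n)) measure)"
    by (rule measurable_restrict_space2)
       (auto simp: interp_in_seg_space intro: borel_measurable_continuous_onI continuous_interp)
  from measurable_compose[OF measurable_fst_states this]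
  show ?thesis unfolding to_segment_def[abs_def] state_space_def by measurable
qed

lemma state_dist_to_segment_le: "state_dist (to_segment p) (to_segment p') \<le> win_dist (p, p')"
proof -
  have "norm (interp \<tau> \<delta> (fst p) - interp \<tau> \<delta> (fst p')) \<le> wdist M 1 (fst p) (fst p')"
    using norm_interp_diff_le_wdist[of 1 "fst p" "fst p'"] by simp
  then show ?thesis by (simp add: state_dist_def to_segment_def win_dist_def)
qed

lemma win_norm_to_window_le: "win_norm (to_window x) \<le> norm (fst x)"
  using wdist_grid_window_le[of 1 "fst x" 0] by (simp add: win_norm_def to_window_def grid_window_zero)

lemma norm_to_segment_le: "norm (fst (to_segment p)) \<le> win_norm p"
  using norm_interp_diff_le_wdist[of 1 "fst p" "\<lambda>_. 0"] by (simp add: win_norm_def to_segment_def interp_zero)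

lemma to_window_to_segment:
  assumes "\<And>q. q > M \<Longrightarrow> fst p q = 0"
  shows "to_window (to_segment p) = p"
proof -
  have "apply_bcontfun (interp \<tau> \<delta> x) (- (real q * \<delta>)) = x q" if "q \<le> M" for q and x :: "nat \<Rightarrow> real ^ 'n"
  proof (cases "q = 0")
    case True
    then show ?thesis by (simp add: interp_at_0)
  next
    case False
    have "real q * \<delta> \<le> \<tau>" using that step_pos M_step by (metis less_imp_le mult_right_mono of_nat_le_iff)
    then have "max (- \<tau>) (min 0 (- (real q * \<delta>))) = - (real q * \<delta>)"
      using step_pos by (simp add: min_absorb2)
    moreover have "\<lfloor>- (real q * \<delta>) / \<delta>\<rfloor> = - int q" using step_pos by (simp add: floor_minus)
    moreover have "min (- 1) (- int q) = - int q" using False by simp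
    ultimately show ?thesis by (simp only: interp_apply Let_def) simp
  qed
  then have "grid_window \<delta> M (interp \<tau> \<delta> (fst p)) = fst p"
    using assms by (auto simp: grid_window_def fun_eq_iff)
  then show ?thesis by (simp add: to_window_def to_segment_def)
qed

definition law :: "nat \<Rightarrow> (real \<Rightarrow>\<^sub>C (real ^ 'n)) \<times> 's \<Rightarrow> ((real \<Rightarrow>\<^sub>C (real ^ 'n)) \<times> 's) measure" where
  "law k x = distr (stream_space noise) (state_space \<tau>) (\<lambda>s. to_segment (riter em_map k (to_window x) s))"

lemma measurable_law: "law k \<in> state_space \<tau> \<rightarrow>\<^sub>M subprob_algebra (state_space \<tau>)"
  unfolding law_def[abs_def]
proof (rule measurable_distr2)
  show "(\<lambda>(x, s). to_segment (riter em_map k (to_window x) s))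
      \<in> state_space \<tau> \<Otimes>\<^sub>M stream_space noise \<rightarrow>\<^sub>M state_space \<tau>"
    by measurable
  show "(\<lambda>x. stream_space noise) \<in> state_space \<tau> \<rightarrow>\<^sub>M subprob_algebra (stream_space noise)"
    by (simp add: space_subprob_algebra st.subprob_space_axioms)
qed

lemma prob_measuresD:
  assumes "\<nu> \<in> prob_measures \<tau>"
  shows "prob_space \<nu>" "sets \<nu> = sets (state_space \<tau>)" "space \<nu> = seg_space \<tau> \<times> UNIV"
  using assms sets_eq_imp_space_eq[of \<nu> "state_space \<tau>"]
  by (simp_all add: prob_measures_def space_state_space)

lemma bind_law_eq_distr:
  assumes \<nu>: "\<nu> \<in> prob_measures \<tau>"
  shows "\<nu> \<bind> law k = distr (\<nu> \<Otimes>\<^sub>M stream_space noise) (state_space \<tau>)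
     (\<lambda>w. to_segment (riter em_map k (to_window (fst w)) (snd w)))"
proof -
  note [measurable_cong] = prob_measuresD(2)[OF \<nu>]
  interpret \<nu>: prob_space \<nu> by (rule prob_measuresD[OF \<nu>])
  have law: "law k \<in> \<nu> \<rightarrow>\<^sub>M subprob_algebra (state_space \<tau>)"
    using measurable_law prob_measuresD(2)[OF \<nu>] by (simp cong: measurable_cong_sets)
  have ne: "space \<nu> \<noteq> {}" by (rule \<nu>.not_empty)
  show ?thesis
  proof (rule measure_eqI)
    show s: "sets (\<nu> \<bind> law k) = sets (distr (\<nu> \<Otimes>\<^sub>M stream_space noise) (state_space \<tau>)
       (\<lambda>w. to_segment (riter em_map k (to_window (fst w)) (snd w))))"
      using sets_bind_measurable[OF law ne] by simp
    fix A assume "A \<in> sets (\<nu> \<bind> law k)"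
    then have A[measurable]: "A \<in> sets (state_space \<tau>)" using s by simp
    let ?f = "\<lambda>w. to_segment (riter em_map k (to_window (fst w)) (snd w))"
    have f[measurable]: "?f \<in> \<nu> \<Otimes>\<^sub>M stream_space noise \<rightarrow>\<^sub>M state_space \<tau>" by measurable
    have "emeasure (\<nu> \<bind> law k) A = (\<integral>\<^sup>+x. emeasure (law k x) A \<partial>\<nu>)"
      by (rule emeasure_bind[OF ne law A])
    also have "\<dots> = (\<integral>\<^sup>+x. (\<integral>\<^sup>+s. indicator A (?f (x, s)) \<partial>stream_space noise) \<partial>\<nu>)"
    proof (rule nn_integral_cong)
      fix x assume "x \<in> space \<nu>"
      then have [measurable]: "(\<lambda>s. ?f (x, s)) \<in> stream_space noise \<rightarrow>\<^sub>M state_space \<tau>" by measurable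
      have "emeasure (law k x) A = (\<integral>\<^sup>+y. indicator A y \<partial>law k x)"
        by (rule nn_integral_indicator[symmetric]) (simp add: law_def)
      also have "\<dots> = (\<integral>\<^sup>+s. indicator A (?f (x, s)) \<partial>stream_space noise)"
        unfolding law_def by (subst nn_integral_distr) simp_all
      finally show "emeasure (law k x) A = (\<integral>\<^sup>+s. indicator A (?f (x, s)) \<partial>stream_space noise)" .
    qed
    also have "\<dots> = (\<integral>\<^sup>+w. indicator A (?f w) \<partial>(\<nu> \<Otimes>\<^sub>M stream_space noise))"
      by (rule st.nn_integral_fst) measurable
    also have "\<dots> = (\<integral>\<^sup>+y. indicator A y \<partial>distr (\<nu> \<Otimes>\<^sub>M stream_space noise) (state_space \<tau>) ?f)"
      by (subst nn_integral_distr) simp_all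
    also have "\<dots> = emeasure (distr (\<nu> \<Otimes>\<^sub>M stream_space noise) (state_space \<tau>) ?f) A"
      by (rule nn_integral_indicator) simp
    finally show "emeasure (\<nu> \<bind> law k) A = \<dots>" .
  qed
qed

lemma nn_integral_first_moment:
  fixes \<nu> :: "((real \<Rightarrow>\<^sub>C (real ^ 'n)) \<times> 's) measure"
  assumes "\<nu> \<in> prob_measures \<tau>"
  shows "first_moment \<nu> = (\<integral>\<^sup>+x. ennreal (norm (fst x)) \<partial>\<nu>)"
proof -
  note [measurable_cong] = prob_measuresD(2)[OF assms]
  have "first_moment \<nu> = (\<integral>\<^sup>+x. (\<Sum>i\<in>UNIV. ennreal (norm (fst x)) * indicator (UNIV \<times> {i}) x) \<partial>\<nu>)"
    unfolding first_moment_def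
  proof (rule nn_integral_sum[symmetric])
    fix i :: 's
    have "(\<lambda>x :: (real \<Rightarrow>\<^sub>C (real ^ 'n)) \<times> 's. indicator (UNIV \<times> {i}) x :: ennreal) = (\<lambda>x. indicator {i} (snd x))"
      by (auto simp: fun_eq_iff indicator_def)
    then have [measurable]: "(\<lambda>x :: (real \<Rightarrow>\<^sub>C (real ^ 'n)) \<times> 's. indicator (UNIV \<times> {i}) x :: ennreal) \<in> borel_measurable \<nu>"
      by (simp only:) measurable
    show "(\<lambda>x. ennreal (norm (fst x)) * indicator (UNIV \<times> {i}) x) \<in> borel_measurable \<nu>" by measurable
  qed
  also have "(\<lambda>x. \<Sum>i\<in>UNIV. ennreal (norm (fst x)) * indicator (UNIV \<times> {i}) x)
      = (\<lambda>x :: (real \<Rightarrow>\<^sub>C (real ^ 'n)) \<times> 's. ennreal (norm (fst x)))"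
  proof
    fix x :: "(real \<Rightarrow>\<^sub>C (real ^ 'n)) \<times> 's"
    have "(\<Sum>i\<in>UNIV. ennreal (norm (fst x)) * indicator (UNIV \<times> {i}) x)
        = (\<Sum>i\<in>UNIV. if i = snd x then ennreal (norm (fst x)) else 0)"
      by (intro sum.cong) (auto simp: indicator_def mem_Times_iff)
    then show "(\<Sum>i\<in>UNIV. ennreal (norm (fst x)) * indicator (UNIV \<times> {i}) x) = ennreal (norm (fst x))" by simp
  qed
  finally show ?thesis .
qed

text \<open>Both laws are images of one common noise stream; this synchronous coupling bounds the
  Wasserstein distance.\<close>

lemma wasserstein_law_le:
  assumes \<nu>1: "\<nu>\<^sub>1 \<in> prob_measures \<tau>" and \<nu>2: "\<nu>\<^sub>2 \<in> prob_measures \<tau>"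
  shows "wasserstein (\<nu>\<^sub>1 \<bind> law k) (\<nu>\<^sub>2 \<bind> law k)
    \<le> ennreal C * (1 + first_moment \<nu>\<^sub>1 + first_moment \<nu>\<^sub>2) * ennreal (q ^ k)"
proof -
  note [measurable_cong] = prob_measuresD(2)[OF \<nu>1] prob_measuresD(2)[OF \<nu>2]
  interpret p1: prob_space "\<nu>\<^sub>1" by (rule prob_measuresD[OF \<nu>1])
  interpret p2: prob_space "\<nu>\<^sub>2" by (rule prob_measuresD[OF \<nu>2])
  interpret p12: pair_prob_space "\<nu>\<^sub>1" "\<nu>\<^sub>2" ..
  interpret p3: pair_prob_space "\<nu>\<^sub>1 \<Otimes>\<^sub>M \<nu>\<^sub>2" "stream_space noise" ..
  let ?f = "\<lambda>x s. to_segment (riter em_map k (to_window x) s)"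
  let ?N = "(\<nu>\<^sub>1 \<Otimes>\<^sub>M \<nu>\<^sub>2) \<Otimes>\<^sub>M stream_space noise"
  define \<mu>1 where "\<mu>1 = \<nu>\<^sub>1 \<bind> law k"
  define \<mu>2 where "\<mu>2 = \<nu>\<^sub>2 \<bind> law k"
  have s1[measurable_cong]: "sets \<mu>1 = sets (state_space \<tau>)" by (simp add: \<mu>1_def bind_law_eq_distr[OF \<nu>1])
  have s2[measurable_cong]: "sets \<mu>2 = sets (state_space \<tau>)" by (simp add: \<mu>2_def bind_law_eq_distr[OF \<nu>2])
  define T where "T w = (?f (fst (fst w)) (snd w), ?f (snd (fst w)) (snd w))" for w
  have T[measurable]: "T \<in> ?N \<rightarrow>\<^sub>M \<mu>1 \<Otimes>\<^sub>M \<mu>2" unfolding T_def by measurable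
  define \<pi> where "\<pi> = distr ?N (\<mu>1 \<Otimes>\<^sub>M \<mu>2) T"
  have proj1: "distr ?N (\<nu>\<^sub>1 \<Otimes>\<^sub>M stream_space noise) (\<lambda>w. (fst (fst w), snd w)) = \<nu>\<^sub>1 \<Otimes>\<^sub>M stream_space noise"
  proof -
    interpret sf: sigma_finite_measure "distr (\<nu>\<^sub>1 \<Otimes>\<^sub>M \<nu>\<^sub>2) \<nu>\<^sub>1 fst"
      by (simp add: p2.distr_pair_fst p1.sigma_finite_measure_axioms)
    have "distr ?N (\<nu>\<^sub>1 \<Otimes>\<^sub>M stream_space noise) (\<lambda>(x, y). (fst x, id y))
        = distr (\<nu>\<^sub>1 \<Otimes>\<^sub>M \<nu>\<^sub>2) \<nu>\<^sub>1 fst \<Otimes>\<^sub>M distr (stream_space noise) (stream_space noise) id"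
      by (rule pair_measure_distr[symmetric]) (auto simp: st.sigma_finite_measure_axioms id_def distr_id)
    then show ?thesis by (simp add: p2.distr_pair_fst id_def distr_id case_prod_beta')
  qed
  have proj2: "distr ?N (\<nu>\<^sub>2 \<Otimes>\<^sub>M stream_space noise) (\<lambda>w. (snd (fst w), snd w)) = \<nu>\<^sub>2 \<Otimes>\<^sub>M stream_space noise"
  proof -
    have snd2: "distr (\<nu>\<^sub>1 \<Otimes>\<^sub>M \<nu>\<^sub>2) \<nu>\<^sub>2 snd = \<nu>\<^sub>2"
    proof (rule measure_eqI)
      fix A assume "A \<in> sets (distr (\<nu>\<^sub>1 \<Otimes>\<^sub>M \<nu>\<^sub>2) \<nu>\<^sub>2 snd)"
      then have A: "A \<in> sets \<nu>\<^sub>2" by simp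
      then have "emeasure (distr (\<nu>\<^sub>1 \<Otimes>\<^sub>M \<nu>\<^sub>2) \<nu>\<^sub>2 snd) A = emeasure (\<nu>\<^sub>1 \<Otimes>\<^sub>M \<nu>\<^sub>2) (space \<nu>\<^sub>1 \<times> A)"
        using sets.sets_into_space[OF A]
        by (subst emeasure_distr) (auto intro!: arg_cong[where f = "emeasure _"] simp: space_pair_measure)
      also have "\<dots> = emeasure \<nu>\<^sub>2 A"
        using A by (simp add: p2.emeasure_pair_measure_Times p1.emeasure_space_1)
      finally show "emeasure (distr (\<nu>\<^sub>1 \<Otimes>\<^sub>M \<nu>\<^sub>2) \<nu>\<^sub>2 snd) A = emeasure \<nu>\<^sub>2 A" .
    qed simp
    interpret sf: sigma_finite_measure "distr (\<nu>\<^sub>1 \<Otimes>\<^sub>M \<nu>\<^sub>2) \<nu>\<^sub>2 snd"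
      by (simp add: snd2 p2.sigma_finite_measure_axioms)
    have "distr ?N (\<nu>\<^sub>2 \<Otimes>\<^sub>M stream_space noise) (\<lambda>(x, y). (snd x, id y))
        = distr (\<nu>\<^sub>1 \<Otimes>\<^sub>M \<nu>\<^sub>2) \<nu>\<^sub>2 snd \<Otimes>\<^sub>M distr (stream_space noise) (stream_space noise) id"
      by (rule pair_measure_distr[symmetric]) (auto simp: st.sigma_finite_measure_axioms id_def distr_id)
    then show ?thesis by (simp add: snd2 id_def distr_id case_prod_beta')
  qed
  have "\<pi> \<in> couplings \<mu>1 \<mu>2"
    unfolding couplings_def
  proof (intro CollectI conjI)
    show "prob_space \<pi>" unfolding \<pi>_def by (rule p3.prob_space_distr) (rule T)
    show "sets \<pi> = sets (\<mu>1 \<Otimes>\<^sub>M \<mu>2)" by (simp add: \<pi>_def)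
    have "distr \<pi> \<mu>1 fst = distr ?N \<mu>1 (\<lambda>w. ?f (fst (fst w)) (snd w))"
      unfolding \<pi>_def by (subst distr_distr) (auto simp: T_def o_def)
    also have "\<dots> = distr (distr ?N (\<nu>\<^sub>1 \<Otimes>\<^sub>M stream_space noise) (\<lambda>w. (fst (fst w), snd w))) \<mu>1 (\<lambda>w. ?f (fst w) (snd w))"
      by (subst distr_distr) (auto simp: o_def)
    also have "\<dots> = distr (\<nu>\<^sub>1 \<Otimes>\<^sub>M stream_space noise) (state_space \<tau>) (\<lambda>w. ?f (fst w) (snd w))"
      unfolding proj1 by (rule distr_cong) (simp_all add: s1)
    also have "\<dots> = \<mu>1" by (simp add: \<mu>1_def bind_law_eq_distr[OF \<nu>1])
    finally show "distr \<pi> \<mu>1 fst = \<mu>1" .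
    have "distr \<pi> \<mu>2 snd = distr ?N \<mu>2 (\<lambda>w. ?f (snd (fst w)) (snd w))"
      unfolding \<pi>_def by (subst distr_distr) (auto simp: T_def o_def)
    also have "\<dots> = distr (distr ?N (\<nu>\<^sub>2 \<Otimes>\<^sub>M stream_space noise) (\<lambda>w. (snd (fst w), snd w))) \<mu>2 (\<lambda>w. ?f (fst w) (snd w))"
      by (subst distr_distr) (auto simp: o_def)
    also have "\<dots> = distr (\<nu>\<^sub>2 \<Otimes>\<^sub>M stream_space noise) (state_space \<tau>) (\<lambda>w. ?f (fst w) (snd w))"
      unfolding proj2 by (rule distr_cong) (simp_all add: s2)
    also have "\<dots> = \<mu>2" by (simp add: \<mu>2_def bind_law_eq_distr[OF \<nu>2])
    finally show "distr \<pi> \<mu>2 snd = \<mu>2" .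
  qed
  then have "wasserstein \<mu>1 \<mu>2 \<le> (\<integral>\<^sup>+z. ennreal (state_dist (fst z) (snd z)) \<partial>\<pi>)"
    unfolding wasserstein_def by (rule INF_lower)
  also have "\<dots> \<le> (\<integral>\<^sup>+w. ennreal (state_dist (fst (T w)) (snd (T w))) \<partial>?N)"
    unfolding \<pi>_def by (rule nn_integral_distr_le[OF T])
  also have "\<dots> \<le> (\<integral>\<^sup>+w. ennreal (win_dist (riter (pair_map em_map) k (to_window (fst (fst w)), to_window (snd (fst w))) (snd w))) \<partial>?N)"
    by (intro nn_integral_mono ennreal_leI) (simp add: T_def riter_pair_map state_dist_to_segment_le)
  also have "\<dots> = (\<integral>\<^sup>+v. pair_expect k (\<lambda>z. ennreal (win_dist z)) (to_window (fst v), to_window (snd v)) \<partial>(\<nu>\<^sub>1 \<Otimes>\<^sub>M \<nu>\<^sub>2))"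
    by (subst st.nn_integral_fst[symmetric]) (simp_all add: iter_expect_def)
  also have "\<dots> \<le> (\<integral>\<^sup>+v. ennreal C * (1 + ennreal (norm (fst (fst v))) + ennreal (norm (fst (snd v)))) * ennreal (q ^ k) \<partial>(\<nu>\<^sub>1 \<Otimes>\<^sub>M \<nu>\<^sub>2))"
  proof (rule nn_integral_mono)
    fix v
    have "pair_expect k (\<lambda>z. ennreal (win_dist z)) (to_window (fst v), to_window (snd v))
      \<le> ennreal (C * (1 + win_norm (to_window (fst v)) + win_norm (to_window (snd v))) * q ^ k)"
      using contraction'[of k "(to_window (fst v), to_window (snd v))"] by simp
    also have "\<dots> \<le> ennreal (C * (1 + norm (fst (fst v)) + norm (fst (snd v))) * q ^ k)"
      using C q win_norm_to_window_le by (intro ennreal_leI mult_right_mono mult_left_mono add_mono) auto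
    also have "\<dots> = ennreal C * (1 + ennreal (norm (fst (fst v))) + ennreal (norm (fst (snd v)))) * ennreal (q ^ k)"
      using C q by (simp add: ennreal_mult ennreal_plus)
    finally show "pair_expect k (\<lambda>z. ennreal (win_dist z)) (to_window (fst v), to_window (snd v))
      \<le> ennreal C * (1 + ennreal (norm (fst (fst v))) + ennreal (norm (fst (snd v)))) * ennreal (q ^ k)" .
  qed
  also have "\<dots> = ennreal C * (\<integral>\<^sup>+v. (1 + ennreal (norm (fst (fst v)))) + ennreal (norm (fst (snd v))) \<partial>(\<nu>\<^sub>1 \<Otimes>\<^sub>M \<nu>\<^sub>2)) * ennreal (q ^ k)"
    by (simp add: nn_integral_multc nn_integral_cmult)
  also have "(\<integral>\<^sup>+v. (1 + ennreal (norm (fst (fst v)))) + ennreal (norm (fst (snd v))) \<partial>(\<nu>\<^sub>1 \<Otimes>\<^sub>M \<nu>\<^sub>2))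
      = (\<integral>\<^sup>+x. (\<integral>\<^sup>+y. (1 + ennreal (norm (fst x))) + ennreal (norm (fst y)) \<partial>\<nu>\<^sub>2) \<partial>\<nu>\<^sub>1)"
    by (subst p2.nn_integral_fst[symmetric]) simp_all
  also have "\<dots> = 1 + first_moment \<nu>\<^sub>1 + first_moment \<nu>\<^sub>2"
    by (simp add: nn_integral_add p1.emeasure_space_1 p2.emeasure_space_1
        nn_integral_first_moment[OF \<nu>1] nn_integral_first_moment[OF \<nu>2])
  finally show ?thesis by (simp add: \<mu>1_def \<mu>2_def)
qed

end

subsection \<open>Existence of an invariant measure\<close>

lemma ex_diffusion_bound:
  fixes \<sigma> :: "'s::finite \<Rightarrow> real ^ 'm ^ 'n"
  shows "\<exists>s\<ge>0. \<forall>i z. norm (\<sigma> i *v z) \<le> s * norm z"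
proof (intro exI conjI allI)
  let ?o = "\<lambda>i. onorm ((*v) (\<sigma> i))"
  have o: "0 \<le> ?o i" for i by (rule onorm_pos_le) (rule matrix_vector_mul_bounded_linear)
  then show "0 \<le> (\<Sum>i\<in>UNIV. ?o i)" by (intro sum_nonneg)
  fix i z
  have "norm (\<sigma> i *v z) \<le> ?o i * norm z" by (rule onorm) (rule matrix_vector_mul_bounded_linear)
  also have "\<dots> \<le> (\<Sum>i\<in>UNIV. ?o i) * norm z"
    using o by (intro mult_right_mono member_le_sum) auto
  finally show "norm (\<sigma> i *v z) \<le> (\<Sum>i\<in>UNIV. ?o i) * norm z" .
qed

lemma ex_drift_bound:
  fixes v :: "'s::finite \<Rightarrow> 'a::real_normed_vector"
  assumes "0 < L"
  shows "\<exists>K\<ge>0. \<forall>i. norm (v i) \<le> L * K"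
proof (intro exI conjI allI)
  show "0 \<le> (\<Sum>i\<in>UNIV. norm (v i)) / L" using assms by (simp add: sum_nonneg)
  fix i
  have "norm (v i) \<le> (\<Sum>i\<in>UNIV. norm (v i))" by (intro member_le_sum) auto
  then show "norm (v i) \<le> L * ((\<Sum>i\<in>UNIV. norm (v i)) / L)" using assms by simp
qed

context em_ergodic
begin

definition bwd :: "nat \<Rightarrow> (('s \<Rightarrow> 's) \<times> (real ^ 'm)) stream \<Rightarrow> (nat \<Rightarrow> real ^ 'n) \<times> 's" where
  "bwd k s = riter em_map k (\<lambda>_. 0, undefined) s"

text \<open>The discrete component is read off from a limit of real codes, which makes its
  measurability evident.\<close>

definition bwd_lim :: "(('s \<Rightarrow> 's) \<times> (real ^ 'm)) stream \<Rightarrow> (nat \<Rightarrow> real ^ 'n) \<times> 's" where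
  "bwd_lim s = ((\<lambda>q. lim (\<lambda>k. fst (bwd k s) q)),
     from_nat (nat \<lfloor>lim (\<lambda>k. real (to_nat (snd (bwd k s))))\<rfloor>))"

definition increments :: "(('s \<Rightarrow> 's) \<times> (real ^ 'm)) stream \<Rightarrow> ennreal" where
  "increments s = (\<Sum>k. ennreal (win_dist (bwd k s, bwd (Suc k) s)))"

lemma measurable_bwd[measurable]: "bwd k \<in> stream_space noise \<rightarrow>\<^sub>M states"
  unfolding bwd_def[abs_def] by measurable

lemma measurable_bwd_lim[measurable]: "bwd_lim \<in> stream_space noise \<rightarrow>\<^sub>M states"
proof -
  have "(\<lambda>s q. lim (\<lambda>k. fst (bwd k s) q)) \<in> borel_measurable (stream_space noise)"
    by (rule measurable_coordinatewise_then_product) measurable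
  moreover have "(\<lambda>s. from_nat (nat \<lfloor>lim (\<lambda>k. real (to_nat (snd (bwd k s))))\<rfloor>) :: 's)
      \<in> stream_space noise \<rightarrow>\<^sub>M count_space UNIV"
  proof -
    have "(\<lambda>s. lim (\<lambda>k. real (to_nat (snd (bwd k s))))) \<in> borel_measurable (stream_space noise)"
    proof (rule borel_measurable_lim_metric)
      fix k
      show "(\<lambda>s. real (to_nat (snd (bwd k s)))) \<in> borel_measurable (stream_space noise)"
        by (rule measurable_compose[of "\<lambda>s. snd (bwd k s)" _ "count_space UNIV"]) measurable
    qed
    then show ?thesis by measurable
  qed
  ultimately show ?thesis unfolding bwd_lim_def[abs_def] states_def by measurable
qed

lemma measurable_increments[measurable]: "increments \<in> borel_measurable (stream_space noise)"
  unfolding increments_def[abs_def] by measurable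

text \<open>Consecutive backward iterates have summable expected distances, because they result from running
  the same maps from two starting points that are one step apart.\<close>

lemma increments_finite: "(\<integral>\<^sup>+s. increments s \<partial>stream_space noise) < \<infinity>"
proof -
  let ?x = "(\<lambda>_. 0 :: real ^ 'n, undefined :: 's)"
  define D where "D = (\<integral>\<^sup>+a. ennreal (C * (1 + win_norm (em_map ?x a))) \<partial>noise)"
  obtain s K where sK: "\<And>i z. norm (\<sigma> i *v z) \<le> s * norm z" "0 \<le> s" "\<And>i. norm (b 0 i) \<le> L * K" "0 \<le> K"
    using ex_diffusion_bound[of \<sigma>] ex_drift_bound[OF L_pos, of "b 0"] by metis
  have "D = (\<integral>\<^sup>+a. ennreal C * (1 + ennreal (win_norm (em_map ?x a))) \<partial>noise)"
    unfolding D_def using C win_norm_nonneg by (simp add: ennreal_mult ennreal_plus)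
  also have "\<dots> = ennreal C * (1 + iter_expect noise em_map 1 (\<lambda>p. ennreal (win_norm p)) ?x)"
    by (simp add: nn_integral_cmult nn_integral_add emeasure_space_1 iter_expect_Suc iter_expect_0)
  also have "iter_expect noise em_map 1 (\<lambda>p. ennreal (win_norm p)) ?x < \<infinity>"
    unfolding win_norm_def
    by (rule le_less_trans[OF moment_from_zero[OF sK]]) auto
  then have "ennreal C * (1 + iter_expect noise em_map 1 (\<lambda>p. ennreal (win_norm p)) ?x) < \<infinity>"
    by (simp add: ennreal_mult_less_top)
  finally have D: "D < \<infinity>" .
  have incr: "(\<integral>\<^sup>+s. ennreal (win_dist (bwd k s, bwd (Suc k) s)) \<partial>stream_space noise) \<le> D * ennreal (q ^ k)" for k
  proof -
    have "(\<integral>\<^sup>+s. ennreal (win_dist (bwd k s, bwd (Suc k) s)) \<partial>stream_space noise)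
        = (\<integral>\<^sup>+a. pair_expect k (\<lambda>z. ennreal (win_dist z)) (?x, em_map ?x a) \<partial>noise)"
      unfolding bwd_def by (rule nn_integral_riter_consecutive) measurable
    also have "\<dots> \<le> (\<integral>\<^sup>+a. ennreal (C * (1 + win_norm (em_map ?x a))) * ennreal (q ^ k) \<partial>noise)"
    proof (rule nn_integral_mono)
      fix a
      have "win_norm ?x = 0" by (simp add: win_norm_def wdist_def)
      then show "pair_expect k (\<lambda>z. ennreal (win_dist z)) (?x, em_map ?x a)
          \<le> ennreal (C * (1 + win_norm (em_map ?x a))) * ennreal (q ^ k)"
        using contraction'[of k "(?x, em_map ?x a)"] q C win_norm_nonneg by (simp add: ennreal_mult)
    qed
    also have "\<dots> = D * ennreal (q ^ k)" unfolding D_def by (rule nn_integral_multc) measurable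
    finally show ?thesis .
  qed
  have "(\<integral>\<^sup>+s. increments s \<partial>stream_space noise)
      = (\<Sum>k. \<integral>\<^sup>+s. ennreal (win_dist (bwd k s, bwd (Suc k) s)) \<partial>stream_space noise)"
    unfolding increments_def by (rule nn_integral_suminf) measurable
  also have "\<dots> \<le> (\<Sum>k. D * ennreal (q ^ k))" using incr by (intro suminf_le) auto
  also have "\<dots> = D * ennreal (\<Sum>k. q ^ k)"
    using q by (simp add: suminf_ennreal2 summable_geometric)
  also have "\<dots> < \<infinity>" using D by (simp add: ennreal_mult_less_top)
  finally show ?thesis .
qed

lemma bwd_beyond: "q' > M \<Longrightarrow> fst (bwd k s) q' = 0"
  unfolding bwd_def by (induction k arbitrary: s) (auto simp: em_map_def window_step_def)

lemma bwd_converges: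
  assumes "increments s < \<infinity>"
  shows "(\<lambda>k. fst (bwd k s) p) \<longlonglongrightarrow> fst (bwd_lim s) p"
    and "eventually (\<lambda>k. snd (bwd k s) = snd (bwd_lim s)) sequentially"
    and "p > M \<Longrightarrow> fst (bwd_lim s) p = 0"
    and "ennreal (win_norm (bwd_lim s)) \<le> increments s"
proof -
  define d where "d k = win_dist (bwd k s, bwd (Suc k) s)" for k
  have d0: "0 \<le> d k" for k by (simp add: d_def win_dist_nonneg)
  have sum_d: "summable d"
    using assms d0 by (intro summable_suminf_not_top) (auto simp: increments_def d_def)
  have step: "norm (fst (bwd (Suc k) s) p - fst (bwd k s) p) \<le> d k" for k p
  proof (cases "p \<le> M")
    case True
    have "norm (fst (bwd (Suc k) s) p - fst (bwd k s) p) \<le> wdist M 1 (fst (bwd k s)) (fst (bwd (Suc k) s))"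
      using wdist_ge[OF True, of 1 "fst (bwd k s)" "fst (bwd (Suc k) s)"] by (simp add: norm_minus_commute)
    then show ?thesis by (simp add: d_def win_dist_def add_increasing2)
  next
    case False
    then show ?thesis using d0 by (simp add: bwd_beyond)
  qed
  have tele: "fst (bwd n s) p = (\<Sum>k<n. fst (bwd (Suc k) s) p - fst (bwd k s) p)" for n p
  proof -
    have "fst (bwd 0 s) p = 0" by (simp add: bwd_def)
    then show ?thesis using sum_lessThan_telescope[of "\<lambda>k. fst (bwd k s) p" n] by simp
  qed
  have lim: "(\<lambda>k. fst (bwd k s) p) \<longlonglongrightarrow> fst (bwd_lim s) p" for p
  proof -
    have "summable (\<lambda>k. fst (bwd (Suc k) s) p - fst (bwd k s) p)"
      by (rule summable_comparison_test[OF _ sum_d]) (use step in auto)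
    then have "convergent (\<lambda>n. \<Sum>k<n. fst (bwd (Suc k) s) p - fst (bwd k s) p)"
      by (rule summable_LIMSEQ[THEN convergentI])
    then have "convergent (\<lambda>k. fst (bwd k s) p)" by (simp only: tele[symmetric])
    then show ?thesis by (simp add: bwd_lim_def convergent_LIMSEQ_iff)
  qed
  then show "(\<lambda>k. fst (bwd k s) p) \<longlonglongrightarrow> fst (bwd_lim s) p" .
  show "p > M \<Longrightarrow> fst (bwd_lim s) p = 0" by (simp add: bwd_lim_def bwd_beyond)
  have "eventually (\<lambda>k. d k < 1) sequentially"
    using summable_LIMSEQ_zero[OF sum_d] by (rule order_tendstoD) simp
  then obtain N where N: "\<And>k. k \<ge> N \<Longrightarrow> d k < 1" by (auto simp: eventually_sequentially)
  have eq: "snd (bwd (Suc k) s) = snd (bwd k s)" if "k \<ge> N" for k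
    using N[OF that] wdist_nonneg[of 1 M "fst (bwd k s)" "fst (bwd (Suc k) s)"]
    by (auto simp: d_def win_dist_def of_bool_def split: if_splits)
  have const: "snd (bwd k s) = snd (bwd N s)" if "k \<ge> N" for k
    using that by (induction k rule: dec_induct) (simp_all add: eq del: riter.simps)
  have "(\<lambda>k. real (to_nat (snd (bwd k s)))) \<longlonglongrightarrow> real (to_nat (snd (bwd N s)))"
    by (rule tendsto_eventually, rule eventually_sequentiallyI[of N]) (metis const)
  then have lim_N: "snd (bwd_lim s) = snd (bwd N s)" by (simp add: bwd_lim_def limI)
  show "eventually (\<lambda>k. snd (bwd k s) = snd (bwd_lim s)) sequentially"
    unfolding lim_N by (rule eventually_sequentiallyI[of N]) (rule const)
  have bnd: "norm (fst (bwd_lim s) p) \<le> suminf d" for p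
  proof (rule tendsto_upperbound[OF tendsto_norm[OF lim]])
    have "norm (fst (bwd n s) p) \<le> suminf d" for n
    proof -
      have "norm (fst (bwd n s) p) \<le> (\<Sum>k<n. d k)"
        unfolding tele[of n p] by (intro sum_norm_le step)
      also have "\<dots> \<le> suminf d" using sum_d d0 by (intro sum_le_suminf) auto
      finally show ?thesis .
    qed
    then show "eventually (\<lambda>n. norm (fst (bwd n s) p) \<le> suminf d) sequentially" by simp
  qed simp
  have "win_norm (bwd_lim s) \<le> suminf d"
    unfolding win_norm_def wdist_le_iff using bnd by simp
  then have "ennreal (win_norm (bwd_lim s)) \<le> ennreal (suminf d)" by (rule ennreal_leI)
  also have "\<dots> = increments s"
    unfolding increments_def d_def[symmetric] using d0 sum_d by (intro suminf_ennreal2[symmetric])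
  finally show "ennreal (win_norm (bwd_lim s)) \<le> increments s" .
qed

lemma AE_increments: "AE s in stream_space noise. increments s < \<infinity>"
  using nn_integral_PInf_AE[OF measurable_increments] increments_finite by (auto simp: less_top)

lemma distr_stl: "distr (stream_space noise) (stream_space noise) stl = stream_space noise"
proof (rule measure_eqI)
  fix A assume "A \<in> sets (distr (stream_space noise) (stream_space noise) stl)"
  then have A[measurable]: "A \<in> sets (stream_space noise)" by simp
  have "emeasure (distr (stream_space noise) (stream_space noise) stl) A
      = (\<integral>\<^sup>+s. indicator A s \<partial>distr (stream_space noise) (stream_space noise) stl)"
    by (rule nn_integral_indicator[symmetric]) simp
  also have "\<dots> = (\<integral>\<^sup>+s. indicator A (stl s) \<partial>stream_space noise)" by (rule nn_integral_distr) simp_all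
  also have "\<dots> = (\<integral>\<^sup>+a. \<integral>\<^sup>+s. indicator A (stl (a ## s)) \<partial>stream_space noise \<partial>noise)"
    by (rule nn_integral_stream_space) measurable
  also have "\<dots> = emeasure (stream_space noise) A" by (simp add: emeasure_space_1)
  finally show "emeasure (distr (stream_space noise) (stream_space noise) stl) A = emeasure (stream_space noise) A" .
qed simp

text \<open>The limit is a fixed point of the random map applied last, because that map is continuous.\<close>

lemma bwd_lim_fixed_point: "AE s in stream_space noise. bwd_lim s = em_map (bwd_lim (stl s)) (shd s)"
proof -
  have "AE s in distr (stream_space noise) (stream_space noise) stl. increments s < \<infinity>"
    by (subst distr_stl) (rule AE_increments)
  then have "AE s in stream_space noise. increments (stl s) < \<infinity>"
    by (rule AE_distrD[OF measurable_stl])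
  with AE_increments show ?thesis
  proof eventually_elim
    fix s assume s: "increments s < \<infinity>" "increments (stl s) < \<infinity>"
    note c = bwd_converges[OF s(1)] and c' = bwd_converges[OF s(2)]
    let ?y = "bwd_lim (stl s)" and ?a = "shd s"
    have rec: "bwd (Suc k) s = em_map (bwd k (stl s)) ?a" for k by (simp add: bwd_def)
    have ev: "eventually (\<lambda>k. snd (bwd k (stl s)) = snd ?y) sequentially" by (rule c'(2))
    have sndeq: "snd (bwd_lim s) = snd (em_map ?y ?a)"
    proof -
      have "eventually (\<lambda>k. snd (bwd (Suc k) s) = snd (bwd_lim s)) sequentially"
        using c(2) eventually_sequentially_Suc[of "\<lambda>k. snd (bwd k s) = snd (bwd_lim s)"] by blast
      then have "eventually (\<lambda>k. snd (bwd_lim s) = snd (em_map ?y ?a)) sequentially"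
        using ev by eventually_elim (simp add: rec em_map_def)
      then show ?thesis by simp
    qed
    have drift: "(\<lambda>k. b (interp \<tau> \<delta> (fst (bwd k (stl s)))) (snd ?y)) \<longlonglongrightarrow> b (interp \<tau> \<delta> (fst ?y)) (snd ?y)"
    proof -
      have "(\<lambda>k. \<Sum>p\<le>M. norm (fst (bwd k (stl s)) p - fst ?y p)) \<longlonglongrightarrow> (\<Sum>p\<le>M. norm (fst ?y p - fst ?y p))"
        by (intro tendsto_intros c'(1))
      then have lim: "(\<lambda>k. L * (\<Sum>p\<le>M. norm (fst (bwd k (stl s)) p - fst ?y p))) \<longlonglongrightarrow> 0"
        using tendsto_mult_right_zero by fastforce
      have le: "norm (b (interp \<tau> \<delta> x) i - b (interp \<tau> \<delta> y) i) \<le> L * (\<Sum>p\<le>M. norm (x p - y p))" for x y i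
      proof -
        have "norm (interp \<tau> \<delta> x - interp \<tau> \<delta> y) \<le> (\<Sum>p\<le>M. norm (x p - y p))"
          by (rule norm_interp_diff_le) (auto intro: member_le_sum)
        then have "L * norm (interp \<tau> \<delta> x - interp \<tau> \<delta> y) \<le> L * (\<Sum>p\<le>M. norm (x p - y p))"
          using L_pos by (intro mult_left_mono) auto
        then show ?thesis
          using lipschitz[OF interp_in_seg_space interp_in_seg_space, of x i y] by simp
      qed
      show ?thesis
        by (rule LIM_zero_cancel, rule Lim_null_comparison[OF always_eventually lim]) (use le in auto)
    qed
    have "fst (bwd_lim s) p = fst (em_map ?y ?a) p" for p
    proof -
      have "(\<lambda>k. next_window (fst (bwd k (stl s))) (snd ?y) (snd ?a) p)
          \<longlonglongrightarrow> next_window (fst ?y) (snd ?y) (snd ?a) p"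
        unfolding window_step_def by (auto intro!: tendsto_intros c'(1) drift)
      moreover have "eventually (\<lambda>k. next_window (fst (bwd k (stl s))) (snd ?y) (snd ?a) p
          = fst (em_map (bwd k (stl s)) ?a) p) sequentially"
        using ev by eventually_elim (simp add: em_map_def)
      ultimately have "(\<lambda>k. fst (em_map (bwd k (stl s)) ?a) p) \<longlonglongrightarrow> fst (em_map ?y ?a) p"
        unfolding em_map_def[of ?y] fst_conv by (rule Lim_transform_eventually)
      moreover have "(\<lambda>k. fst (em_map (bwd k (stl s)) ?a) p) \<longlonglongrightarrow> fst (bwd_lim s) p"
        using LIMSEQ_Suc[OF c(1)[of p]] by (simp add: rec)
      ultimately show ?thesis by (rule LIMSEQ_unique[symmetric])
    qed
    then show "bwd_lim s = em_map ?y ?a" using sndeq by (simp add: prod_eq_iff fun_eq_iff)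
  qed
qed

lemma nn_integral_bwd_lim_iter:
  assumes "h \<in> borel_measurable states"
  shows "(\<integral>\<^sup>+s. iter_expect noise em_map k h (bwd_lim s) \<partial>stream_space noise)
    = (\<integral>\<^sup>+s. h (bwd_lim s) \<partial>stream_space noise)"
  using assms
proof (induction k arbitrary: h)
  case (Suc k)
  note [measurable] = Suc.prems
  interpret pair_sigma_finite "stream_space noise" noise ..
  have "(\<integral>\<^sup>+s. iter_expect noise em_map (Suc k) h (bwd_lim s) \<partial>stream_space noise)
      = (\<integral>\<^sup>+s. \<integral>\<^sup>+a. h (em_map (bwd_lim s) a) \<partial>noise \<partial>stream_space noise)"
    by (simp add: iter_expect_Suc Suc.IH)
  also have "\<dots> = (\<integral>\<^sup>+a. \<integral>\<^sup>+s. h (em_map (bwd_lim (stl (a ## s))) (shd (a ## s))) \<partial>stream_space noise \<partial>noise)"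
    by (simp, rule Fubini'[symmetric]) measurable
  also have "\<dots> = (\<integral>\<^sup>+s. h (em_map (bwd_lim (stl s)) (shd s)) \<partial>stream_space noise)"
    by (rule nn_integral_stream_space[symmetric]) measurable
  also have "\<dots> = (\<integral>\<^sup>+s. h (bwd_lim s) \<partial>stream_space noise)"
    by (rule nn_integral_cong_AE) (use bwd_lim_fixed_point in eventually_elim, simp)
  finally show ?case .
qed (simp add: iter_expect_0)

lemma emeasure_law:
  assumes [measurable]: "A \<in> sets (state_space \<tau>)"
  shows "emeasure (law k x) A = iter_expect noise em_map k (\<lambda>p. indicator A (to_segment p)) (to_window x)"
proof -
  have "emeasure (law k x) A = (\<integral>\<^sup>+y. indicator A y \<partial>law k x)"
    by (rule nn_integral_indicator[symmetric]) (simp add: law_def)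
  also have "\<dots> = (\<integral>\<^sup>+s. indicator A (to_segment (riter em_map k (to_window x) s)) \<partial>stream_space noise)"
    unfolding law_def by (subst nn_integral_distr) simp_all
  finally show ?thesis by (simp add: iter_expect_def)
qed

definition inv_measure :: "((real \<Rightarrow>\<^sub>C (real ^ 'n)) \<times> 's) measure" where
  "inv_measure = distr (stream_space noise) (state_space \<tau>) (\<lambda>s. to_segment (bwd_lim s))"

lemma inv_measure_prob: "inv_measure \<in> prob_measures \<tau>"
  unfolding prob_measures_def inv_measure_def by (auto intro!: st.prob_space_distr)

lemma inv_measure_moment: "inv_measure \<in> prob_measures0 \<tau>"
proof -
  have "first_moment inv_measure = (\<integral>\<^sup>+x. ennreal (norm (fst x)) \<partial>inv_measure)"
    by (rule nn_integral_first_moment[OF inv_measure_prob])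
  also have "\<dots> = (\<integral>\<^sup>+s. ennreal (norm (fst (to_segment (bwd_lim s)))) \<partial>stream_space noise)"
    unfolding inv_measure_def by (rule nn_integral_distr) measurable
  also have "\<dots> \<le> (\<integral>\<^sup>+s. increments s \<partial>stream_space noise)"
  proof (rule nn_integral_mono_AE)
    show "AE s in stream_space noise. ennreal (norm (fst (to_segment (bwd_lim s)))) \<le> increments s"
      using AE_increments
    proof eventually_elim
      fix s assume "increments s < \<infinity>"
      from bwd_converges(4)[OF this] show "ennreal (norm (fst (to_segment (bwd_lim s)))) \<le> increments s"
        using norm_to_segment_le[of "bwd_lim s"] by (meson ennreal_leI order_trans)
    qed
  qed
  also have "\<dots> < \<infinity>" by (rule increments_finite)
  finally show ?thesis using inv_measure_prob by (simp add: prob_measures0_def)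
qed

lemma inv_measure_invariant: "inv_measure \<bind> law k = inv_measure"
proof (rule measure_eqI)
  interpret \<mu>: prob_space inv_measure by (rule prob_measuresD[OF inv_measure_prob])
  have s: "sets inv_measure = sets (state_space \<tau>)" by (simp add: inv_measure_def)
  have law: "law k \<in> inv_measure \<rightarrow>\<^sub>M subprob_algebra (state_space \<tau>)"
    using measurable_law s by (simp cong: measurable_cong_sets)
  show "sets (inv_measure \<bind> law k) = sets inv_measure"
    using sets_bind_measurable[OF law \<mu>.not_empty] s by simp
  fix A assume "A \<in> sets (inv_measure \<bind> law k)"
  then have A[measurable]: "A \<in> sets (state_space \<tau>)"
    using sets_bind_measurable[OF law \<mu>.not_empty] by simp
  have "emeasure (inv_measure \<bind> law k) A = (\<integral>\<^sup>+x. emeasure (law k x) A \<partial>inv_measure)"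
    by (rule emeasure_bind[OF \<mu>.not_empty law A])
  also have "\<dots> = (\<integral>\<^sup>+x. iter_expect noise em_map k (\<lambda>p. indicator A (to_segment p)) (to_window x) \<partial>inv_measure)"
    by (simp add: emeasure_law)
  also have "\<dots> = (\<integral>\<^sup>+s. iter_expect noise em_map k (\<lambda>p. indicator A (to_segment p)) (to_window (to_segment (bwd_lim s))) \<partial>stream_space noise)"
    unfolding inv_measure_def by (rule nn_integral_distr) measurable
  also have "\<dots> = (\<integral>\<^sup>+s. iter_expect noise em_map k (\<lambda>p. indicator A (to_segment p)) (bwd_lim s) \<partial>stream_space noise)"
  proof (rule nn_integral_cong_AE)
    show "AE s in stream_space noise. iter_expect noise em_map k (\<lambda>p. indicator A (to_segment p)) (to_window (to_segment (bwd_lim s)))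
        = iter_expect noise em_map k (\<lambda>p. indicator A (to_segment p)) (bwd_lim s)"
      using AE_increments by eventually_elim (subst to_window_to_segment, simp_all add: bwd_converges(3))
  qed
  also have "\<dots> = (\<integral>\<^sup>+s. indicator A (to_segment (bwd_lim s)) \<partial>stream_space noise)"
    by (rule nn_integral_bwd_lim_iter) measurable
  also have "\<dots> = (\<integral>\<^sup>+x. indicator A x \<partial>inv_measure)"
    unfolding inv_measure_def by (rule nn_integral_distr[symmetric]) measurable
  also have "\<dots> = emeasure inv_measure A"
    by (rule nn_integral_indicator) (simp add: s)
  finally show "emeasure (inv_measure \<bind> law k) A = emeasure inv_measure A" .
qed

end

subsection \<open>Uniqueness\<close>

text \<open>The closed sets generate the Borel sets and are stable under intersections.\<close>

lemma measure_eqI_closed_slices: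
  fixes \<mu> \<nu> :: "((real \<Rightarrow>\<^sub>C (real ^ 'n)) \<times> 's::finite) measure"
  assumes \<mu>: "\<mu> \<in> prob_measures \<tau>" and \<nu>: "\<nu> \<in> prob_measures \<tau>"
    and eq: "\<And>C i. closed C \<Longrightarrow> emeasure \<nu> {x \<in> space \<nu>. fst x \<in> C \<and> snd x = i}
        = emeasure \<mu> {x \<in> space \<mu>. fst x \<in> C \<and> snd x = i}"
  shows "\<nu> = \<mu>"
proof (rule measure_eqI)
  have sets: "sets \<mu> = sets (state_space \<tau>)" "sets \<nu> = sets (state_space \<tau>)"
    using \<mu> \<nu> by (auto simp: prob_measures_def)
  note [measurable_cong] = sets
  have sp: "space \<mu> = seg_space \<tau> \<times> UNIV" "space \<nu> = seg_space \<tau> \<times> UNIV"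
    using sets[THEN sets_eq_imp_space_eq]
    by (auto simp: state_space_def space_pair_measure space_restrict_space)
  have fst_meas[measurable]: "fst \<in> borel_measurable (state_space \<tau> :: ((real \<Rightarrow>\<^sub>C (real ^ 'n)) \<times> 's) measure)"
    unfolding state_space_def
    by (rule measurable_compose[OF measurable_fst]) (rule measurable_restrict_space1, simp)
  have snd_meas[measurable]: "snd \<in> state_space \<tau> \<rightarrow>\<^sub>M (count_space UNIV :: 's measure)"
    unfolding state_space_def by measurable
  show "sets \<nu> = sets \<mu>" by (simp add: sets)
  define slice where "slice N i = distr (restrict_space N {x \<in> space N. snd x = i}) borel fst"
    for N :: "((real \<Rightarrow>\<^sub>C (real ^ 'n)) \<times> 's) measure" and i
  have em: "emeasure (slice N i) B = emeasure N {x \<in> space N. fst x \<in> B \<and> snd x = i}"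
    if [measurable_cong]: "sets N = sets (state_space \<tau>)" and B: "B \<in> sets borel" for N i B
  proof -
    have [measurable]: "{x \<in> space N. snd x = i} \<in> sets N" by measurable
    have "emeasure (slice N i) B
        = emeasure (restrict_space N {x \<in> space N. snd x = i}) (fst -` B \<inter> space (restrict_space N {x \<in> space N. snd x = i}))"
      unfolding slice_def using B
      by (intro emeasure_distr measurable_restrict_space1) (simp_all add: that(1) cong: measurable_cong_sets)
    also have "\<dots> = emeasure N (fst -` B \<inter> space (restrict_space N {x \<in> space N. snd x = i}))"
      by (rule emeasure_restrict_space) (auto simp: space_restrict_space)
    also have "fst -` B \<inter> space (restrict_space N {x \<in> space N. snd x = i}) = {x \<in> space N. fst x \<in> B \<and> snd x = i}"
      by (auto simp: space_restrict_space)
    finally show ?thesis .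
  qed
  have slices: "slice \<nu> i = slice \<mu> i" for i
  proof (rule measure_eqI_generator_eq[where E = "Collect closed" and \<Omega> = UNIV and A = "\<lambda>_. UNIV"])
    show "Int_stable (Collect closed :: (real \<Rightarrow>\<^sub>C (real ^ 'n)) set set)" by (auto simp: Int_stable_def)
    have "sets borel = sigma_sets UNIV (Collect closed :: (real \<Rightarrow>\<^sub>C (real ^ 'n)) set set)"
      by (subst borel_eq_closed) simp
    then show "sets (slice \<nu> i) = sigma_sets UNIV (Collect closed)" "sets (slice \<mu> i) = sigma_sets UNIV (Collect closed)"
      by (simp_all add: slice_def)
    show "emeasure (slice \<nu> i) X = emeasure (slice \<mu> i) X" if "X \<in> Collect closed" for X
      using that eq[of X i] by (simp add: em sets)
    have "prob_space \<nu>" using \<nu> by (simp add: prob_measures_def)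
    then have "emeasure \<nu> A \<noteq> \<infinity>" for A
      by (metis ennreal_one_less_top infinity_ennreal_def leD prob_space.measure_le_1 prob_space.emeasure_le_1 top.not_eq_extremum)
    then show "emeasure (slice \<nu> i) UNIV \<noteq> \<infinity>" by (simp add: em sets)
  qed auto
  fix A assume "A \<in> sets \<nu>"
  then have A: "A \<in> sets (state_space \<tau>)" by (simp add: sets)
  have "\<exists>B. B \<in> sets borel \<and> {\<xi>. (\<xi>, i) \<in> A} = B \<inter> seg_space \<tau>" for i
  proof -
    have "(\<lambda>\<xi>. (\<xi>, i)) -` A \<inter> space (restrict_space borel (seg_space \<tau>)) \<in> sets (restrict_space borel (seg_space \<tau>))"
      using A unfolding state_space_def by (intro measurable_sets[OF measurable_Pair2']) auto
    then obtain B where "B \<in> sets borel" "(\<lambda>\<xi>. (\<xi>, i)) -` A \<inter> seg_space \<tau> = seg_space \<tau> \<inter> B"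
      by (auto simp: sets_restrict_space space_restrict_space)
    moreover have "A \<subseteq> seg_space \<tau> \<times> UNIV" using sets.sets_into_space[OF \<open>A \<in> sets \<nu>\<close>] sp by simp
    ultimately show ?thesis by (intro exI[of _ B]) auto
  qed
  then obtain B where B: "\<And>i. B i \<in> sets borel" "\<And>i. {\<xi>. (\<xi>, i) \<in> A} = B i \<inter> seg_space \<tau>" by metis
  have decomp: "emeasure N A = (\<Sum>i\<in>UNIV. emeasure (slice N i) (B i))"
    if N: "sets N = sets (state_space \<tau>)" "space N = seg_space \<tau> \<times> UNIV" for N
  proof -
    note [measurable_cong] = N(1)
    have "(\<xi>, i) \<in> A \<longleftrightarrow> \<xi> \<in> B i \<and> \<xi> \<in> seg_space \<tau>" for \<xi> i
      using B(2)[of i] by blast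
    then have "A = (\<Union>i\<in>UNIV. {x \<in> space N. fst x \<in> B i \<and> snd x = i})"
      unfolding N(2) by auto
    also have "emeasure N \<dots> = (\<Sum>i\<in>UNIV. emeasure N {x \<in> space N. fst x \<in> B i \<and> snd x = i})"
    proof (rule sum_emeasure[symmetric])
      have "{x \<in> space N. fst x \<in> B i \<and> snd x = i} \<in> sets N" for i
        using B(1)[of i] by measurable
      then show "(\<lambda>i. {x \<in> space N. fst x \<in> B i \<and> snd x = i}) ` UNIV \<subseteq> sets N" by auto
    qed (auto simp: disjoint_family_on_def)
    finally show ?thesis using B(1) by (simp add: em N(1))
  qed
  show "emeasure \<nu> A = emeasure \<mu> A" by (simp add: decomp sets sp slices)
qed

context em_ergodic
begin

text \<open>An invariant measure is not known to have a first moment, so a bound on the Wasserstein distance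
  of two of them would be void.  Instead, start from both and use the same noise: the two copies are within distance
  \<open>e\<close> of each other with a probability that tends to one.  Hence the mass of a closed set under one
  measure is at most the mass of its \<open>e\<close>-neighbourhood under the other one.\<close>

lemma invariant_closed_le:
  fixes \<mu> \<nu> :: "((real \<Rightarrow>\<^sub>C (real ^ 'n)) \<times> 's) measure"
  assumes \<mu>: "\<mu> \<in> prob_measures \<tau>" "\<And>k. \<mu> \<bind> law k = \<mu>"
    and \<nu>: "\<nu> \<in> prob_measures \<tau>" "\<And>k. \<nu> \<bind> law k = \<nu>"
    and D: "closed D"
  shows "emeasure \<nu> {x \<in> space \<nu>. fst x \<in> D \<and> snd x = i} \<le> emeasure \<mu> {x \<in> space \<mu>. fst x \<in> D \<and> snd x = i}"
proof (cases "D = {}")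
  case False
  note [measurable_cong] = prob_measuresD(2)[OF \<mu>(1)] prob_measuresD(2)[OF \<nu>(1)]
  interpret p1: prob_space \<nu> by (rule prob_measuresD[OF \<nu>(1)])
  interpret p2: prob_space \<mu> by (rule prob_measuresD[OF \<mu>(1)])
  interpret p12: pair_prob_space \<nu> \<mu> ..
  have sp: "space \<nu> = seg_space \<tau> \<times> UNIV" "space \<mu> = seg_space \<tau> \<times> UNIV"
    using prob_measuresD(3)[OF \<nu>(1)] prob_measuresD(3)[OF \<mu>(1)] by auto
  have infd[measurable]: "(\<lambda>x. infdist (fst x) D) \<in> borel_measurable (state_space \<tau> :: ((real \<Rightarrow>\<^sub>C (real ^ 'n)) \<times> 's) measure)"
    by (rule measurable_compose[OF measurable_fst_state_space])
       (intro borel_measurable_continuous_onI continuous_intros)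
  define A where "A e = {x \<in> space (state_space \<tau>). infdist (fst x) D \<le> e \<and> snd x = i}" for e
  have A[measurable]: "A e \<in> sets (state_space \<tau>)" for e unfolding A_def by measurable
  have A0: "{x \<in> space N. fst x \<in> D \<and> snd x = i} = A 0" if "space N = seg_space \<tau> \<times> UNIV"
    for N :: "((real \<Rightarrow>\<^sub>C (real ^ 'n)) \<times> 's) measure"
    using in_closed_iff_infdist_zero[OF D False] infdist_nonneg[of _ D] that
    by (auto simp: A_def space_state_space order_antisym_conv)
  have stat: "emeasure N B = (\<integral>\<^sup>+x. iter_expect noise em_map k (\<lambda>p. indicator B (to_segment p)) (to_window x) \<partial>N)"
    if N: "N \<in> prob_measures \<tau>" "N \<bind> law k = N" and B: "B \<in> sets (state_space \<tau>)" for N B k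
  proof -
    interpret N: prob_space N by (rule prob_measuresD[OF N(1)])
    have "law k \<in> N \<rightarrow>\<^sub>M subprob_algebra (state_space \<tau>)"
      using measurable_law prob_measuresD(2)[OF N(1)] by (simp cong: measurable_cong_sets)
    then have "emeasure (N \<bind> law k) B = (\<integral>\<^sup>+x. emeasure (law k x) B \<partial>N)"
      by (rule emeasure_bind[OF N.not_empty _ B])
    then show ?thesis by (simp add: N(2) emeasure_law[OF B])
  qed
  have bound: "emeasure \<nu> (A 0) \<le> emeasure \<mu> (A e)" if e: "0 < e" "e < 1" for e
  proof -
    define g where "g v k = C * (1 + win_norm (to_window (fst v)) + win_norm (to_window (snd v))) / e * q ^ k" for v and k :: nat
    have g_meas[measurable]: "(\<lambda>v. g v k) \<in> borel_measurable (\<nu> \<Otimes>\<^sub>M \<mu>)" for k unfolding g_def by measurable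
    define R where "R k = (\<integral>\<^sup>+v. min 1 (ennreal (g v k)) \<partial>(\<nu> \<Otimes>\<^sub>M \<mu>))" for k
    have R: "R \<longlonglongrightarrow> 0"
    proof -
      have "(\<lambda>k. \<integral>\<^sup>+v. min 1 (ennreal (g v k)) \<partial>(\<nu> \<Otimes>\<^sub>M \<mu>)) \<longlonglongrightarrow> (\<integral>\<^sup>+v. 0 \<partial>(\<nu> \<Otimes>\<^sub>M \<mu>))"
      proof (rule nn_integral_dominated_convergence[where w = "\<lambda>_. 1"])
        show "AE v in \<nu> \<Otimes>\<^sub>M \<mu>. (\<lambda>k. min 1 (ennreal (g v k))) \<longlonglongrightarrow> 0"
        proof (intro AE_I2)
          fix v
          have "(\<lambda>k. q ^ k) \<longlonglongrightarrow> 0" using q by (intro LIMSEQ_power_zero) auto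
          then have "(\<lambda>k. g v k) \<longlonglongrightarrow> 0" unfolding g_def by (rule tendsto_mult_right_zero)
          then have "(\<lambda>k. ennreal (g v k)) \<longlonglongrightarrow> ennreal 0" by (rule tendsto_ennrealI)
          then have "(\<lambda>k. min 1 (ennreal (g v k))) \<longlonglongrightarrow> min 1 (ennreal 0)" by (intro tendsto_min tendsto_const)
          then show "(\<lambda>k. min 1 (ennreal (g v k))) \<longlonglongrightarrow> 0" by simp
        qed
      qed (simp_all add: p12.emeasure_space_1)
      then show ?thesis by (simp add: R_def[abs_def])
    qed
    have le_R: "emeasure \<nu> (A 0) \<le> emeasure \<mu> (A e) + R k" for k
    proof -
      let ?E = "pair_expect k"
      let ?w = "\<lambda>v. (to_window (fst v), to_window (snd v))"
      have "emeasure \<nu> (A 0) = (\<integral>\<^sup>+x. iter_expect noise em_map k (\<lambda>p. indicator (A 0) (to_segment p)) (to_window x) \<partial>\<nu>)"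
        by (rule stat[OF \<nu> A])
      also have "\<dots> = (\<integral>\<^sup>+v. iter_expect noise em_map k (\<lambda>p. indicator (A 0) (to_segment p)) (to_window (fst v)) \<partial>(\<nu> \<Otimes>\<^sub>M \<mu>))"
        by (subst p2.nn_integral_fst[symmetric]) (simp_all add: p2.emeasure_space_1)
      also have "\<dots> \<le> (\<integral>\<^sup>+v. iter_expect noise em_map k (\<lambda>p. indicator (A e) (to_segment p)) (to_window (snd v))
          + min 1 (ennreal (g v k)) \<partial>(\<nu> \<Otimes>\<^sub>M \<mu>))"
      proof (rule nn_integral_mono)
        fix v :: "((real \<Rightarrow>\<^sub>C (real ^ 'n)) \<times> 's) \<times> ((real \<Rightarrow>\<^sub>C (real ^ 'n)) \<times> 's)"
        define far where "far z = (of_bool (e < win_dist z) :: ennreal)" for z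
        have [measurable]: "far \<in> borel_measurable (states \<Otimes>\<^sub>M states)"
          unfolding far_def[abs_def] of_bool_def by measurable
        have close: "indicator (A 0) (to_segment p) \<le> indicator (A e) (to_segment p') + far (p, p')" for p p'
        proof (cases "e < win_dist (p, p')")
          case False
          then have d: "norm (fst (to_segment p) - fst (to_segment p')) + (if snd p \<noteq> snd p' then 1 else 0) \<le> e"
            using state_dist_to_segment_le[of p p'] by (simp add: state_dist_def to_segment_def)
          have "snd p = snd p'" using d e by (smt (verit) norm_ge_zero)
          moreover have "infdist (fst (to_segment p')) D \<le> infdist (fst (to_segment p)) D + dist (fst (to_segment p')) (fst (to_segment p))"
            by (rule infdist_triangle)
          moreover have "dist (fst (to_segment p')) (fst (to_segment p)) \<le> e"
            using d by (simp add: dist_norm norm_minus_commute split: if_splits)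
          moreover have "to_segment p' \<in> space (state_space \<tau>)"
            by (simp add: space_state_space to_segment_def interp_in_seg_space)
          ultimately have "to_segment p \<in> A 0 \<Longrightarrow> to_segment p' \<in> A e"
            by (auto simp: A_def to_segment_def)
          then show ?thesis by (auto simp: indicator_def)
        qed (simp add: far_def indicator_def)
        have E_far: "?E far (?w v) \<le> min 1 (ennreal (g v k))"
        proof (rule min.boundedI)
          have "?E far (?w v) \<le> ?E (\<lambda>_. 1) (?w v)"
            by (rule pair.iter_expect_mono) (simp add: far_def)
          then show "?E far (?w v) \<le> 1" by (simp add: pair.iter_expect_const)
          have far_le: "far z \<le> ennreal (1 / e) * ennreal (win_dist z)" for z
          proof (cases "e < win_dist z")
            case True
            then have far1: "far z = ennreal 1" by (simp add: far_def)
            have "ennreal 1 \<le> ennreal (1 / e * win_dist z)" using e True by (intro ennreal_leI) (simp add: field_simps)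
            also have "\<dots> = ennreal (1 / e) * ennreal (win_dist z)" by (rule ennreal_mult') (use e in simp)
            finally show ?thesis unfolding far1 .
          qed (simp add: far_def)
          have "?E far (?w v) \<le> ?E (\<lambda>z. ennreal (1 / e) * ennreal (win_dist z)) (?w v)"
            by (rule pair.iter_expect_mono) (rule far_le)
          also have "\<dots> = ennreal (1 / e) * ?E (\<lambda>z. ennreal (win_dist z)) (?w v)"
            by (rule pair.iter_expect_cmult) measurable
          also have "\<dots> \<le> ennreal (1 / e) * ennreal (C * (1 + win_norm (fst (?w v)) + win_norm (snd (?w v))) * q ^ k)"
            by (intro mult_left_mono contraction') simp
          also have "\<dots> = ennreal (g v k)"
            using e by (subst ennreal_mult'[symmetric]) (simp_all add: g_def)
          finally show "?E far (?w v) \<le> ennreal (g v k)" .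
        qed
        have "?E (\<lambda>z. indicator (A 0) (to_segment (fst z))) (?w v)
            \<le> ?E (\<lambda>z. indicator (A e) (to_segment (snd z)) + far z) (?w v)"
        proof (rule pair.iter_expect_mono)
          fix s
          show "indicator (A 0) (to_segment (fst (riter (pair_map em_map) k (?w v) s)))
              \<le> indicator (A e) (to_segment (snd (riter (pair_map em_map) k (?w v) s)))
                + far (riter (pair_map em_map) k (?w v) s)"
            using close[of "fst (riter (pair_map em_map) k (?w v) s)" "snd (riter (pair_map em_map) k (?w v) s)"]
            by (simp only: prod.collapse)
        qed
        also have "\<dots> = ?E (\<lambda>z. indicator (A e) (to_segment (snd z))) (?w v) + ?E far (?w v)"
          by (rule pair.iter_expect_plus) measurable
        also have "\<dots> \<le> ?E (\<lambda>z. indicator (A e) (to_segment (snd z))) (?w v) + min 1 (ennreal (g v k))"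
          by (rule add_left_mono) (rule E_far)
        finally have joint: "?E (\<lambda>z. indicator (A 0) (to_segment (fst z))) (?w v)
            \<le> ?E (\<lambda>z. indicator (A e) (to_segment (snd z))) (?w v) + min 1 (ennreal (g v k))" .
        have "?E (\<lambda>z. indicator (A 0) (to_segment (fst z))) (?w v)
            = iter_expect noise em_map k (\<lambda>p. indicator (A 0) (to_segment p)) (fst (?w v))"
          by (rule iter_expect_semiconj) (simp add: pair_map_def)
        moreover have "?E (\<lambda>z. indicator (A e) (to_segment (snd z))) (?w v)
            = iter_expect noise em_map k (\<lambda>p. indicator (A e) (to_segment p)) (snd (?w v))"
          by (rule iter_expect_semiconj) (simp add: pair_map_def)
        ultimately show "iter_expect noise em_map k (\<lambda>p. indicator (A 0) (to_segment p)) (to_window (fst v))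
            \<le> iter_expect noise em_map k (\<lambda>p. indicator (A e) (to_segment p)) (to_window (snd v)) + min 1 (ennreal (g v k))"
          using joint by (simp only: fst_conv snd_conv)
      qed
      also have "\<dots> = (\<integral>\<^sup>+v. iter_expect noise em_map k (\<lambda>p. indicator (A e) (to_segment p)) (to_window (snd v)) \<partial>(\<nu> \<Otimes>\<^sub>M \<mu>)) + R k"
        unfolding R_def by (rule nn_integral_add) measurable
      also have "(\<integral>\<^sup>+v. iter_expect noise em_map k (\<lambda>p. indicator (A e) (to_segment p)) (to_window (snd v)) \<partial>(\<nu> \<Otimes>\<^sub>M \<mu>))
          = emeasure \<mu> (A e)"
      proof -
        have "(\<integral>\<^sup>+v. iter_expect noise em_map k (\<lambda>p. indicator (A e) (to_segment p)) (to_window (snd v)) \<partial>(\<nu> \<Otimes>\<^sub>M \<mu>))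
            = (\<integral>\<^sup>+x. \<integral>\<^sup>+y. iter_expect noise em_map k (\<lambda>p. indicator (A e) (to_segment p)) (to_window y) \<partial>\<mu> \<partial>\<nu>)"
          by (subst p2.nn_integral_fst[symmetric]) simp_all
        also have "\<dots> = (\<integral>\<^sup>+x. emeasure \<mu> (A e) \<partial>\<nu>)"
          by (simp only: stat[OF \<mu> A, of e k, symmetric])
        finally show ?thesis by (simp add: p1.emeasure_space_1)
      qed
      finally show ?thesis .
    qed
    have "(\<lambda>k. emeasure \<mu> (A e) + R k) \<longlonglongrightarrow> emeasure \<mu> (A e) + 0"
      by (rule tendsto_add[OF tendsto_const R])
    from LIMSEQ_le_const[OF this, of "emeasure \<nu> (A 0)"] show ?thesis using le_R by simp
  qed
  have "(\<lambda>n. emeasure \<mu> (A (1 / real (n + 2)))) \<longlonglongrightarrow> emeasure \<mu> (\<Inter>n. A (1 / real (n + 2)))"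
  proof (rule Lim_emeasure_decseq)
    show "range (\<lambda>n. A (1 / real (n + 2))) \<subseteq> sets \<mu>" 
      unfolding image_subset_iff prob_measuresD(2)[OF \<mu>(1)] by (intro ballI A)
    show "decseq (\<lambda>n. A (1 / real (n + 2)))"
    proof (rule decseq_SucI)
      fix n
      have "1 / real (Suc n + 2) \<le> 1 / real (n + 2)" by (rule divide_left_mono) simp_all
      then show "A (1 / real (Suc n + 2)) \<subseteq> A (1 / real (n + 2))"
        unfolding A_def using order_trans by blast
    qed
  qed simp
  moreover have "(\<Inter>n. A (1 / real (n + 2))) = A 0"
  proof (intro subset_antisym subsetI)
    fix x assume x: "x \<in> (\<Inter>n. A (1 / real (n + 2)))"
    have "(\<lambda>n. 1 / real (n + 2)) \<longlonglongrightarrow> 0" by (rule LIMSEQ_ignore_initial_segment[OF lim_1_over_n])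
    moreover have "infdist (fst x) D \<le> 1 / real (n + 2)" for n using x by (auto simp: A_def)
    ultimately have "infdist (fst x) D \<le> 0" using LIMSEQ_le_const by blast
    then show "x \<in> A 0" using x by (auto simp: A_def)
  qed (auto simp: A_def intro: order_trans)
  ultimately have "(\<lambda>n. emeasure \<mu> (A (1 / real (n + 2)))) \<longlonglongrightarrow> emeasure \<mu> (A 0)" by simp
  then have "emeasure \<nu> (A 0) \<le> emeasure \<mu> (A 0)"
  proof (rule LIMSEQ_le_const)
    have "emeasure \<nu> (A 0) \<le> emeasure \<mu> (A (1 / real (n + 2)))" for n
      by (rule bound) (simp_all add: field_simps)
    then show "\<exists>N. \<forall>n\<ge>N. emeasure \<nu> (A 0) \<le> emeasure \<mu> (A (1 / real (n + 2)))" by blast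
  qed
  then show ?thesis by (simp only: A0[OF sp(1)] A0[OF sp(2)])
qed simp

lemma invariant_unique:
  assumes "\<nu> \<in> prob_measures \<tau>" "\<And>k. \<nu> \<bind> law k = \<nu>"
  shows "\<nu> = inv_measure"
proof (rule measure_eqI_closed_slices[OF inv_measure_prob assms(1)])
  fix D :: "(real \<Rightarrow>\<^sub>C (real ^ 'n)) set" and i :: 's assume D: "closed D"
  show "emeasure \<nu> {x \<in> space \<nu>. fst x \<in> D \<and> snd x = i}
      = emeasure inv_measure {x \<in> space inv_measure. fst x \<in> D \<and> snd x = i}"
    by (rule antisym)
       (rule invariant_closed_le[OF inv_measure_prob inv_measure_invariant assms D]
             invariant_closed_le[OF assms inv_measure_prob inv_measure_invariant D])+
qed

end

section \<open>The law of the scheme\<close>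

text \<open>Independence of two random variables whose values may have different types.\<close>

definition indep_rv :: "'w measure \<Rightarrow> 'x measure \<Rightarrow> ('w \<Rightarrow> 'x) \<Rightarrow> 'y measure \<Rightarrow> ('w \<Rightarrow> 'y) \<Rightarrow> bool" where
  "indep_rv M S X T Y \<longleftrightarrow> X \<in> M \<rightarrow>\<^sub>M S \<and> Y \<in> M \<rightarrow>\<^sub>M T \<and>
     (\<forall>A\<in>sets S. \<forall>B\<in>sets T. emeasure M ((X -` A \<inter> space M) \<inter> (Y -` B \<inter> space M))
        = emeasure M (X -` A \<inter> space M) * emeasure M (Y -` B \<inter> space M))"

lemma indep_rvD:
  assumes "indep_rv M S X T Y"
  shows "X \<in> M \<rightarrow>\<^sub>M S" "Y \<in> M \<rightarrow>\<^sub>M T"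
  using assms by (simp_all add: indep_rv_def)

lemma indep_rv_compose:
  assumes XY: "indep_rv M S X T Y" and f: "f \<in> S \<rightarrow>\<^sub>M S'" and g: "g \<in> T \<rightarrow>\<^sub>M T'"
  shows "indep_rv M S' (\<lambda>\<omega>. f (X \<omega>)) T' (\<lambda>\<omega>. g (Y \<omega>))"
  unfolding indep_rv_def
proof (intro conjI ballI)
  have X: "X \<in> M \<rightarrow>\<^sub>M S" and Y: "Y \<in> M \<rightarrow>\<^sub>M T" using XY by (simp_all add: indep_rv_def)
  show "(\<lambda>\<omega>. f (X \<omega>)) \<in> M \<rightarrow>\<^sub>M S'" by (rule measurable_compose[OF X f])
  show "(\<lambda>\<omega>. g (Y \<omega>)) \<in> M \<rightarrow>\<^sub>M T'" by (rule measurable_compose[OF Y g])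
  fix A B assume "A \<in> sets S'" "B \<in> sets T'"
  then have AB: "f -` A \<inter> space S \<in> sets S" "g -` B \<inter> space T \<in> sets T"
    using f g by (auto intro: measurable_sets)
  have eqs: "(\<lambda>\<omega>. f (X \<omega>)) -` A \<inter> space M = X -` (f -` A \<inter> space S) \<inter> space M"
    "(\<lambda>\<omega>. g (Y \<omega>)) -` B \<inter> space M = Y -` (g -` B \<inter> space T) \<inter> space M"
    using measurable_space[OF X] measurable_space[OF Y] by auto
  show "emeasure M (((\<lambda>\<omega>. f (X \<omega>)) -` A \<inter> space M) \<inter> ((\<lambda>\<omega>. g (Y \<omega>)) -` B \<inter> space M))
      = emeasure M ((\<lambda>\<omega>. f (X \<omega>)) -` A \<inter> space M) * emeasure M ((\<lambda>\<omega>. g (Y \<omega>)) -` B \<inter> space M)"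
    unfolding eqs using XY AB unfolding indep_rv_def by blast
qed

lemma (in prob_space) nn_integral_indep_rv:
  assumes ind: "indep_rv M S X T Y" and \<phi>[measurable]: "\<phi> \<in> borel_measurable (S \<Otimes>\<^sub>M T)"
  shows "(\<integral>\<^sup>+\<omega>. \<phi> (X \<omega>, Y \<omega>) \<partial>M) = (\<integral>\<^sup>+\<omega>. \<integral>\<^sup>+y. \<phi> (X \<omega>, y) \<partial>distr M T Y \<partial>M)"
proof -
  have X[measurable]: "X \<in> M \<rightarrow>\<^sub>M S" and Y[measurable]: "Y \<in> M \<rightarrow>\<^sub>M T"
    using ind by (simp_all add: indep_rv_def)
  interpret X: prob_space "distr M S X" by (rule prob_space_distr) simp
  interpret Y: prob_space "distr M T Y" by (rule prob_space_distr) simp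
  have eq: "distr M S X \<Otimes>\<^sub>M distr M T Y = distr M (S \<Otimes>\<^sub>M T) (\<lambda>\<omega>. (X \<omega>, Y \<omega>))"
  proof (rule pair_measure_eqI)
    fix A B assume "A \<in> sets (distr M S X)" "B \<in> sets (distr M T Y)"
    then have AB: "A \<in> sets S" "B \<in> sets T" by simp_all
    have "(\<lambda>\<omega>. (X \<omega>, Y \<omega>)) -` (A \<times> B) \<inter> space M = (X -` A \<inter> space M) \<inter> (Y -` B \<inter> space M)" by auto
    then show "emeasure (distr M S X) A * emeasure (distr M T Y) B
        = emeasure (distr M (S \<Otimes>\<^sub>M T) (\<lambda>\<omega>. (X \<omega>, Y \<omega>))) (A \<times> B)"
      using AB ind by (simp add: emeasure_distr indep_rv_def)
  qed (simp_all add: X.sigma_finite_measure_axioms Y.sigma_finite_measure_axioms cong: sets_pair_measure_cong)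
  have "(\<integral>\<^sup>+\<omega>. \<phi> (X \<omega>, Y \<omega>) \<partial>M) = (\<integral>\<^sup>+w. \<phi> w \<partial>distr M (S \<Otimes>\<^sub>M T) (\<lambda>\<omega>. (X \<omega>, Y \<omega>)))"
    by (subst nn_integral_distr) simp_all
  also have "\<dots> = (\<integral>\<^sup>+x. \<integral>\<^sup>+y. \<phi> (x, y) \<partial>distr M T Y \<partial>distr M S X)"
    unfolding eq[symmetric] by (subst Y.nn_integral_fst[symmetric]) simp_all
  also have "\<dots> = (\<integral>\<^sup>+\<omega>. \<integral>\<^sup>+y. \<phi> (X \<omega>, y) \<partial>distr M T Y \<partial>M)"
    by (rule nn_integral_distr) measurable
  finally show ?thesis .
qed

text \<open>A driving noise given by increments \<open>\<zeta>\<close> and, independently, a discrete-time Markov chain \<open>\<kappa>\<close>;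
  unlike the random maps used so far, the chain is only known through its finite-dimensional laws.\<close>

locale em_driven = em_chain \<tau> \<delta> M b \<sigma> L P \<gamma> + \<Omega>: prob_space \<Omega>
  for \<tau> \<delta> :: real and M :: nat and b :: "(real \<Rightarrow>\<^sub>C (real ^ 'n)) \<Rightarrow> 's::finite \<Rightarrow> real ^ 'n"
    and \<sigma> :: "'s \<Rightarrow> real ^ 'm ^ 'n" and L :: real and P :: "'s \<Rightarrow> 's pmf"
    and \<gamma> :: "(real ^ 'm) measure" and \<Omega> :: "'w measure" +
  fixes \<zeta> :: "nat \<Rightarrow> 'w \<Rightarrow> real ^ 'm" and \<kappa> :: "nat \<Rightarrow> 'w \<Rightarrow> 's" and i0 :: 's
  assumes increments_measurable[measurable]: "\<And>l. \<zeta> l \<in> borel_measurable \<Omega>"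
    and increments_law: "\<And>l. distr \<Omega> borel (\<zeta> l) = \<gamma>"
    and increments_indep: "\<And>k. indep_rv \<Omega> (PiM {..<k} (\<lambda>_. borel)) (\<lambda>\<omega>. \<lambda>l\<in>{..<k}. \<zeta> l \<omega>) borel (\<zeta> k)"
    and chain_measurable[measurable]: "\<And>l. \<kappa> l \<in> \<Omega> \<rightarrow>\<^sub>M count_space UNIV"
    and chain_start: "AE \<omega> in \<Omega>. \<kappa> 0 \<omega> = i0"
    and chain_path: "\<And>k a. \<P>(\<omega> in \<Omega>. \<forall>l\<le>Suc k. \<kappa> l \<omega> = a l)
        = \<P>(\<omega> in \<Omega>. \<forall>l\<le>k. \<kappa> l \<omega> = a l) * pmf (P (a k)) (a (Suc k))"
    and independent: "indep_rv \<Omega> (PiM UNIV (\<lambda>_. borel)) (\<lambda>\<omega> l. \<zeta> l \<omega>)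
        (PiM UNIV (\<lambda>_. count_space UNIV)) (\<lambda>\<omega> l. \<kappa> l \<omega>)"
begin

primrec window_path :: "(nat \<Rightarrow> real ^ 'n) \<Rightarrow> (nat \<Rightarrow> real ^ 'm) \<Rightarrow> (nat \<Rightarrow> 's) \<Rightarrow> nat \<Rightarrow> nat \<Rightarrow> real ^ 'n" where
  "window_path x z a 0 = x"
| "window_path x z a (Suc k) = next_window (window_path x z a k) (a k) (z k)"

lemma window_path_cong:
  "(\<And>l. l < k \<Longrightarrow> z l = z' l) \<Longrightarrow> (\<And>l. l < k \<Longrightarrow> a l = a' l) \<Longrightarrow>
    window_path x z a k = window_path x z' a' k"
  by (induction k) simp_all

lemma measurable_window_path:
  "k \<le> n \<Longrightarrow> (\<lambda>z. window_path x z a k) \<in> borel_measurable (PiM {..<n} (\<lambda>_. borel))"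
proof (induction k)
  case (Suc k)
  then have [measurable]: "(\<lambda>z. window_path x z a k) \<in> borel_measurable (PiM {..<n} (\<lambda>_. borel))"
    and k: "k \<in> {..<n}" by auto
  have [measurable]: "(\<lambda>z. z k) \<in> borel_measurable (PiM {..<n} (\<lambda>_. borel :: (real ^ 'm) measure))"
    using k by (rule measurable_component_singleton)
  show ?case by simp
qed simp

lemma measurable_window_path_UNIV[measurable]:
  "(\<lambda>z. window_path x z a k) \<in> borel_measurable (PiM UNIV (\<lambda>_. borel))"
  by (induction k) simp_all

lemma measurable_increment_seq[measurable]: "(\<lambda>\<omega> l. \<zeta> l \<omega>) \<in> \<Omega> \<rightarrow>\<^sub>M PiM UNIV (\<lambda>_. borel)"
  using independent by (rule indep_rvD(1))

lemma one_step_expectation: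
  assumes [measurable]: "g \<in> borel_measurable states"
  shows "(\<integral>\<^sup>+a. g (em_map (x, i) a) \<partial>noise)
    = (\<Sum>j\<in>UNIV. ennreal (pmf (P i) j) * (\<integral>\<^sup>+z. g (next_window x i z, j) \<partial>\<gamma>))"
proof -
  have gj[measurable]: "(\<lambda>z. g (next_window x i z, j)) \<in> borel_measurable borel" for j
    by (rule measurable_compose[OF _ assms]) (simp add: states_def)
  have [measurable]: "(\<lambda>a. g (em_map (x, i) a)) \<in> borel_measurable noise" by measurable
  have "(\<integral>\<^sup>+a. g (em_map (x, i) a) \<partial>noise)
      = (\<integral>\<^sup>+z. \<integral>\<^sup>+\<theta>. g (em_map (x, i) (\<theta>, z)) \<partial>measure_pmf (Pi_pmf UNIV undefined P) \<partial>\<gamma>)"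
    unfolding noise_def by (subst joint.nn_integral_snd) (simp_all add: noise_def[symmetric])
  also have "\<dots> = (\<integral>\<^sup>+z. (\<Sum>j\<in>UNIV. g (next_window x i z, j) * ennreal (pmf (P i) j)) \<partial>\<gamma>)"
  proof (rule nn_integral_cong)
    fix z
    let ?h = "\<lambda>j. g (next_window x i z, j)"
    have "(\<integral>\<^sup>+\<theta>. g (em_map (x, i) (\<theta>, z)) \<partial>measure_pmf (Pi_pmf UNIV undefined P))
        = (\<integral>\<^sup>+j. ?h j \<partial>map_pmf (\<lambda>\<theta>. \<theta> i) (Pi_pmf UNIV undefined P))"
      by (simp add: em_map_def)
    also have "\<dots> = (\<integral>\<^sup>+j. ?h j \<partial>P i)" by (subst Pi_pmf_component) simp_all
    also have "\<dots> = (\<Sum>j\<in>UNIV. ?h j * ennreal (pmf (P i) j))"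
      by (rule nn_integral_measure_pmf_support) simp_all
    finally show "(\<integral>\<^sup>+\<theta>. g (em_map (x, i) (\<theta>, z)) \<partial>measure_pmf (Pi_pmf UNIV undefined P))
        = (\<Sum>j\<in>UNIV. ?h j * ennreal (pmf (P i) j))" .
  qed
  also have "\<dots> = (\<Sum>j\<in>UNIV. \<integral>\<^sup>+z. ennreal (pmf (P i) j) * g (next_window x i z, j) \<partial>\<gamma>)"
    by (subst nn_integral_sum) (simp_all add: mult.commute)
  also have "\<dots> = (\<Sum>j\<in>UNIV. ennreal (pmf (P i) j) * (\<integral>\<^sup>+z. g (next_window x i z, j) \<partial>\<gamma>))"
    by (intro sum.cong refl nn_integral_cmult) measurable
  finally show ?thesis .
qed

lemma nn_integral_chain_event:
  assumes [measurable]: "f \<in> borel_measurable (PiM UNIV (\<lambda>_. borel :: (real ^ 'm) measure))"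
    and E: "Measurable.pred (PiM UNIV (\<lambda>_. count_space UNIV)) E"
  shows "(\<integral>\<^sup>+\<omega>. of_bool (E (\<lambda>l. \<kappa> l \<omega>)) * f (\<lambda>l. \<zeta> l \<omega>) \<partial>\<Omega>)
    = ennreal \<P>(\<omega> in \<Omega>. E (\<lambda>l. \<kappa> l \<omega>)) * (\<integral>\<^sup>+\<omega>. f (\<lambda>l. \<zeta> l \<omega>) \<partial>\<Omega>)"
proof -
  note E[measurable]
  let ?K = "PiM UNIV (\<lambda>_. count_space UNIV) :: (nat \<Rightarrow> 's) measure"
  have K[measurable]: "(\<lambda>\<omega> l. \<kappa> l \<omega>) \<in> \<Omega> \<rightarrow>\<^sub>M ?K" using independent by (rule indep_rvD(2))
  have of_E[measurable]: "(\<lambda>a. of_bool (E a) :: ennreal) \<in> borel_measurable ?K"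
    unfolding of_bool_def by measurable
  have "(\<integral>\<^sup>+\<omega>. of_bool (E (\<lambda>l. \<kappa> l \<omega>)) * f (\<lambda>l. \<zeta> l \<omega>) \<partial>\<Omega>)
      = (\<integral>\<^sup>+\<omega>. (\<lambda>w. of_bool (E (snd w)) * f (fst w)) ((\<lambda>l. \<zeta> l \<omega>), (\<lambda>l. \<kappa> l \<omega>)) \<partial>\<Omega>)" by simp
  also have "\<dots> = (\<integral>\<^sup>+\<omega>. \<integral>\<^sup>+a. (\<lambda>w. of_bool (E (snd w)) * f (fst w)) ((\<lambda>l. \<zeta> l \<omega>), a) \<partial>distr \<Omega> ?K (\<lambda>\<omega> l. \<kappa> l \<omega>) \<partial>\<Omega>)"
    by (rule \<Omega>.nn_integral_indep_rv[OF independent]) measurable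
  also have "\<dots> = (\<integral>\<^sup>+\<omega>. (\<integral>\<^sup>+a. of_bool (E a) \<partial>distr \<Omega> ?K (\<lambda>\<omega> l. \<kappa> l \<omega>)) * f (\<lambda>l. \<zeta> l \<omega>) \<partial>\<Omega>)"
    by (intro nn_integral_cong) (simp, rule nn_integral_multc, simp)
  also have "(\<integral>\<^sup>+a. of_bool (E a) \<partial>distr \<Omega> ?K (\<lambda>\<omega> l. \<kappa> l \<omega>)) = (\<integral>\<^sup>+\<omega>. of_bool (E (\<lambda>l. \<kappa> l \<omega>)) \<partial>\<Omega>)"
    by (rule nn_integral_distr) measurable
  also have "\<dots> = (\<integral>\<^sup>+\<omega>. indicator {\<omega> \<in> space \<Omega>. E (\<lambda>l. \<kappa> l \<omega>)} \<omega> \<partial>\<Omega>)"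
    by (intro nn_integral_cong) (auto simp: indicator_def)
  also have "\<dots> = ennreal \<P>(\<omega> in \<Omega>. E (\<lambda>l. \<kappa> l \<omega>))"
    by (subst nn_integral_indicator) (auto simp: \<Omega>.emeasure_eq_measure)
  finally show ?thesis by (simp add: nn_integral_cmult)
qed

text \<open>Condition on the path of the chain, use that the next increment is independent of the window
  reached so far, and reassemble.\<close>

lemma nn_integral_window_path:
  assumes "g \<in> borel_measurable states"
  shows "(\<integral>\<^sup>+\<omega>. g (window_path x (\<lambda>l. \<zeta> l \<omega>) (\<lambda>l. \<kappa> l \<omega>) k, \<kappa> k \<omega>) \<partial>\<Omega>)
    = iter_expect noise em_map k g (x, i0)"
  using assms
proof (induction k arbitrary: g)
  case 0
  have "(\<integral>\<^sup>+\<omega>. g (x, \<kappa> 0 \<omega>) \<partial>\<Omega>) = (\<integral>\<^sup>+\<omega>. g (x, i0) \<partial>\<Omega>)"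
    by (rule nn_integral_cong_AE) (use chain_start in eventually_elim, simp)
  then show ?case by (simp add: iter_expect_0 \<Omega>.emeasure_space_1)
next
  case (Suc k)
  note g[measurable] = Suc.prems
  define A where "A = PiE {..k} (\<lambda>_. UNIV :: 's set)"
  have A: "finite A" unfolding A_def by (rule finite_PiE) simp_all
  define E where "E a a' \<longleftrightarrow> (\<forall>l\<le>k. a' l = a l)" for a a' :: "nat \<Rightarrow> 's"
  have E_meas[measurable]: "Measurable.pred (PiM UNIV (\<lambda>_. count_space UNIV)) (E a)" for a
    unfolding E_def by measurable
  have split: "(\<Sum>a\<in>A. of_bool (E a a') * f a) = f (restrict a' {..k})" for a' and f :: "(nat \<Rightarrow> 's) \<Rightarrow> ennreal"
  proof -
    have "E a a' \<longleftrightarrow> a = restrict a' {..k}" if "a \<in> A" for a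
      using that by (auto simp: A_def E_def PiE_def extensional_def restrict_def fun_eq_iff)
    then have "(\<Sum>a\<in>A. of_bool (E a a') * f a) = (\<Sum>a\<in>A. if a = restrict a' {..k} then f a else 0)"
      by (intro sum.cong) auto
    also have "\<dots> = f (restrict a' {..k})" using A by (simp add: A_def)
    finally show ?thesis .
  qed
  have wp: "window_path x z (restrict a {..k}) k = window_path x z a k" for z a
    by (rule window_path_cong) simp_all
  let ?w = "\<lambda>\<omega> a. window_path x (\<lambda>l. \<zeta> l \<omega>) a k"
  define G where "G a j z = g (next_window (window_path x z a k) (a k) (z k), j)" for a j and z :: "nat \<Rightarrow> real ^ 'm"
  have gj[measurable]: "(\<lambda>y. g (y, j)) \<in> borel_measurable borel" for j
    by (rule measurable_compose[OF _ g]) (simp add: states_def)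
  have G_meas[measurable]: "G a j \<in> borel_measurable (PiM UNIV (\<lambda>_. borel))" for a j
    unfolding G_def[abs_def] by measurable
  define Tg where "Tg y = (\<integral>\<^sup>+a. g (em_map y a) \<partial>noise)" for y
  have Tg[measurable]: "Tg \<in> borel_measurable states" unfolding Tg_def[abs_def] by measurable
  have Tgi[measurable]: "(\<lambda>y. Tg (y, i)) \<in> borel_measurable borel" for i
    by (rule measurable_compose[OF _ Tg]) (simp add: states_def)
  have step: "(\<integral>\<^sup>+\<omega>. G a j (\<lambda>l. \<zeta> l \<omega>) \<partial>\<Omega>)
      = (\<integral>\<^sup>+\<omega>. \<integral>\<^sup>+z. g (next_window (?w \<omega> a) (a k) z, j) \<partial>\<gamma> \<partial>\<Omega>)" for a j
  proof -
    let ?\<phi> = "\<lambda>v. g (next_window (window_path x (fst v) a k) (a k) (snd v), j)"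
    have [measurable]: "(\<lambda>z. window_path x z a k) \<in> borel_measurable (PiM {..<k} (\<lambda>_. borel))"
      by (rule measurable_window_path) simp
    have [measurable]: "?\<phi> \<in> borel_measurable (PiM {..<k} (\<lambda>_. borel) \<Otimes>\<^sub>M borel)" by measurable
    have cut: "window_path x (\<lambda>l\<in>{..<k}. \<zeta> l \<omega>) a k = ?w \<omega> a" for \<omega>
      by (rule window_path_cong) simp_all
    have "(\<integral>\<^sup>+\<omega>. G a j (\<lambda>l. \<zeta> l \<omega>) \<partial>\<Omega>) = (\<integral>\<^sup>+\<omega>. ?\<phi> ((\<lambda>l\<in>{..<k}. \<zeta> l \<omega>), \<zeta> k \<omega>) \<partial>\<Omega>)"
      by (simp add: G_def cut)
    also have "\<dots> = (\<integral>\<^sup>+\<omega>. \<integral>\<^sup>+z. ?\<phi> ((\<lambda>l\<in>{..<k}. \<zeta> l \<omega>), z) \<partial>distr \<Omega> borel (\<zeta> k) \<partial>\<Omega>)"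
      by (rule \<Omega>.nn_integral_indep_rv[OF increments_indep]) measurable
    finally show ?thesis by (simp add: cut increments_law)
  qed
  have path: "ennreal \<P>(\<omega> in \<Omega>. E a (\<lambda>l. \<kappa> l \<omega>) \<and> \<kappa> (Suc k) \<omega> = j)
      = ennreal \<P>(\<omega> in \<Omega>. E a (\<lambda>l. \<kappa> l \<omega>)) * ennreal (pmf (P (a k)) j)" for a j
  proof -
    have "(\<forall>l\<le>Suc k. \<kappa> l \<omega> = (a(Suc k := j)) l) \<longleftrightarrow> E a (\<lambda>l. \<kappa> l \<omega>) \<and> \<kappa> (Suc k) \<omega> = j" for \<omega>
      by (auto simp: E_def le_Suc_eq)
    moreover have "(\<forall>l\<le>k. \<kappa> l \<omega> = (a(Suc k := j)) l) \<longleftrightarrow> E a (\<lambda>l. \<kappa> l \<omega>)" for \<omega>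
      by (auto simp: E_def)
    ultimately show ?thesis
      using chain_path[of k "a(Suc k := j)"] by (simp add: ennreal_mult)
  qed
  have "(\<integral>\<^sup>+\<omega>. g (window_path x (\<lambda>l. \<zeta> l \<omega>) (\<lambda>l. \<kappa> l \<omega>) (Suc k), \<kappa> (Suc k) \<omega>) \<partial>\<Omega>)
      = (\<integral>\<^sup>+\<omega>. (\<Sum>a\<in>A. \<Sum>j\<in>UNIV. of_bool (E a (\<lambda>l. \<kappa> l \<omega>) \<and> \<kappa> (Suc k) \<omega> = j) * G a j (\<lambda>l. \<zeta> l \<omega>)) \<partial>\<Omega>)"
  proof (rule nn_integral_cong)
    fix \<omega>
    have "(\<Sum>j\<in>UNIV. of_bool (E a (\<lambda>l. \<kappa> l \<omega>) \<and> \<kappa> (Suc k) \<omega> = j) * G a j (\<lambda>l. \<zeta> l \<omega>))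
        = of_bool (E a (\<lambda>l. \<kappa> l \<omega>)) * G a (\<kappa> (Suc k) \<omega>) (\<lambda>l. \<zeta> l \<omega>)" for a
    proof -
      have "(\<Sum>j\<in>UNIV. of_bool (E a (\<lambda>l. \<kappa> l \<omega>) \<and> \<kappa> (Suc k) \<omega> = j) * G a j (\<lambda>l. \<zeta> l \<omega>))
          = (\<Sum>j\<in>UNIV. if j = \<kappa> (Suc k) \<omega> then of_bool (E a (\<lambda>l. \<kappa> l \<omega>)) * G a j (\<lambda>l. \<zeta> l \<omega>) else 0)"
        by (intro sum.cong) auto
      then show ?thesis by simp
    qed
    then have "(\<Sum>a\<in>A. \<Sum>j\<in>UNIV. of_bool (E a (\<lambda>l. \<kappa> l \<omega>) \<and> \<kappa> (Suc k) \<omega> = j) * G a j (\<lambda>l. \<zeta> l \<omega>))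
        = G (restrict (\<lambda>l. \<kappa> l \<omega>) {..k}) (\<kappa> (Suc k) \<omega>) (\<lambda>l. \<zeta> l \<omega>)"
      by (simp only: split)
    then show "g (window_path x (\<lambda>l. \<zeta> l \<omega>) (\<lambda>l. \<kappa> l \<omega>) (Suc k), \<kappa> (Suc k) \<omega>)
        = (\<Sum>a\<in>A. \<Sum>j\<in>UNIV. of_bool (E a (\<lambda>l. \<kappa> l \<omega>) \<and> \<kappa> (Suc k) \<omega> = j) * G a j (\<lambda>l. \<zeta> l \<omega>))"
      by (simp only: G_def wp window_path.simps) simp
  qed
  also have "\<dots> = (\<Sum>a\<in>A. \<Sum>j\<in>UNIV. \<integral>\<^sup>+\<omega>. of_bool (E a (\<lambda>l. \<kappa> l \<omega>) \<and> \<kappa> (Suc k) \<omega> = j) * G a j (\<lambda>l. \<zeta> l \<omega>) \<partial>\<Omega>)"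
  proof -
    have K: "(\<lambda>\<omega> l. \<kappa> l \<omega>) \<in> \<Omega> \<rightarrow>\<^sub>M PiM UNIV (\<lambda>_. count_space UNIV)" using independent by (rule indep_rvD(2))
    have p[measurable]: "Measurable.pred \<Omega> (\<lambda>\<omega>. E a (\<lambda>l. \<kappa> l \<omega>))" for a by (rule measurable_compose[OF K E_meas])
    have [measurable]: "(\<lambda>\<omega>. G a j (\<lambda>l. \<zeta> l \<omega>)) \<in> borel_measurable \<Omega>" for a j
      by (rule measurable_compose[OF measurable_increment_seq G_meas])
    have [measurable]: "(\<lambda>\<omega>. of_bool (E a (\<lambda>l. \<kappa> l \<omega>) \<and> \<kappa> (Suc k) \<omega> = j) :: ennreal) \<in> borel_measurable \<Omega>" for a j
      unfolding of_bool_def by measurable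
    have "(\<integral>\<^sup>+\<omega>. (\<Sum>a\<in>A. \<Sum>j\<in>UNIV. of_bool (E a (\<lambda>l. \<kappa> l \<omega>) \<and> \<kappa> (Suc k) \<omega> = j) * G a j (\<lambda>l. \<zeta> l \<omega>)) \<partial>\<Omega>)
        = (\<Sum>a\<in>A. \<integral>\<^sup>+\<omega>. (\<Sum>j\<in>UNIV. of_bool (E a (\<lambda>l. \<kappa> l \<omega>) \<and> \<kappa> (Suc k) \<omega> = j) * G a j (\<lambda>l. \<zeta> l \<omega>)) \<partial>\<Omega>)"
      by (rule nn_integral_sum) measurable
    also have "\<dots> = (\<Sum>a\<in>A. \<Sum>j\<in>UNIV. \<integral>\<^sup>+\<omega>. of_bool (E a (\<lambda>l. \<kappa> l \<omega>) \<and> \<kappa> (Suc k) \<omega> = j) * G a j (\<lambda>l. \<zeta> l \<omega>) \<partial>\<Omega>)"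
      by (intro sum.cong refl nn_integral_sum) measurable
    finally show ?thesis .
  qed
  also have "\<dots> = (\<Sum>a\<in>A. \<Sum>j\<in>UNIV. ennreal \<P>(\<omega> in \<Omega>. E a (\<lambda>l. \<kappa> l \<omega>)) * (ennreal (pmf (P (a k)) j)
      * (\<integral>\<^sup>+\<omega>. \<integral>\<^sup>+z. g (next_window (?w \<omega> a) (a k) z, j) \<partial>\<gamma> \<partial>\<Omega>)))"
  proof (intro sum.cong refl)
    fix a j
    have "(\<integral>\<^sup>+\<omega>. of_bool ((\<lambda>a'. E a a' \<and> a' (Suc k) = j) (\<lambda>l. \<kappa> l \<omega>)) * G a j (\<lambda>l. \<zeta> l \<omega>) \<partial>\<Omega>)
        = ennreal \<P>(\<omega> in \<Omega>. (\<lambda>a'. E a a' \<and> a' (Suc k) = j) (\<lambda>l. \<kappa> l \<omega>)) * (\<integral>\<^sup>+\<omega>. G a j (\<lambda>l. \<zeta> l \<omega>) \<partial>\<Omega>)"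
      by (rule nn_integral_chain_event[OF G_meas]) measurable
    then show "(\<integral>\<^sup>+\<omega>. of_bool (E a (\<lambda>l. \<kappa> l \<omega>) \<and> \<kappa> (Suc k) \<omega> = j) * G a j (\<lambda>l. \<zeta> l \<omega>) \<partial>\<Omega>)
        = ennreal \<P>(\<omega> in \<Omega>. E a (\<lambda>l. \<kappa> l \<omega>)) * (ennreal (pmf (P (a k)) j)
          * (\<integral>\<^sup>+\<omega>. \<integral>\<^sup>+z. g (next_window (?w \<omega> a) (a k) z, j) \<partial>\<gamma> \<partial>\<Omega>))"
      by (simp only: path step mult.assoc)
  qed
  also have "\<dots> = (\<Sum>a\<in>A. ennreal \<P>(\<omega> in \<Omega>. E a (\<lambda>l. \<kappa> l \<omega>)) * (\<integral>\<^sup>+\<omega>. Tg (?w \<omega> a, a k) \<partial>\<Omega>))"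
  proof (intro sum.cong refl)
    fix a
    have w[measurable]: "(\<lambda>\<omega>. ?w \<omega> a) \<in> borel_measurable \<Omega>"
      by (rule measurable_compose[OF measurable_increment_seq measurable_window_path_UNIV])
    have [measurable]: "(\<lambda>\<omega>. \<integral>\<^sup>+z. g (next_window (?w \<omega> a) (a k) z, j) \<partial>\<gamma>) \<in> borel_measurable \<Omega>" for j
      by (rule increment.borel_measurable_nn_integral) measurable
    have "(\<integral>\<^sup>+\<omega>. Tg (?w \<omega> a, a k) \<partial>\<Omega>) = (\<Sum>j\<in>UNIV. ennreal (pmf (P (a k)) j)
        * (\<integral>\<^sup>+\<omega>. \<integral>\<^sup>+z. g (next_window (?w \<omega> a) (a k) z, j) \<partial>\<gamma> \<partial>\<Omega>))"
      unfolding Tg_def one_step_expectation[OF g] by (simp add: nn_integral_sum nn_integral_cmult)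
    then show "(\<Sum>j\<in>UNIV. ennreal \<P>(\<omega> in \<Omega>. E a (\<lambda>l. \<kappa> l \<omega>)) * (ennreal (pmf (P (a k)) j)
        * (\<integral>\<^sup>+\<omega>. \<integral>\<^sup>+z. g (next_window (?w \<omega> a) (a k) z, j) \<partial>\<gamma> \<partial>\<Omega>)))
        = ennreal \<P>(\<omega> in \<Omega>. E a (\<lambda>l. \<kappa> l \<omega>)) * (\<integral>\<^sup>+\<omega>. Tg (?w \<omega> a, a k) \<partial>\<Omega>)"
      by (simp only: sum_distrib_left)
  qed
  also have "\<dots> = (\<Sum>a\<in>A. \<integral>\<^sup>+\<omega>. of_bool (E a (\<lambda>l. \<kappa> l \<omega>)) * Tg (?w \<omega> a, a k) \<partial>\<Omega>)"
  proof (intro sum.cong refl)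
    fix a
    have "(\<lambda>z. Tg (window_path x z a k, a k)) \<in> borel_measurable (PiM UNIV (\<lambda>_. borel))" by measurable
    from nn_integral_chain_event[OF this E_meas]
    show "ennreal \<P>(\<omega> in \<Omega>. E a (\<lambda>l. \<kappa> l \<omega>)) * (\<integral>\<^sup>+\<omega>. Tg (?w \<omega> a, a k) \<partial>\<Omega>)
        = (\<integral>\<^sup>+\<omega>. of_bool (E a (\<lambda>l. \<kappa> l \<omega>)) * Tg (?w \<omega> a, a k) \<partial>\<Omega>)" by (rule sym)
  qed
  also have "\<dots> = (\<integral>\<^sup>+\<omega>. (\<Sum>a\<in>A. of_bool (E a (\<lambda>l. \<kappa> l \<omega>)) * Tg (?w \<omega> a, a k)) \<partial>\<Omega>)"
  proof (rule nn_integral_sum[symmetric])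
    fix a
    have K: "(\<lambda>\<omega> l. \<kappa> l \<omega>) \<in> \<Omega> \<rightarrow>\<^sub>M PiM UNIV (\<lambda>_. count_space UNIV)" using independent by (rule indep_rvD(2))
    have p[measurable]: "Measurable.pred \<Omega> (\<lambda>\<omega>. E a (\<lambda>l. \<kappa> l \<omega>))" by (rule measurable_compose[OF K E_meas])
    have w[measurable]: "(\<lambda>\<omega>. ?w \<omega> a) \<in> borel_measurable \<Omega>"
      by (rule measurable_compose[OF measurable_increment_seq measurable_window_path_UNIV])
    show "(\<lambda>\<omega>. of_bool (E a (\<lambda>l. \<kappa> l \<omega>)) * Tg (?w \<omega> a, a k)) \<in> borel_measurable \<Omega>"
      unfolding of_bool_def by measurable
  qed
  also have "\<dots> = (\<integral>\<^sup>+\<omega>. Tg (?w \<omega> (\<lambda>l. \<kappa> l \<omega>), \<kappa> k \<omega>) \<partial>\<Omega>)"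
    by (simp only: split[of _ "\<lambda>a. Tg (?w _ a, a k)"] wp) simp
  also have "\<dots> = iter_expect noise em_map k Tg (x, i0)" by (rule Suc.IH[OF Tg])
  also have "\<dots> = iter_expect noise em_map (Suc k) g (x, i0)"
    by (simp add: iter_expect_Suc Tg_def[abs_def])
  finally show ?case .
qed

end

section \<open>The chain and the Brownian motion on the grid\<close>

locale chain_family = prob_space \<Omega> for \<Omega> :: "'w measure" +
  fixes p :: "real \<Rightarrow> 's::finite \<Rightarrow> 's \<Rightarrow> real" and \<Lambda> :: "'s \<Rightarrow> real \<Rightarrow> 'w \<Rightarrow> 's"
  assumes markov: "\<And>i. markov_chain \<Omega> p (\<Lambda> i)" and start: "\<And>i. AE \<omega> in \<Omega>. \<Lambda> i 0 \<omega> = i"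
begin

lemma chain_meas: "0 \<le> t \<Longrightarrow> \<Lambda> i t \<in> \<Omega> \<rightarrow>\<^sub>M count_space UNIV"
  using markov[of i] by (simp add: markov_chain_def)

lemma chain_event:
  assumes "finite T" "\<And>t. t \<in> T \<Longrightarrow> 0 \<le> t"
  shows "{\<omega> \<in> space \<Omega>. \<forall>t\<in>T. \<Lambda> i t \<omega> = a t} \<in> sets \<Omega>"
proof -
  have "Measurable.pred \<Omega> (\<lambda>\<omega>. \<forall>t\<in>T. \<Lambda> i t \<omega> = a t)"
  proof (rule pred_intros_finite(3)[OF assms(1)])
    fix t assume "t \<in> T"
    then have [measurable]: "\<Lambda> i t \<in> \<Omega> \<rightarrow>\<^sub>M count_space UNIV" using assms(2) chain_meas by blast
    show "Measurable.pred \<Omega> (\<lambda>\<omega>. \<Lambda> i t \<omega> = a t)" by measurable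
  qed
  then show ?thesis by (simp add: pred_def)
qed

lemma markov_product:
  assumes t: "0 \<le> t" "0 \<le> h" and T: "finite T" "T \<subseteq> {0..<t}"
  shows "\<P>(\<omega> in \<Omega>. \<Lambda> k (t + h) \<omega> = j \<and> \<Lambda> k t \<omega> = i \<and> (\<forall>s\<in>T. \<Lambda> k s \<omega> = a s))
    = \<P>(\<omega> in \<Omega>. \<Lambda> k t \<omega> = i \<and> (\<forall>s\<in>T. \<Lambda> k s \<omega> = a s)) * p h i j"
proof (cases "0 < \<P>(\<omega> in \<Omega>. \<Lambda> k t \<omega> = i \<and> (\<forall>s\<in>T. \<Lambda> k s \<omega> = a s))")
  case True
  have "\<P>(\<omega> in \<Omega>. \<Lambda> k (t + h) \<omega> = j \<bar> \<Lambda> k t \<omega> = i \<and> (\<forall>s\<in>T. \<Lambda> k s \<omega> = a s)) = p h i j"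
    using markov[of k] t T True unfolding markov_chain_def by blast
  then show ?thesis using True by (simp add: cond_prob_def field_simps)
next
  case False
  have "{\<omega> \<in> space \<Omega>. \<forall>s\<in>insert t T. \<Lambda> k s \<omega> = (a(t := i)) s} \<in> sets \<Omega>"
    using t T by (intro chain_event) auto
  moreover have eq: "{\<omega> \<in> space \<Omega>. \<forall>s\<in>insert t T. \<Lambda> k s \<omega> = (a(t := i)) s}
      = {\<omega> \<in> space \<Omega>. \<Lambda> k t \<omega> = i \<and> (\<forall>s\<in>T. \<Lambda> k s \<omega> = a s)}"
    using T(2) by auto
  ultimately have "\<P>(\<omega> in \<Omega>. \<Lambda> k (t + h) \<omega> = j \<and> \<Lambda> k t \<omega> = i \<and> (\<forall>s\<in>T. \<Lambda> k s \<omega> = a s))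
      \<le> \<P>(\<omega> in \<Omega>. \<Lambda> k t \<omega> = i \<and> (\<forall>s\<in>T. \<Lambda> k s \<omega> = a s))"
    by (intro finite_measure_mono) auto
  moreover have "\<P>(\<omega> in \<Omega>. \<Lambda> k t \<omega> = i \<and> (\<forall>s\<in>T. \<Lambda> k s \<omega> = a s)) = 0"
    using False by (simp add: zero_less_measure_iff)
  ultimately have "\<P>(\<omega> in \<Omega>. \<Lambda> k (t + h) \<omega> = j \<and> \<Lambda> k t \<omega> = i \<and> (\<forall>s\<in>T. \<Lambda> k s \<omega> = a s)) \<le> 0"
    by simp
  then have "\<P>(\<omega> in \<Omega>. \<Lambda> k (t + h) \<omega> = j \<and> \<Lambda> k t \<omega> = i \<and> (\<forall>s\<in>T. \<Lambda> k s \<omega> = a s)) = 0"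
    by (rule antisym) (rule measure_nonneg)
  then show ?thesis using \<open>\<P>(\<omega> in \<Omega>. \<Lambda> k t \<omega> = i \<and> (\<forall>s\<in>T. \<Lambda> k s \<omega> = a s)) = 0\<close> by simp
qed

lemma start_prob: "\<P>(\<omega> in \<Omega>. \<Lambda> i 0 \<omega> = i) = 1"
proof -
  have [measurable]: "\<Lambda> i 0 \<in> \<Omega> \<rightarrow>\<^sub>M count_space UNIV" by (rule chain_meas) simp
  show ?thesis by (subst prob_Collect_eq_1) (simp_all add: start)
qed

lemma trans_prob:
  assumes "0 \<le> h"
  shows "\<P>(\<omega> in \<Omega>. \<Lambda> i h \<omega> = j) = p h i j"
proof -
  have [measurable]: "\<Lambda> i 0 \<in> \<Omega> \<rightarrow>\<^sub>M count_space UNIV" "\<Lambda> i h \<in> \<Omega> \<rightarrow>\<^sub>M count_space UNIV"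
    using assms by (auto intro: chain_meas)
  have "\<P>(\<omega> in \<Omega>. \<Lambda> i h \<omega> = j) = \<P>(\<omega> in \<Omega>. \<Lambda> i h \<omega> = j \<and> \<Lambda> i 0 \<omega> = i)"
    by (rule prob_eq_AE) (use start[of i] in auto)
  also have "\<dots> = \<P>(\<omega> in \<Omega>. \<Lambda> i 0 \<omega> = i) * p h i j"
    using markov_product[of 0 h "{}" i j i undefined] assms by simp
  finally show ?thesis by (simp add: start_prob)
qed

lemma p_nonneg: "0 \<le> h \<Longrightarrow> 0 \<le> p h i j"
  by (simp flip: trans_prob)

lemma p_0: "p 0 i j = of_bool (i = j)"
proof -
  have [measurable]: "\<Lambda> i 0 \<in> \<Omega> \<rightarrow>\<^sub>M count_space UNIV" by (rule chain_meas) simp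
  have "\<P>(\<omega> in \<Omega>. \<Lambda> i 0 \<omega> = j) = 0" if "i \<noteq> j"
    by (subst prob_Collect_eq_0) (use start[of i] that in auto)
  then show ?thesis using trans_prob[of 0 i j] start_prob[of i] by (cases "i = j") auto
qed

lemma prob_sum_states:
  assumes "Measurable.pred \<Omega> R" and [measurable]: "X \<in> \<Omega> \<rightarrow>\<^sub>M count_space UNIV"
  shows "\<P>(\<omega> in \<Omega>. R \<omega>) = (\<Sum>l\<in>(UNIV :: 's set). \<P>(\<omega> in \<Omega>. R \<omega> \<and> X \<omega> = l))"
proof -
  note assms(1)[measurable]
  have "{\<omega> \<in> space \<Omega>. R \<omega>} = (\<Union>l\<in>UNIV. {\<omega> \<in> space \<Omega>. R \<omega> \<and> X \<omega> = l})" by auto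
  also have "prob \<dots> = (\<Sum>l\<in>(UNIV :: 's set). \<P>(\<omega> in \<Omega>. R \<omega> \<and> X \<omega> = l))"
    by (rule finite_measure_finite_Union) (auto simp: disjoint_family_on_def)
  finally show ?thesis .
qed

lemma p_sum:
  assumes "0 \<le> h"
  shows "(\<Sum>j\<in>UNIV. p h i j) = 1"
  using prob_sum_states[of "\<lambda>_. True" "\<Lambda> i h"] chain_meas[OF assms, of i] trans_prob[OF assms, of i]
  by (simp add: prob_space)

lemma chapman_kolmogorov:
  assumes t: "0 \<le> t" "0 \<le> h"
  shows "p (t + h) i j = (\<Sum>l\<in>UNIV. p t i l * p h l j)"
proof -
  have [measurable]: "\<Lambda> i t \<in> \<Omega> \<rightarrow>\<^sub>M count_space UNIV" "\<Lambda> i (t + h) \<in> \<Omega> \<rightarrow>\<^sub>M count_space UNIV"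
    using t by (auto intro: chain_meas)
  have "p (t + h) i j = \<P>(\<omega> in \<Omega>. \<Lambda> i (t + h) \<omega> = j)" using t by (simp add: trans_prob)
  also have "\<dots> = (\<Sum>l\<in>UNIV. \<P>(\<omega> in \<Omega>. \<Lambda> i (t + h) \<omega> = j \<and> \<Lambda> i t \<omega> = l))"
    by (rule prob_sum_states) measurable
  also have "\<dots> = (\<Sum>l\<in>UNIV. p t i l * p h l j)"
    using markov_product[of t h "{}" i j _ undefined] t by (intro sum.cong) (simp_all add: trans_prob)
  finally show ?thesis .
qed

lemma path_prob:
  assumes \<delta>: "0 < \<delta>"
  shows "\<P>(\<omega> in \<Omega>. \<forall>l\<le>Suc k. \<Lambda> i (real l * \<delta>) \<omega> = a l)
    = \<P>(\<omega> in \<Omega>. \<forall>l\<le>k. \<Lambda> i (real l * \<delta>) \<omega> = a l) * p \<delta> (a k) (a (Suc k))"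
proof -
  let ?T = "(\<lambda>l. real l * \<delta>) ` {..<k}"
  let ?a = "\<lambda>s. a (nat \<lfloor>s / \<delta>\<rfloor>)"
  have T: "finite ?T" "?T \<subseteq> {0..<real k * \<delta>}" using \<delta> by auto
  have all: "(\<forall>s\<in>?T. \<Lambda> i s \<omega> = ?a s) \<longleftrightarrow> (\<forall>l<k. \<Lambda> i (real l * \<delta>) \<omega> = a l)" for \<omega>
    using \<delta> by auto
  have k: "(\<forall>l\<le>k. \<Lambda> i (real l * \<delta>) \<omega> = a l)
      \<longleftrightarrow> \<Lambda> i (real k * \<delta>) \<omega> = a k \<and> (\<forall>l<k. \<Lambda> i (real l * \<delta>) \<omega> = a l)" for \<omega>
    by (auto simp: le_less)
  have S: "(\<forall>l\<le>Suc k. \<Lambda> i (real l * \<delta>) \<omega> = a l)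
      \<longleftrightarrow> \<Lambda> i (real k * \<delta> + \<delta>) \<omega> = a (Suc k) \<and> \<Lambda> i (real k * \<delta>) \<omega> = a k \<and> (\<forall>l<k. \<Lambda> i (real l * \<delta>) \<omega> = a l)" for \<omega>
  proof -
    have "real (Suc k) * \<delta> = real k * \<delta> + \<delta>" by (simp add: algebra_simps)
    then show ?thesis by (metis k le_Suc_eq)
  qed
  have "0 \<le> real k * \<delta>" "0 \<le> \<delta>" using \<delta> by simp_all
  from markov_product[OF this T, of i "a (Suc k)" "a k" ?a]
  show ?thesis unfolding all S k .
qed

lemma grid_power:
  assumes "0 \<le> \<delta>"
  shows "p (real (Suc k) * \<delta>) i j = (\<Sum>l\<in>UNIV. p \<delta> i l * p (real k * \<delta>) l j)"
proof -
  have "p (\<delta> + real k * \<delta>) i j = (\<Sum>l\<in>UNIV. p \<delta> i l * p (real k * \<delta>) l j)"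
    using assms by (intro chapman_kolmogorov) auto
  moreover have "real (Suc k) * \<delta> = \<delta> + real k * \<delta>" by (simp add: algebra_simps)
  ultimately show ?thesis by simp
qed

definition grid_kernel :: "real \<Rightarrow> 's \<Rightarrow> 's pmf" where
  "grid_kernel h i = embed_pmf (p h i)"

lemma pmf_grid_kernel:
  assumes "0 \<le> h"
  shows "pmf (grid_kernel h i) j = p h i j"
  unfolding grid_kernel_def
proof (rule pmf_embed_pmf)
  show "0 \<le> p h i x" for x using p_nonneg[OF assms] .
  show "(\<integral>\<^sup>+x. ennreal (p h i x) \<partial>count_space UNIV) = 1"
    using p_nonneg[OF assms] p_sum[OF assms, of i] by (simp add: nn_integral_count_space_finite)
qed

text \<open>By continuity at zero a chain may stay where it is for a short time, and hence for any time.\<close>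

lemma p_diag_pos:
  assumes lim: "((\<lambda>h. (p h i i - 1) / h) \<longlongrightarrow> c) (at_right 0)" and t: "0 \<le> t"
  shows "0 < p t i i"
proof -
  have "((\<lambda>h. (p h i i - 1) / h * h + 1) \<longlongrightarrow> c * 0 + 1) (at_right 0)"
    by (intro tendsto_intros lim)
  then have "eventually (\<lambda>h. 0 < (p h i i - 1) / h * h + 1) (at_right 0)"
    by (rule order_tendstoD) simp
  then obtain b where b: "0 < b" "\<And>h. 0 < h \<Longrightarrow> h < b \<Longrightarrow> 0 < (p h i i - 1) / h * h + 1"
    by (auto simp: eventually_at_right_field)
  then have small: "0 < p h i i" if "0 < h" "h < b" for h using that b(2)[of h] by simp
  show ?thesis
  proof (cases "t = 0")
    case True
    then show ?thesis by (simp add: p_0)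
  next
    case False
    obtain n :: nat where n: "t / b < real n" using reals_Archimedean2 by blast
    have n0: "0 < n" using n t b(1) by (metis divide_nonneg_pos gr0I leD of_nat_0)
    define h where "h = t / real n"
    have h: "0 < h" "h < b" using False t n n0 b(1) by (auto simp: h_def field_simps)
    have "0 < p (real m * h) i i" for m
    proof (induction m)
      case (Suc m)
      have "0 < p h i i * p (real m * h) i i" using Suc small h by simp
      also have "\<dots> \<le> (\<Sum>l\<in>UNIV. p h i l * p (real m * h) l i)"
        using h by (intro member_le_sum[of i UNIV "\<lambda>l. p h i l * p (real m * h) l i"]) (auto intro!: mult_nonneg_nonneg p_nonneg)
      also have "\<dots> = p (real (Suc m) * h) i i" using h by (intro grid_power[symmetric]) simp
      finally show ?case .
    qed (simp add: p_0)
    from this[of n] show ?thesis using n0 by (simp add: h_def)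
  qed
qed

text \<open>Periodicity is excluded in continuous time: a state that can be reached at some time can be
  reached at all later times, by waiting there.\<close>

lemma eventually_positive:
  assumes irr: "irreducible_chain \<Omega> \<Lambda>" and diag: "\<And>i t. 0 \<le> t \<Longrightarrow> 0 < p t i i" and \<tau>: "0 < \<tau>"
  shows "\<exists>R>0. \<forall>i j. 0 < p (real R * \<tau>) i j"
proof -
  obtain t where t: "\<And>i j. 0 \<le> t i j" "\<And>i j. 0 < p (t i j) i j"
    using irr trans_prob unfolding irreducible_chain_def by metis
  define S where "S = (\<Sum>i\<in>UNIV. \<Sum>j\<in>UNIV. t i j)"
  have S: "t i j \<le> S" for i j
  proof -
    have "t i j \<le> (\<Sum>j\<in>UNIV. t i j)" by (rule member_le_sum) (auto simp: t)
    also have "\<dots> \<le> S" unfolding S_def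
      by (rule member_le_sum[of i UNIV "\<lambda>i. \<Sum>j\<in>UNIV. t i j"]) (auto intro: sum_nonneg simp: t)
    finally show ?thesis .
  qed
  obtain R :: nat where R: "S / \<tau> < real R" using reals_Archimedean2 by blast
  have SR: "S < real R * \<tau>" using R \<tau> by (simp add: field_simps)
  have "0 \<le> S" unfolding S_def by (intro sum_nonneg t)
  then have "0 < R" using SR by (metis leD mult_zero_left of_nat_0 gr0I)
  moreover have "0 < p (real R * \<tau>) i j" for i j
  proof -
    let ?r = "real R * \<tau> - t i j"
    have r: "0 \<le> ?r" using S[of i j] SR by simp
    have "0 < p (t i j) i j * p ?r j j" using t diag[OF r] by simp
    also have "\<dots> \<le> (\<Sum>l\<in>UNIV. p (t i j) i l * p ?r l j)"
      using r t by (intro member_le_sum[of j UNIV "\<lambda>l. p (t i j) i l * p ?r l j"]) (auto intro!: mult_nonneg_nonneg p_nonneg)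
    also have "\<dots> = p (real R * \<tau>) i j" using chapman_kolmogorov[OF t(1) r, of i j i j] by simp
    finally show ?thesis .
  qed
  ultimately show ?thesis by blast
qed

end

lemma exp_slope:
  fixes \<alpha> \<beta> L a \<tau> c :: real
  shows "((\<lambda>h. (exp (h / 2 * (\<alpha> + (\<beta> + h * L\<^sup>2) * exp (- a * \<tau> - a * h)) + c * h) - 1) / h)
    \<longlongrightarrow> (\<alpha> + exp (- a * \<tau>) * \<beta>) / 2 + c) (at_right 0)"
proof -
  let ?g = "\<lambda>h. exp (h / 2 * (\<alpha> + (\<beta> + h * L\<^sup>2) * exp (- a * \<tau> - a * h)) + c * h)"
  have "(?g has_field_derivative (\<alpha> + exp (- a * \<tau>) * \<beta>) / 2 + c) (at 0)"
    by (auto intro!: derivative_eq_intros)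
  then have "((\<lambda>h. (?g h - ?g 0) / (h - 0)) \<longlongrightarrow> (\<alpha> + exp (- a * \<tau>) * \<beta>) / 2 + c) (at 0)"
    by (simp only: has_field_derivative_iff)
  then have "((\<lambda>h. (?g h - 1) / h) \<longlongrightarrow> (\<alpha> + exp (- a * \<tau>) * \<beta>) / 2 + c) (at 0)" by simp
  then show ?thesis by (rule filterlim_mono) (auto simp: at_le)
qed

text \<open>The one-step form of the spectral condition.  The derivative at \<open>h = 0\<close> of the left-hand side is
  \<open>(Q u)\<^sub>i + f i u\<^sub>i / 2 < 0\<close> with \<open>f i = \<alpha> i + exp (- a \<tau>) \<beta> i\<close>, which leaves room for a common rate \<open>c\<close>
  on an interval of step sizes.\<close>

lemma weights_decay:
  fixes Q :: "real ^ 's ^ 's" and p :: "real \<Rightarrow> 's \<Rightarrow> 's \<Rightarrow> real"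
  assumes deriv: "\<And>i j. ((\<lambda>h. (p h i j - (if i = j then 1 else 0)) / h) \<longlongrightarrow> Q $ i $ j) (at_right 0)"
    and neg: "\<And>i. (\<Sum>j\<in>UNIV. Q $ i $ j * u j) + (\<alpha> i + exp (- a * \<tau>) * \<beta> i) / 2 * u i < 0"
    and u: "\<And>i. 0 < u i"
  shows "\<exists>c>0. \<exists>d>0. \<forall>h. 0 < h \<longrightarrow> h < d \<longrightarrow>
    (\<forall>i. exp (h / 2 * (\<alpha> i + (\<beta> i + h * L\<^sup>2) * exp (- a * \<tau> - a * h))) * (\<Sum>j\<in>UNIV. p h i j * u j)
      \<le> exp (- c * h) * u i)"
proof -
  define D where "D i = (\<Sum>j\<in>UNIV. Q $ i $ j * u j) + (\<alpha> i + exp (- a * \<tau>) * \<beta> i) / 2 * u i" for i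
  define c where "c = Min (range (\<lambda>i. - D i / (2 * u i)))"
  have "0 < - D i / (2 * u i)" for i
    using neg[of i] u[of i] by (intro divide_pos_pos) (simp_all add: D_def)
  then have c: "0 < c" by (simp add: c_def Min_gr_iff)
  have Dc: "D i + c * u i < 0" for i
  proof -
    have "c \<le> - D i / (2 * u i)" unfolding c_def by (intro Min_le) auto
    then have "c * u i \<le> - D i / 2" using u[of i] by (simp add: field_simps)
    moreover have "D i < 0" using neg[of i] by (simp add: D_def)
    ultimately show ?thesis by simp
  qed
  define E where "E i h = exp (h / 2 * (\<alpha> i + (\<beta> i + h * L\<^sup>2) * exp (- a * \<tau> - a * h)) + c * h)" for i h
  define S where "S i h = (\<Sum>j\<in>UNIV. p h i j * u j)" for i h
  have "eventually (\<lambda>h. E i h * S i h < u i) (at_right 0)" for i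
  proof -
    have E: "((\<lambda>h. (E i h - 1) / h) \<longlongrightarrow> (\<alpha> i + exp (- a * \<tau>) * \<beta> i) / 2 + c) (at_right 0)"
      unfolding E_def by (rule exp_slope)
    have h0: "eventually (\<lambda>h::real. 0 < h) (at_right 0)" by (rule eventually_at_right_less)
    have "((\<lambda>h. (E i h - 1) / h * h + 1) \<longlongrightarrow> ((\<alpha> i + exp (- a * \<tau>) * \<beta> i) / 2 + c) * 0 + 1) (at_right 0)"
      by (intro tendsto_intros E)
    then have "((\<lambda>h. (E i h - 1) / h * h + 1) \<longlongrightarrow> 1) (at_right 0)" by simp
    then have E1: "(E i \<longlongrightarrow> 1) (at_right 0)"
      by (rule Lim_transform_eventually) (rule eventually_mono[OF h0], simp)
    have "((\<lambda>h. \<Sum>j\<in>UNIV. (p h i j - (if i = j then 1 else 0)) / h * u j) \<longlongrightarrow> (\<Sum>j\<in>UNIV. Q $ i $ j * u j)) (at_right 0)"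
      by (intro tendsto_intros deriv)
    moreover have "(\<Sum>j\<in>UNIV. (p h i j - (if i = j then 1 else 0)) / h * u j) = (S i h - u i) / h" for h
    proof -
      have "(\<Sum>j\<in>UNIV. (p h i j - (if i = j then 1 else 0)) / h * u j)
          = (\<Sum>j\<in>UNIV. p h i j * u j / h - (if j = i then u j / h else 0))"
        by (intro sum.cong) (auto simp: diff_divide_distrib left_diff_distrib)
      also have "\<dots> = S i h / h - u i / h"
        by (simp add: sum_subtractf S_def sum_divide_distrib)
      finally show ?thesis by (simp add: diff_divide_distrib)
    qed
    ultimately have S: "((\<lambda>h. (S i h - u i) / h) \<longlongrightarrow> (\<Sum>j\<in>UNIV. Q $ i $ j * u j)) (at_right 0)" by simp
    have "((\<lambda>h. E i h * ((S i h - u i) / h) + (E i h - 1) / h * u i)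
        \<longlongrightarrow> 1 * (\<Sum>j\<in>UNIV. Q $ i $ j * u j) + ((\<alpha> i + exp (- a * \<tau>) * \<beta> i) / 2 + c) * u i) (at_right 0)"
      by (intro tendsto_intros E E1 S)
    then have "eventually (\<lambda>h. E i h * ((S i h - u i) / h) + (E i h - 1) / h * u i < 0) (at_right 0)"
      by (rule order_tendstoD) (use Dc[of i] in \<open>simp add: D_def algebra_simps\<close>)
    then show ?thesis using h0
    proof eventually_elim
      fix h :: real assume h: "E i h * ((S i h - u i) / h) + (E i h - 1) / h * u i < 0" "0 < h"
      have "E i h * ((S i h - u i) / h) + (E i h - 1) / h * u i = (E i h * S i h - u i) / h"
        by (simp add: diff_divide_distrib algebra_simps)
      then show "E i h * S i h < u i" using h by (simp add: divide_less_0_iff)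
    qed
  qed
  then have "eventually (\<lambda>h. \<forall>i. E i h * S i h < u i) (at_right 0)" by (rule eventually_all_finite)
  then obtain d where d: "0 < d" "\<And>h i. 0 < h \<Longrightarrow> h < d \<Longrightarrow> E i h * S i h < u i"
    by (auto simp: eventually_at_right_field)
  have "exp (h / 2 * (\<alpha> i + (\<beta> i + h * L\<^sup>2) * exp (- a * \<tau> - a * h))) * S i h \<le> exp (- c * h) * u i"
    if "0 < h" "h < d" for h i
  proof -
    have "exp (- c * h) * (E i h * S i h) \<le> exp (- c * h) * u i"
      using d(2)[OF that, of i] by (intro mult_left_mono) auto
    moreover have "exp (- c * h) * E i h = exp (h / 2 * (\<alpha> i + (\<beta> i + h * L\<^sup>2) * exp (- a * \<tau> - a * h)))"
      unfolding E_def exp_add[symmetric] by simp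
    moreover have "exp (- c * h) * (E i h * S i h) = exp (- c * h) * E i h * S i h" by (rule mult.assoc[symmetric])
    ultimately show ?thesis by (simp only:)
  qed
  then show ?thesis using c d(1) unfolding S_def by blast
qed

locale brownian = prob_space \<Omega> for \<Omega> :: "'w measure" +
  fixes W :: "real \<Rightarrow> 'w \<Rightarrow> real ^ 'm" and \<delta> :: real
  assumes bm: "brownian_motion \<Omega> W" and step_pos: "0 < \<delta>"
begin

definition grid_increment :: "nat \<Rightarrow> 'w \<Rightarrow> real ^ 'm" where
  "grid_increment l \<omega> = W (real (Suc l) * \<delta>) \<omega> - W (real l * \<delta>) \<omega>"

definition increment_law :: "(real ^ 'm) measure" where
  "increment_law = distr \<Omega> borel (grid_increment 0)"

lemma measurable_W: "0 \<le> t \<Longrightarrow> W t \<in> borel_measurable \<Omega>"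
  using bm by (simp add: brownian_motion_def)

lemma measurable_grid_increment[measurable]: "grid_increment l \<in> borel_measurable \<Omega>"
proof -
  have [measurable]: "W (real (Suc l) * \<delta>) \<in> borel_measurable \<Omega>" "W (real l * \<delta>) \<in> borel_measurable \<Omega>"
    using step_pos by (auto intro!: measurable_W)
  show ?thesis unfolding grid_increment_def[abs_def] by measurable
qed

lemma increment_distributed:
  "distributed \<Omega> lborel (\<lambda>\<omega>. grid_increment l \<omega> $ c) (normal_density 0 (sqrt \<delta>))"
proof -
  have "0 \<le> real l * \<delta>" "real l * \<delta> < real (Suc l) * \<delta>" using step_pos by auto
  then have "distributed \<Omega> lborel (\<lambda>\<omega>. (W (real (Suc l) * \<delta>) \<omega> - W (real l * \<delta>) \<omega>) $ c)
      (normal_density 0 (sqrt (real (Suc l) * \<delta> - real l * \<delta>)))"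
    using bm unfolding brownian_motion_def by blast
  moreover have "real (Suc l) * \<delta> - real l * \<delta> = \<delta>" by (simp add: algebra_simps)
  ultimately show ?thesis by (simp add: grid_increment_def)
qed

lemma increments_indep_components:
  "indep_vars (\<lambda>_. borel) (\<lambda>(l, c) \<omega>. grid_increment (n + l) \<omega> $ c) ({..<r} \<times> UNIV)"
proof -
  have all: "\<And>(t :: nat \<Rightarrow> real) r. 0 \<le> t 0 \<and> strict_mono t \<Longrightarrow>
      indep_vars (\<lambda>_. borel) (\<lambda>(q, l) \<omega>. (W (t (Suc q)) \<omega> - W (t q) \<omega>) $ l) ({..<r} \<times> UNIV)"
    using bm by (simp add: brownian_motion_def)
  have "strict_mono (\<lambda>l. real (n + l) * \<delta>)"
    by (rule strict_monoI) (use step_pos in simp)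
  moreover have "0 \<le> real (n + 0) * \<delta>" using step_pos by simp
  ultimately show ?thesis
    using all[of "\<lambda>l. real (n + l) * \<delta>" r] by (simp only: grid_increment_def add_Suc_right)
qed

lemma borel_measurable_vec_lambda:
  fixes f :: "'m::finite \<Rightarrow> 'x \<Rightarrow> real"
  assumes "\<And>c. f c \<in> borel_measurable K"
  shows "(\<lambda>x. \<chi> c. f c x) \<in> borel_measurable K"
  unfolding borel_measurable_euclidean_space[of "\<lambda>x. \<chi> c. f c x"]
  using assms by (auto simp: Basis_vec_def inner_axis)

lemma measurable_vec_component[measurable (raw)]:
  fixes f :: "'x \<Rightarrow> real ^ 'm::finite"
  shows "f \<in> borel_measurable K \<Longrightarrow> (\<lambda>x. f x $ c) \<in> borel_measurable K"
  by (rule measurable_compose[of f _ borel]) (auto intro!: borel_measurable_continuous_onI continuous_intros)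

lemma grid_increment_law: "distr \<Omega> borel (grid_increment l) = increment_law"
proof -
  let ?I = "{..<1::nat} \<times> (UNIV :: 'm set)"
  let ?f = "\<lambda>f :: nat \<times> 'm \<Rightarrow> real. (\<chi> c. f (0, c)) :: real ^ 'm"
  have f[measurable]: "?f \<in> borel_measurable (PiM ?I (\<lambda>_. borel))"
    by (intro borel_measurable_vec_lambda measurable_component_singleton) auto
  have "distr \<Omega> borel (grid_increment n)
      = distr (PiM ?I (\<lambda>_. density lborel (normal_density 0 (sqrt \<delta>)))) borel ?f" for n
  proof -
    let ?X = "\<lambda>(l, c) \<omega>. grid_increment (n + l) \<omega> $ c"
    have rv: "random_variable borel (?X i)" for i by (cases i) simp
    have marg: "distr \<Omega> borel (?X i) = density lborel (normal_density 0 (sqrt \<delta>))" if mem: "i \<in> ?I" for i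
    proof -
      obtain c where i: "i = (0, c)" using mem by (cases i) auto
      have "distr \<Omega> borel (?X i) = distr \<Omega> lborel (\<lambda>\<omega>. grid_increment n \<omega> $ c)"
        by (rule distr_cong) (simp_all add: i)
      then show ?thesis using increment_distributed[of n c] by (simp add: distributed_def)
    qed
    have "distr \<Omega> (PiM ?I (\<lambda>_. borel)) (\<lambda>\<omega>. \<lambda>i\<in>?I. ?X i \<omega>) = PiM ?I (\<lambda>i. distr \<Omega> borel (?X i))"
      by (rule iffD1[OF indep_vars_iff_distr_eq_PiM[OF _ rv] increments_indep_components])
         (auto simp: lessThan_empty_iff)
    also have "\<dots> = PiM ?I (\<lambda>_. density lborel (normal_density 0 (sqrt \<delta>)))"
      by (rule PiM_cong) (simp_all add: marg)
    finally have law: "distr \<Omega> (PiM ?I (\<lambda>_. borel)) (\<lambda>\<omega>. \<lambda>i\<in>?I. ?X i \<omega>)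
        = PiM ?I (\<lambda>_. density lborel (normal_density 0 (sqrt \<delta>)))" .
    have X: "(\<lambda>\<omega>. \<lambda>i\<in>?I. ?X i \<omega>) \<in> \<Omega> \<rightarrow>\<^sub>M PiM ?I (\<lambda>_. borel)"
      by (rule measurable_restrict) (rule rv)
    have "grid_increment n = (\<lambda>\<omega>. ?f (\<lambda>i\<in>?I. ?X i \<omega>))" by (simp add: fun_eq_iff vec_eq_iff)
    then have "distr \<Omega> borel (grid_increment n) = distr (distr \<Omega> (PiM ?I (\<lambda>_. borel)) (\<lambda>\<omega>. \<lambda>i\<in>?I. ?X i \<omega>)) borel ?f"
      by (simp only: distr_distr[OF f X] o_def)
    then show ?thesis by (simp only: law)
  qed
  then show ?thesis by (simp add: increment_law_def)
qed

lemma increments_indep_past: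
  "indep_rv \<Omega> (PiM {..<k} (\<lambda>_. borel)) (\<lambda>\<omega>. \<lambda>l\<in>{..<k}. grid_increment l \<omega>) borel (grid_increment k)"
proof -
  let ?X = "\<lambda>(l, c) \<omega>. grid_increment l \<omega> $ c"
  let ?A = "{..<k} \<times> (UNIV :: 'm set)" and ?B = "{k} \<times> (UNIV :: 'm set)"
  have "indep_vars (\<lambda>_. borel) ?X ({..<Suc k} \<times> UNIV)"
    using increments_indep_components[of 0 "Suc k"] by simp
  then have ind: "indep_var (PiM ?A (\<lambda>_. borel)) (\<lambda>\<omega>. restrict (\<lambda>i. ?X i \<omega>) ?A) (PiM ?B (\<lambda>_. borel)) (\<lambda>\<omega>. restrict (\<lambda>i. ?X i \<omega>) ?B)"
    by (rule indep_var_restrict) auto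
  have rv: "indep_rv \<Omega> (PiM ?A (\<lambda>_. borel)) (\<lambda>\<omega>. restrict (\<lambda>i. ?X i \<omega>) ?A) (PiM ?B (\<lambda>_. borel)) (\<lambda>\<omega>. restrict (\<lambda>i. ?X i \<omega>) ?B)"
    unfolding indep_rv_def
  proof (intro conjI ballI)
    show "(\<lambda>\<omega>. restrict (\<lambda>i. ?X i \<omega>) ?A) \<in> \<Omega> \<rightarrow>\<^sub>M PiM ?A (\<lambda>_. borel)" using ind by (rule indep_var_rv1)
    show "(\<lambda>\<omega>. restrict (\<lambda>i. ?X i \<omega>) ?B) \<in> \<Omega> \<rightarrow>\<^sub>M PiM ?B (\<lambda>_. borel)" using ind by (rule indep_var_rv2)
    fix U V assume UV: "U \<in> sets (PiM ?A (\<lambda>_. borel :: real measure))" "V \<in> sets (PiM ?B (\<lambda>_. borel :: real measure))"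
    have "((\<lambda>\<omega>. restrict (\<lambda>i. ?X i \<omega>) ?A) -` U \<inter> space \<Omega>) \<inter> ((\<lambda>\<omega>. restrict (\<lambda>i. ?X i \<omega>) ?B) -` V \<inter> space \<Omega>)
        = (\<lambda>\<omega>. (restrict (\<lambda>i. ?X i \<omega>) ?A, restrict (\<lambda>i. ?X i \<omega>) ?B)) -` (U \<times> V) \<inter> space \<Omega>" by auto
    then show "emeasure \<Omega> (((\<lambda>\<omega>. restrict (\<lambda>i. ?X i \<omega>) ?A) -` U \<inter> space \<Omega>) \<inter> ((\<lambda>\<omega>. restrict (\<lambda>i. ?X i \<omega>) ?B) -` V \<inter> space \<Omega>))
        = emeasure \<Omega> ((\<lambda>\<omega>. restrict (\<lambda>i. ?X i \<omega>) ?A) -` U \<inter> space \<Omega>) * emeasure \<Omega> ((\<lambda>\<omega>. restrict (\<lambda>i. ?X i \<omega>) ?B) -` V \<inter> space \<Omega>)"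
      using indep_varD[OF ind UV] by (simp only: emeasure_eq_measure ennreal_mult'[OF measure_nonneg])
  qed
  have f: "(\<lambda>f. \<lambda>l\<in>{..<k}. \<chi> c. f (l, c)) \<in> PiM ?A (\<lambda>_. borel) \<rightarrow>\<^sub>M PiM {..<k} (\<lambda>_. borel :: (real ^ 'm) measure)"
    by (intro measurable_restrict borel_measurable_vec_lambda measurable_component_singleton) auto
  have g: "(\<lambda>f. \<chi> c. f (k, c)) \<in> PiM ?B (\<lambda>_. borel) \<rightarrow>\<^sub>M (borel :: (real ^ 'm) measure)"
    by (intro borel_measurable_vec_lambda measurable_component_singleton) auto
  have fX: "(\<lambda>l\<in>{..<k}. \<chi> c. restrict (\<lambda>i. ?X i \<omega>) ?A (l, c)) = (\<lambda>l\<in>{..<k}. grid_increment l \<omega>)" for \<omega>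
    by (auto simp: fun_eq_iff vec_eq_iff restrict_def)
  have gX: "(\<chi> c. restrict (\<lambda>i. ?X i \<omega>) ?B (k, c)) = grid_increment k \<omega>" for \<omega>
    by (simp add: vec_eq_iff)
  show ?thesis using indep_rv_compose[OF rv f g] by (simp only: fX gX)
qed

lemma increment_component:
  shows "integrable increment_law (\<lambda>z. z $ c)" "(\<integral>z. z $ c \<partial>increment_law) = 0"
    "integrable increment_law (\<lambda>z. (z $ c)\<^sup>2)" "(\<integral>z. (z $ c)\<^sup>2 \<partial>increment_law) = \<delta>"
proof -
  have s: "0 < sqrt \<delta>" using step_pos by simp
  note D = increment_distributed[of 0 c]
  have [measurable]: "(\<lambda>z :: real ^ 'm. z $ c) \<in> borel_measurable borel"
    by (intro borel_measurable_continuous_onI continuous_intros)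
  have E: "expectation (\<lambda>\<omega>. grid_increment 0 \<omega> $ c) = 0" by (rule normal_distributed_expectation[OF s D])
  have V: "expectation (\<lambda>\<omega>. (grid_increment 0 \<omega> $ c)\<^sup>2) = \<delta>"
    using normal_distributed_variance[OF s D] step_pos by (simp add: E)
  have "integrable \<Omega> (\<lambda>\<omega>. grid_increment 0 \<omega> $ c)"
    using distributed_integrable[OF D, of "\<lambda>x. x"] integrable_normal_moment_nz_1[OF s, of 0] by simp
  then show "integrable increment_law (\<lambda>z. z $ c)" unfolding increment_law_def by (subst integrable_distr_eq) simp_all
  show "(\<integral>z. z $ c \<partial>increment_law) = 0" unfolding increment_law_def by (subst integral_distr) (simp_all add: E)
  have "integrable \<Omega> (\<lambda>\<omega>. (grid_increment 0 \<omega> $ c)\<^sup>2)"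
    using distributed_integrable[OF D, of "\<lambda>x. x\<^sup>2"] integrable_normal_moment[OF s, of 0 2] by simp
  then show "integrable increment_law (\<lambda>z. (z $ c)\<^sup>2)" unfolding increment_law_def by (subst integrable_distr_eq) simp_all
  show "(\<integral>z. (z $ c)\<^sup>2 \<partial>increment_law) = \<delta>" unfolding increment_law_def by (subst integral_distr) (simp_all add: V)
qed

lemma increment_linear: "integrable increment_law (\<lambda>z. v \<bullet> z)" "(\<integral>z. v \<bullet> z \<partial>increment_law) = 0"
proof -
  have eq: "(\<lambda>z. v \<bullet> z) = (\<lambda>z :: real ^ 'm. \<Sum>c\<in>UNIV. v $ c * z $ c)" by (simp add: inner_vec_def)
  show "integrable increment_law (\<lambda>z. v \<bullet> z)"
    unfolding eq by (intro Bochner_Integration.integrable_sum integrable_mult_right increment_component)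
  show "(\<integral>z. v \<bullet> z \<partial>increment_law) = 0"
    unfolding eq by (subst Bochner_Integration.integral_sum) (simp_all add: increment_component)
qed

lemma increment_square:
  "integrable increment_law (\<lambda>z. (norm z)\<^sup>2)" "(\<integral>z. (norm z)\<^sup>2 \<partial>increment_law) = real CARD('m) * \<delta>"
proof -
  have eq: "(\<lambda>z. (norm z)\<^sup>2) = (\<lambda>z :: real ^ 'm. \<Sum>c\<in>UNIV. (z $ c)\<^sup>2)"
    unfolding power2_norm_eq_inner by (simp add: inner_vec_def power2_eq_square)
  show "integrable increment_law (\<lambda>z. (norm z)\<^sup>2)"
    unfolding eq by (intro Bochner_Integration.integrable_sum increment_component)
  show "(\<integral>z. (norm z)\<^sup>2 \<partial>increment_law) = real CARD('m) * \<delta>"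
    unfolding eq by (subst Bochner_Integration.integral_sum) (simp_all add: increment_component)
qed

end

section \<open>Exponential ergodicity uniformly in the step size\<close>

context em_lyapunov
begin

text \<open>For the weights \<open>r = exp (a \<delta> / 2)\<close> and blocks of \<open>n = T / \<delta>\<close> steps the constants \<open>B\<close>, \<open>q\<close> and \<open>C\<close> are the
  same for all step sizes, since \<open>r ^ M = exp (a \<tau> / 2)\<close>.  The factor \<open>2 / q\<close> pays for the incomplete last
  block.\<close>

lemma window_contraction:
  assumes n: "0 < n" "real n * \<delta> = T" and e: "0 < e" "e \<le> 1"
    and mix: "\<And>z. pair_expect n (\<lambda>z. of_bool (apart z)) z \<le> ennreal (1 - e)"
    and v: "0 < v" "\<And>i. v \<le> u i"
  defines "B \<equiv> 4 * moment_bound T / e" and "q \<equiv> max (\<rho> ^ n) (1 - e / 2)"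
  defines "C \<equiv> (1 / (v * r ^ M) + 1 / B) * (2 / q) * (U + B)"
  shows "pair_expect k
      (\<lambda>z. ennreal (wdist M 1 (fst (fst z)) (fst (snd z)) + of_bool (apart z))) z
    \<le> ennreal (C * (1 + wdist M 1 (fst (fst z)) (\<lambda>_. 0) + wdist M 1 (fst (snd z)) (\<lambda>_. 0)) * (q powr (\<delta> / T)) ^ k)"
    and "0 < B" and "0 < C"
proof -
  have T: "0 < T" using n step_pos by (metis mult_pos_pos of_nat_0_less_iff)
  have mb: "0 < moment_bound T" using U_pos drift_at_0 T by (simp add: moment_bound_def add_pos_nonneg)
  then show B: "0 < B" using e by (simp add: B_def)
  have q: "0 < q" "q \<le> 1" using e \<rho> by (auto simp: q_def power_le_one less_max_iff_disj)
  have rM: "0 < r ^ M" using r by simp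
  have D: "0 < 1 / (v * r ^ M) + 1 / B" using v rM B by (simp add: add_pos_pos)
  show C: "0 < C" using D q U_pos B by (simp add: C_def add_pos_pos)
  have wd1: "wdist M 1 x y \<le> wdist M r x y / r ^ M" for x y :: "nat \<Rightarrow> real ^ 'n"
    unfolding wdist_le_iff
  proof (intro allI impI)
    fix p assume p: "p \<le> M"
    have "r ^ M * norm (x p - y p) \<le> r ^ p * norm (x p - y p)"
      using r p by (intro mult_right_mono power_decreasing) auto
    also have "\<dots> \<le> wdist M r x y" by (rule wdist_ge[OF p])
    finally show "1 ^ p * norm (x p - y p) \<le> wdist M r x y / r ^ M" using rM by (simp add: field_simps)
  qed
  have wdr: "wdist M r x y \<le> wdist M 1 x y" for x y :: "nat \<Rightarrow> real ^ 'n"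
    unfolding wdist_le_iff
  proof (intro allI impI)
    fix p assume p: "p \<le> M"
    have "r ^ p * norm (x p - y p) \<le> 1 * norm (x p - y p)"
      using r by (intro mult_right_mono power_le_one) auto
    also have "\<dots> \<le> wdist M 1 x y" using wdist_ge[OF p, of 1 x y] by simp
    finally show "r ^ p * norm (x p - y p) \<le> wdist M 1 x y" .
  qed
  have low: "wdist M r x y / r ^ M \<le> u i * wdist M r x y / (v * r ^ M)" for x y i
  proof -
    have "v * wdist M r x y \<le> u i * wdist M r x y" using v wdist_nonneg' by (intro mult_right_mono) auto
    then have "v * wdist M r x y / (v * r ^ M) \<le> u i * wdist M r x y / (v * r ^ M)"
      using v rM by (intro divide_right_mono) auto
    then show ?thesis using v by simp
  qed
  have below: "wdist M 1 (fst (fst z)) (fst (snd z)) + of_bool (apart z)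
      \<le> (1 / (v * r ^ M) + 1 / B) * lyap B z" for z
  proof (cases "together z")
    case True
    have "wdist M 1 (fst (fst z)) (fst (snd z)) \<le> u (snd (fst z)) * wdist M r (fst (fst z)) (fst (snd z)) / (v * r ^ M)"
      by (rule order_trans[OF wd1 low])
    also have "\<dots> = (1 / (v * r ^ M)) * lyap B z" using True by (simp add: lyap_def)
    also have "\<dots> \<le> (1 / (v * r ^ M) + 1 / B) * lyap B z"
      using B lyap_nonneg[of B z] by (intro mult_right_mono) auto
    finally show ?thesis using True by simp
  next
    case False
    have "wdist M 1 (fst (fst z)) (fst (snd z)) \<le> (wdist M r (fst (fst z)) (\<lambda>_. 0) + wdist M r (\<lambda>_. 0) (fst (snd z))) / r ^ M"
      using rM r by (intro order_trans[OF wd1] divide_right_mono wdist_triangle) auto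
    also have "\<dots> = wdist M r (fst (fst z)) (\<lambda>_. 0) / r ^ M + wdist M r (fst (snd z)) (\<lambda>_. 0) / r ^ M"
      by (simp add: add_divide_distrib wdist_commute[of M r "\<lambda>_. 0"])
    also have "\<dots> \<le> height (fst z) / (v * r ^ M) + height (snd z) / (v * r ^ M)"
      unfolding height_def by (intro add_mono low)
    also have "\<dots> + 1 = (1 / (v * r ^ M)) * (height (fst z) + height (snd z)) + (1 / B) * B"
      using B by (simp add: add_divide_distrib)
    also have "\<dots> \<le> (1 / (v * r ^ M) + 1 / B) * (height (fst z) + height (snd z)) + (1 / (v * r ^ M) + 1 / B) * B"
      using B v rM height_nonneg by (intro add_mono mult_right_mono) auto
    also have "\<dots> = (1 / (v * r ^ M) + 1 / B) * lyap B z" using False by (simp add: lyap_def distrib_left)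
    finally show ?thesis using False by simp
  qed
  have above: "lyap B z \<le> (U + B) * (1 + wdist M 1 (fst (fst z)) (\<lambda>_. 0) + wdist M 1 (fst (snd z)) (\<lambda>_. 0))" for z
  proof -
    have h: "height p \<le> U * wdist M 1 (fst p) (\<lambda>_. 0)" for p
      unfolding height_def using u_le[of "snd p"] u_pos[of "snd p"] wdr wdist_nonneg' U_pos by (intro mult_mono) auto
    have w0: "0 \<le> wdist M 1 x (\<lambda>_. 0)" for x :: "nat \<Rightarrow> real ^ 'n" by (rule wdist_nonneg) simp
    have "lyap B z \<le> height (fst z) + height (snd z) + B" using B by (intro lyap_le) simp
    also have "\<dots> \<le> U * wdist M 1 (fst (fst z)) (\<lambda>_. 0) + U * wdist M 1 (fst (snd z)) (\<lambda>_. 0) + B" by (intro add_mono h) simp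
    also have "\<dots> \<le> (U + B) * (1 + wdist M 1 (fst (fst z)) (\<lambda>_. 0) + wdist M 1 (fst (snd z)) (\<lambda>_. 0))"
      using B U_pos w0[of "fst (fst z)"] w0[of "fst (snd z)"] by (simp add: algebra_simps)
    finally show ?thesis .
  qed
  have rate: "q ^ (k div n) \<le> (1 / q) * (q powr (\<delta> / T)) ^ k"
  proof -
    have "real k / real n \<le> real (k div n) + 1"
      using n by (simp add: real_of_nat_div field_simps) (metis add.commute mult.commute mult_Suc_right of_nat_add of_nat_mult of_nat_le_iff div_mult_mod_eq mod_less_divisor add_le_cancel_left less_imp_le)
    then have "q powr (real (k div n) + 1) \<le> q powr (real k / real n)" using q by (intro powr_mono') auto
    moreover have "q powr (real k / real n) = (q powr (\<delta> / T)) ^ k"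
    proof -
      have "real k / real n = real k * (\<delta> / T)" using n step_pos T by (simp add: field_simps flip: n(2))
      then show ?thesis using q by (simp add: powr_powr powr_realpow[symmetric] mult.commute)
    qed
    moreover have "q powr (real (k div n) + 1) = q ^ (k div n) * q" using q by (simp add: powr_add powr_realpow)
    ultimately have "q ^ (k div n) * q \<le> (q powr (\<delta> / T)) ^ k" by simp
    then show ?thesis using q by (simp add: field_simps)
  qed
  let ?N = "1 + wdist M 1 (fst (fst z)) (\<lambda>_. 0) + wdist M 1 (fst (snd z)) (\<lambda>_. 0)"
  have "pair_expect k
      (\<lambda>z. ennreal (wdist M 1 (fst (fst z)) (fst (snd z)) + of_bool (apart z))) z
    \<le> pair_expect k (\<lambda>z. ennreal (1 / (v * r ^ M) + 1 / B) * ennreal (lyap B z)) z"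
  proof (rule pair.iter_expect_mono)
    fix s
    let ?w = "riter (pair_map em_map) k z s"
    have "ennreal (wdist M 1 (fst (fst ?w)) (fst (snd ?w)) + of_bool (snd (fst ?w) \<noteq> snd (snd ?w)))
        \<le> ennreal ((1 / (v * r ^ M) + 1 / B) * lyap B ?w)" by (intro ennreal_leI below)
    then show "ennreal (wdist M 1 (fst (fst ?w)) (fst (snd ?w)) + of_bool (snd (fst ?w) \<noteq> snd (snd ?w)))
        \<le> ennreal (1 / (v * r ^ M) + 1 / B) * ennreal (lyap B ?w)"
      by (subst (asm) ennreal_mult'[OF less_imp_le[OF D]])
  qed
  also have "\<dots> = ennreal (1 / (v * r ^ M) + 1 / B) * pair_expect k (\<lambda>z. ennreal (lyap B z)) z"
    by (rule pair.iter_expect_cmult) measurable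
  also have "\<dots> \<le> ennreal (1 / (v * r ^ M) + 1 / B) * ennreal (2 * q ^ (k div n) * lyap B z)"
    unfolding B_def q_def by (intro mult_left_mono lyap_decay[OF n e mix]) simp
  also have "\<dots> = ennreal ((1 / (v * r ^ M) + 1 / B) * (2 * q ^ (k div n) * lyap B z))"
    by (rule ennreal_mult'[symmetric, OF less_imp_le[OF D]])
  also have "\<dots> \<le> ennreal (C * ?N * (q powr (\<delta> / T)) ^ k)"
  proof (rule ennreal_leI)
    have "(1 / (v * r ^ M) + 1 / B) * (2 * q ^ (k div n) * lyap B z)
        \<le> (1 / (v * r ^ M) + 1 / B) * (2 * ((1 / q) * (q powr (\<delta> / T)) ^ k) * ((U + B) * ?N))"
      using D q rate above[of z] lyap_nonneg[of B z] B by (intro mult_left_mono mult_mono) auto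
    also have "\<dots> = C * ?N * (q powr (\<delta> / T)) ^ k"
    proof -
      have "d * (2 * (1 / q * X) * (w * N)) = d * (2 / q) * w * N * X" for d X w N :: real by simp
      then show ?thesis unfolding C_def .
    qed
    finally show "(1 / (v * r ^ M) + 1 / B) * (2 * q ^ (k div n) * lyap B z) \<le> C * ?N * (q powr (\<delta> / T)) ^ k" .
  qed
  finally show "pair_expect k
      (\<lambda>z. ennreal (wdist M 1 (fst (fst z)) (fst (snd z)) + of_bool (apart z))) z
    \<le> ennreal (C * ?N * (q powr (\<delta> / T)) ^ k)" .
qed

end

lemma (in em_driven) distr_window_path:
  assumes h[measurable]: "h \<in> states \<rightarrow>\<^sub>M K"
  shows "distr \<Omega> K (\<lambda>\<omega>. h (window_path x (\<lambda>l. \<zeta> l \<omega>) (\<lambda>l. \<kappa> l \<omega>) k, \<kappa> k \<omega>))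
    = distr (stream_space noise) K (\<lambda>s. h (riter em_map k (x, i0) s))"
proof -
  have wp: "window_path x z (a :: nat \<Rightarrow> 's) k = window_path x z (restrict a {..k}) k" for z a
    by (rule window_path_cong) simp_all
  have [measurable]: "(\<lambda>\<omega>. window_path x (\<lambda>l. \<zeta> l \<omega>) (\<lambda>l. \<kappa> l \<omega>) k) \<in> borel_measurable \<Omega>"
  proof (induction k)
    case (Suc k)
    note [measurable] = Suc
    show ?case by simp
  qed simp
  have X: "(\<lambda>\<omega>. (window_path x (\<lambda>l. \<zeta> l \<omega>) (\<lambda>l. \<kappa> l \<omega>) k, \<kappa> k \<omega>)) \<in> \<Omega> \<rightarrow>\<^sub>M states"
    unfolding states_def by measurable
  have hX[measurable]: "(\<lambda>\<omega>. h (window_path x (\<lambda>l. \<zeta> l \<omega>) (\<lambda>l. \<kappa> l \<omega>) k, \<kappa> k \<omega>)) \<in> \<Omega> \<rightarrow>\<^sub>M K"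
    by (rule measurable_compose[OF X h])
  show ?thesis
  proof (rule measure_eqI)
    fix A assume "A \<in> sets (distr \<Omega> K (\<lambda>\<omega>. h (window_path x (\<lambda>l. \<zeta> l \<omega>) (\<lambda>l. \<kappa> l \<omega>) k, \<kappa> k \<omega>)))"
    then have A[measurable]: "A \<in> sets K" by simp
    have "emeasure (distr \<Omega> K (\<lambda>\<omega>. h (window_path x (\<lambda>l. \<zeta> l \<omega>) (\<lambda>l. \<kappa> l \<omega>) k, \<kappa> k \<omega>))) A
        = (\<integral>\<^sup>+y. indicator A y \<partial>distr \<Omega> K (\<lambda>\<omega>. h (window_path x (\<lambda>l. \<zeta> l \<omega>) (\<lambda>l. \<kappa> l \<omega>) k, \<kappa> k \<omega>)))"
      by (rule nn_integral_indicator[symmetric]) simp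
    also have "\<dots> = (\<integral>\<^sup>+\<omega>. indicator A (h (window_path x (\<lambda>l. \<zeta> l \<omega>) (\<lambda>l. \<kappa> l \<omega>) k, \<kappa> k \<omega>)) \<partial>\<Omega>)"
      by (rule nn_integral_distr[OF hX]) simp
    also have "\<dots> = iter_expect noise em_map k (\<lambda>y. indicator A (h y)) (x, i0)"
      by (rule nn_integral_window_path) measurable
    also have "\<dots> = (\<integral>\<^sup>+y. indicator A y \<partial>distr (stream_space noise) K (\<lambda>s. h (riter em_map k (x, i0) s)))"
      unfolding iter_expect_def by (rule nn_integral_distr[symmetric]) measurable
    also have "\<dots> = emeasure (distr (stream_space noise) K (\<lambda>s. h (riter em_map k (x, i0) s))) A"
      by (rule nn_integral_indicator) simp
    finally show "emeasure (distr \<Omega> K (\<lambda>\<omega>. h (window_path x (\<lambda>l. \<zeta> l \<omega>) (\<lambda>l. \<kappa> l \<omega>) k, \<kappa> k \<omega>))) A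
        = emeasure (distr (stream_space noise) K (\<lambda>s. h (riter em_map k (x, i0) s))) A" .
  qed simp
qed

text \<open>Independent processes generate independent \<open>\<sigma>\<close>-algebras, and the values and increments on the
  grid are measurable functions of the whole paths.\<close>

lemma indep_processes_grid:
  fixes W :: "real \<Rightarrow> 'w \<Rightarrow> real ^ 'm" and X :: "real \<Rightarrow> 'w \<Rightarrow> 's"
  assumes \<Omega>: "prob_space \<Omega>" and ind: "indep_processes \<Omega> borel W (count_space UNIV) X"
    and W: "\<And>t. 0 \<le> t \<Longrightarrow> W t \<in> borel_measurable \<Omega>" and X: "\<And>t. 0 \<le> t \<Longrightarrow> X t \<in> \<Omega> \<rightarrow>\<^sub>M count_space UNIV"
    and \<delta>: "0 \<le> \<delta>"
  shows "indep_rv \<Omega> (PiM UNIV (\<lambda>_. borel)) (\<lambda>\<omega> l. W (real (Suc l) * \<delta>) \<omega> - W (real l * \<delta>) \<omega>)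
    (PiM UNIV (\<lambda>_. count_space UNIV)) (\<lambda>\<omega> l. X (real l * \<delta>) \<omega>)"
proof -
  interpret prob_space \<Omega> by (rule \<Omega>)
  let ?V = "\<lambda>\<omega>. \<lambda>t\<in>{0..}. W t \<omega>" and ?Y = "\<lambda>\<omega>. \<lambda>t\<in>{0..}. X t \<omega>"
  let ?S = "PiM {0..} (\<lambda>_. borel) :: (real \<Rightarrow> real ^ 'm) measure"
  let ?T = "PiM {0..} (\<lambda>_. count_space UNIV) :: (real \<Rightarrow> 's) measure"
  have rv: "indep_rv \<Omega> ?S ?V ?T ?Y"
    unfolding indep_rv_def
  proof (intro conjI ballI)
    show "?V \<in> \<Omega> \<rightarrow>\<^sub>M ?S" by (rule measurable_restrict) (simp add: W)
    show "?Y \<in> \<Omega> \<rightarrow>\<^sub>M ?T" by (rule measurable_restrict) (simp add: X)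
    fix A B assume "A \<in> sets ?S" "B \<in> sets ?T"
    then have "?V -` A \<inter> space \<Omega> \<in> sets (vimage_algebra (space \<Omega>) ?V ?S)"
      "?Y -` B \<inter> space \<Omega> \<in> sets (vimage_algebra (space \<Omega>) ?Y ?T)"
      by (auto intro: in_vimage_algebra)
    from indep_setD[OF ind[unfolded indep_processes_def] this]
    show "emeasure \<Omega> ((?V -` A \<inter> space \<Omega>) \<inter> (?Y -` B \<inter> space \<Omega>))
        = emeasure \<Omega> (?V -` A \<inter> space \<Omega>) * emeasure \<Omega> (?Y -` B \<inter> space \<Omega>)"
      by (simp only: emeasure_eq_measure ennreal_mult'[OF measure_nonneg])
  qed
  have f: "(\<lambda>w l. w (real (Suc l) * \<delta>) - w (real l * \<delta>)) \<in> ?S \<rightarrow>\<^sub>M PiM UNIV (\<lambda>_::nat. borel)"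
  proof (rule measurable_PiM_single')
    fix l :: nat
    have [measurable]: "(\<lambda>w. w (real (Suc l) * \<delta>)) \<in> borel_measurable ?S" "(\<lambda>w. w (real l * \<delta>)) \<in> borel_measurable ?S"
      using \<delta> by (auto intro!: measurable_component_singleton)
    show "(\<lambda>w. w (real (Suc l) * \<delta>) - w (real l * \<delta>)) \<in> borel_measurable ?S" by measurable
  qed simp
  have g: "(\<lambda>x l. x (real l * \<delta>)) \<in> ?T \<rightarrow>\<^sub>M PiM UNIV (\<lambda>_::nat. count_space UNIV)"
  proof (rule measurable_PiM_single')
    fix l :: nat
    show "(\<lambda>x. x (real l * \<delta>)) \<in> ?T \<rightarrow>\<^sub>M count_space UNIV"
      using \<delta> by (intro measurable_component_singleton) simp
  qed simp
  have eqs: "(\<lambda>l. ?V \<omega> (real (Suc l) * \<delta>) - ?V \<omega> (real l * \<delta>)) = (\<lambda>l. W (real (Suc l) * \<delta>) \<omega> - W (real l * \<delta>) \<omega>)"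
    "(\<lambda>l. ?Y \<omega> (real l * \<delta>)) = (\<lambda>l. X (real l * \<delta>) \<omega>)" for \<omega>
    using \<delta> by (simp_all add: fun_eq_iff)
  show ?thesis using indep_rv_compose[OF rv f g] by (simp only: eqs)
qed

theorem theorem1p4:
  fixes \<tau> L\<^sub>0 :: real
    and \<Omega> :: "'w measure"
    and W :: "real \<Rightarrow> 'w \<Rightarrow> real ^ 'm"
    and Q :: "real ^ 's ^ 's"
    and \<Lambda> :: "'s \<Rightarrow> real \<Rightarrow> 'w \<Rightarrow> 's"
    and b :: "(real \<Rightarrow>\<^sub>C (real ^ 'n)) \<Rightarrow> 's \<Rightarrow> real ^ 'n"
    and \<sigma> :: "'s \<Rightarrow> real ^ 'm ^ 'n"
    and \<alpha> \<beta> :: "'s \<Rightarrow> real"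
  assumes "\<tau> > 0" and "CARD('s) \<ge> 2"
    and "prob_space \<Omega>"
    and "markov_chain_family \<Omega> Q \<Lambda>" and "irreducible_chain \<Omega> \<Lambda>"
    and "brownian_motion \<Omega> W"
    and "\<And>i. indep_processes \<Omega> borel W (count_space UNIV) (\<Lambda> i)"
    and "\<And>i. \<beta> i \<ge> 0"
    and "\<And>i \<xi> \<eta>. \<xi> \<in> seg_space \<tau> \<Longrightarrow> \<eta> \<in> seg_space \<tau> \<Longrightarrow>
          2 * ((apply_bcontfun \<xi> 0 - apply_bcontfun \<eta> 0) \<bullet> (b \<xi> i - b \<eta> i))
            \<le> \<alpha> i * (norm (apply_bcontfun \<xi> 0 - apply_bcontfun \<eta> 0))\<^sup>2 + \<beta> i * (norm (\<xi> - \<eta>))\<^sup>2"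
    and "L\<^sub>0 > 0"
    and "\<And>i \<xi> \<eta>. \<xi> \<in> seg_space \<tau> \<Longrightarrow> \<eta> \<in> seg_space \<tau> \<Longrightarrow>
          norm (b \<xi> i - b \<eta> i) \<le> L\<^sub>0 * norm (\<xi> - \<eta>)"
    and "eta1 \<tau> Q \<alpha> \<beta> > 0"
  shows "\<exists>\<delta>\<^sub>0 a c :: real. 0 < \<delta>\<^sub>0 \<and> \<delta>\<^sub>0 < 1 \<and> 0 < a \<and> 0 < c \<and>
    (\<forall>\<delta>\<in>step_sizes \<tau>. \<delta> < \<delta>\<^sub>0 \<longrightarrow>
       (\<forall>k. \<forall>\<nu>\<^sub>1\<in>prob_measures0 \<tau>. \<forall>\<nu>\<^sub>2\<in>prob_measures0 \<tau>.
          wasserstein (\<nu>\<^sub>1 \<bind> em_law \<Omega> W \<Lambda> \<tau> b \<sigma> \<delta> k) (\<nu>\<^sub>2 \<bind> em_law \<Omega> W \<Lambda> \<tau> b \<sigma> \<delta> k)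
            \<le> ennreal c * (1 + first_moment \<nu>\<^sub>1 + first_moment \<nu>\<^sub>2)
                * ennreal (exp (- a * real k * \<delta>))) \<and>
       (\<exists>\<mu>\<in>prob_measures0 \<tau>.
          (\<forall>k. \<mu> \<bind> em_law \<Omega> W \<Lambda> \<tau> b \<sigma> \<delta> k = \<mu>) \<and>
          (\<forall>\<nu>\<in>prob_measures \<tau>. (\<forall>k. \<nu> \<bind> em_law \<Omega> W \<Lambda> \<tau> b \<sigma> \<delta> k = \<nu>) \<longrightarrow> \<nu> = \<mu>) \<and>
          (\<forall>\<xi>\<in>seg_space \<tau>. \<forall>i k.
             wasserstein (return (state_space \<tau>) (\<xi>, i) \<bind> em_law \<Omega> W \<Lambda> \<tau> b \<sigma> \<delta> k) (\<mu> \<bind> em_law \<Omega> W \<Lambda> \<tau> b \<sigma> \<delta> k)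
               \<le> ennreal c * (1 + ennreal (norm \<xi>) + first_moment \<mu>)
                   * ennreal (exp (- a * real k * \<delta>)))))"
proof -
  note \<tau> = assms(1) and prob = assms(3) and chain = assms(4) and irr = assms(5) and bm = assms(6)
    and ind = assms(7) and \<beta> = assms(8) and mono = assms(9) and L = assms(10) and lip = assms(11) and eta = assms(12)
  interpret \<Omega>: prob_space \<Omega> by (rule prob)
  obtain p where Q: "q_matrix Q"
    and deriv: "\<And>i j. ((\<lambda>h. (p h i j - (if i = j then 1 else 0)) / h) \<longlongrightarrow> Q $ i $ j) (at_right 0)"
    and mc: "\<And>i. markov_chain \<Omega> p (\<Lambda> i)" "\<And>i. AE \<omega> in \<Omega>. \<Lambda> i 0 \<omega> = i"
    using chain unfolding markov_chain_family_def by blast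
  interpret ch: chain_family \<Omega> p \<Lambda> by unfold_locales (rule mc)+
  define a where "a = Min (range \<alpha>)"
  have a: "a < 0" "\<And>i. a \<le> \<alpha> i" using spectral_weights(1)[OF Q eta \<beta>] by (auto simp: a_def)
  obtain u where u: "\<And>i. 0 < u i"
    and neg: "\<And>i. (\<Sum>j\<in>UNIV. Q $ i $ j * u j) + (\<alpha> i + exp (- a * \<tau>) * \<beta> i) / 2 * u i < 0"
    using spectral_weights(2)[OF Q eta \<beta>] unfolding a_def by blast
  obtain c0 d where c0: "0 < c0" and d: "0 < d"
    and decay: "\<And>h i. 0 < h \<Longrightarrow> h < d \<Longrightarrow>
      exp (h / 2 * (\<alpha> i + (\<beta> i + h * L\<^sub>0\<^sup>2) * exp (- a * \<tau> - a * h))) * (\<Sum>j\<in>UNIV. p h i j * u j) \<le> exp (- c0 * h) * u i"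
    using weights_decay[of p Q u \<alpha> a \<tau> \<beta> L\<^sub>0, OF deriv neg u] by blast
  have "0 < p t i i" if "0 \<le> t" for i t
    using deriv[of i i] by (intro ch.p_diag_pos[OF _ that]) simp
  then obtain R where R: "0 < R" "\<And>i j. 0 < p (real R * \<tau>) i j"
    using ch.eventually_positive[OF irr _ \<tau>] by blast
  define T where "T = real R * \<tau>"
  have T: "0 < T" using R \<tau> by (simp add: T_def)
  define e0 where "e0 = Min (range (\<lambda>(i, j). p T i j))"
  have e0: "0 < e0" "\<And>i j. e0 \<le> p T i j"
  proof -
    show "0 < e0" unfolding e0_def using R(2) by (subst Min_gr_iff) (auto simp: T_def)
    fix i j
    show "e0 \<le> p T i j" unfolding e0_def by (rule Min_le) (auto intro: rev_image_eqI[of "(i, j)"])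
  qed
  have e0_le: "e0 \<le> 1"
  proof -
    fix i :: 's
    have "e0 \<le> p T i i" by (rule e0)
    also have "\<dots> \<le> (\<Sum>j\<in>UNIV. p T i j)" using T by (intro member_le_sum ch.p_nonneg) auto
    also have "\<dots> = 1" using T by (intro ch.p_sum) simp
    finally show ?thesis .
  qed
  define e where "e = e0\<^sup>2"
  have e: "0 < e" "e \<le> 1" using e0(1) e0_le by (auto simp: e_def power_le_one)
  obtain s where s: "\<And>i z. norm (\<sigma> i *v z) \<le> s * norm z" "0 \<le> s" using ex_diffusion_bound[of \<sigma>] by blast
  obtain K where K: "\<And>i. norm (b 0 i) \<le> L\<^sub>0 * K" "0 \<le> K" using ex_drift_bound[OF L, of "b 0"] by blast
  define U where "U = Max (range u)"
  have U: "u i \<le> U" for i unfolding U_def by (rule Max_ge) auto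
  define v where "v = Min (range u)"
  have v: "0 < v" "\<And>i. v \<le> u i" using u by (auto simp: v_def Min_gr_iff)
  \<comment> \<open>The constants below are those of \<open>window_contraction\<close>, written without the step size.\<close>
  define B where "B = 4 * (U * (exp (L\<^sub>0 * T) * (K + 1 + s\<^sup>2 * real CARD('m) * T))) / e"
  define q where "q = max (exp (- c0 * T)) (1 - e / 2)"
  define C where "C = (1 / (v * exp (a * \<tau> / 2)) + 1 / B) * (2 / q) * (U + B)"
  define A where "A = - ln q / T"
  have q: "0 < q" "q < 1" using c0 T e by (auto simp: q_def less_max_iff_disj)
  have A: "0 < A" unfolding A_def using q T by (intro divide_pos_pos) simp_all
  have U0: "0 < U" using u U by (meson less_le_trans)
  have B: "0 < B" using U0 K(2) T e by (simp add: B_def add_pos_nonneg)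
  have C: "0 < C" using v(1) B q U0 by (auto simp: C_def intro!: mult_pos_pos add_pos_pos divide_pos_pos)
  define \<delta>0 where "\<delta>0 = min d (1 / 2)"
  have main: "(\<forall>k. \<forall>\<nu>\<^sub>1\<in>prob_measures0 \<tau>. \<forall>\<nu>\<^sub>2\<in>prob_measures0 \<tau>.
          wasserstein (\<nu>\<^sub>1 \<bind> em_law \<Omega> W \<Lambda> \<tau> b \<sigma> \<delta> k) (\<nu>\<^sub>2 \<bind> em_law \<Omega> W \<Lambda> \<tau> b \<sigma> \<delta> k)
            \<le> ennreal C * (1 + first_moment \<nu>\<^sub>1 + first_moment \<nu>\<^sub>2)
                * ennreal (exp (- A * real k * \<delta>))) \<and>
       (\<exists>\<mu>\<in>prob_measures0 \<tau>.
          (\<forall>k. \<mu> \<bind> em_law \<Omega> W \<Lambda> \<tau> b \<sigma> \<delta> k = \<mu>) \<and>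
          (\<forall>\<nu>\<in>prob_measures \<tau>. (\<forall>k. \<nu> \<bind> em_law \<Omega> W \<Lambda> \<tau> b \<sigma> \<delta> k = \<nu>) \<longrightarrow> \<nu> = \<mu>) \<and>
          (\<forall>\<xi>\<in>seg_space \<tau>. \<forall>i k.
             wasserstein (return (state_space \<tau>) (\<xi>, i) \<bind> em_law \<Omega> W \<Lambda> \<tau> b \<sigma> \<delta> k) (\<mu> \<bind> em_law \<Omega> W \<Lambda> \<tau> b \<sigma> \<delta> k)
               \<le> ennreal C * (1 + ennreal (norm \<xi>) + first_moment \<mu>)
                   * ennreal (exp (- A * real k * \<delta>))))"
    if \<delta>: "\<delta> \<in> step_sizes \<tau>" "\<delta> < \<delta>0" for \<delta>
  proof -
    obtain M :: nat where M: "\<tau> < real M" "\<delta> = \<tau> / real M" using \<delta>(1) by (auto simp: step_sizes_def)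
    interpret grid: delay_grid \<tau> \<delta> M by unfold_locales (use \<tau> M in auto)
    note \<delta>0 = grid.step_pos
    have \<delta>d: "\<delta> < d" using \<delta>(2) by (simp add: \<delta>0_def)
    interpret bw: brownian \<Omega> W \<delta> by unfold_locales (rule bm \<delta>0)+
    define P where "P = ch.grid_kernel \<delta>"
    have P: "pmf (P i) j = p \<delta> i j" for i j using \<delta>0 by (simp add: P_def ch.pmf_grid_kernel)
    define r where "r = exp (a * \<delta> / 2)"
    define cc where "cc i = exp (\<delta> / 2 * (\<alpha> i + (\<beta> i + \<delta> * L\<^sub>0\<^sup>2) * exp (- a * \<tau> - a * \<delta>)))" for i
    interpret em: em_chain \<tau> \<delta> M b \<sigma> L\<^sub>0 P bw.increment_law
    proof (intro em_chain.intro em_chain_axioms.intro)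
      show "delay_grid \<tau> \<delta> M" by (rule grid.delay_grid_axioms)
      show "0 < L\<^sub>0" by (rule L)
      show "norm (b \<xi> i - b \<eta> i) \<le> L\<^sub>0 * norm (\<xi> - \<eta>)" if "\<xi> \<in> seg_space \<tau>" "\<eta> \<in> seg_space \<tau>" for i \<xi> \<eta>
        by (rule lip[OF that])
      show "prob_space bw.increment_law" "sets bw.increment_law = sets borel"
        unfolding bw.increment_law_def by (auto intro: \<Omega>.prob_space_distr)
      show "integrable bw.increment_law (\<lambda>z. c \<bullet> z)" "(\<integral>z. c \<bullet> z \<partial>bw.increment_law) = 0" for c
        by (rule bw.increment_linear)+
      show "integrable bw.increment_law (\<lambda>z. (norm z)\<^sup>2)" by (rule bw.increment_square)
      show "(\<integral>z. (norm z)\<^sup>2 \<partial>bw.increment_law) \<le> real CARD('m) * \<delta>" by (simp add: bw.increment_square)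
    qed
    interpret ly: em_lyapunov \<tau> \<delta> M b \<sigma> L\<^sub>0 P bw.increment_law r s K U "exp (- c0 * \<delta>)" u cc
    proof
      show "0 < r" "r \<le> 1" using a(1) \<delta>0 by (auto simp: r_def mult_nonpos_nonneg)
      show "norm (\<sigma> i *v z) \<le> s * norm z" "0 \<le> s" for i z using s by auto
      show "norm (b 0 i) \<le> L\<^sub>0 * K" "0 \<le> K" for i using K by auto
      show "wdist M r (window_step \<tau> \<delta> M b \<sigma> x i z) (window_step \<tau> \<delta> M b \<sigma> y i z) \<le> cc i * wdist M r x y"
        for x y i z
        unfolding r_def cc_def
        by (rule grid.wdist_window_step[OF mono lip \<beta>]) (use a in auto)
      show "0 < cc i" for i by (simp add: cc_def)
      show "0 < u i" "u i \<le> U" for i using u U by auto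
      show "0 < exp (- c0 * \<delta>)" "exp (- c0 * \<delta>) \<le> 1" using c0 \<delta>0 by auto
      show "cc i * (\<Sum>j\<in>UNIV. pmf (P i) j * u j) \<le> exp (- c0 * \<delta>) * u i" for i
        using decay[OF \<delta>0 \<delta>d, of i] by (simp add: cc_def P)
    qed
    define n where "n = R * M"
    have n: "0 < n" "real n * \<delta> = T" using R(1) grid.M_pos grid.M_step by (simp_all add: n_def T_def mult.assoc)
    have mix: "em.pair_expect n (\<lambda>z. of_bool (apart z)) z \<le> ennreal (1 - e)" for z
      unfolding e_def
    proof (rule em.unequal_states_le[where p = "\<lambda>k. p (real k * \<delta>)"])
      show "p (real 0 * \<delta>) i j = of_bool (i = j)" for i j by (simp add: ch.p_0)
      show "p (real (Suc k) * \<delta>) i j = (\<Sum>l\<in>UNIV. pmf (P i) l * p (real k * \<delta>) l j)" for k i j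
        using ch.grid_power[of \<delta> k i j] \<delta>0 by (simp add: P)
      show "e0 \<le> p (real n * \<delta>) i j" for i j using e0(2) by (simp add: n)
      show "0 \<le> e0" using e0(1) by simp
    qed
    have rho_n: "exp (- c0 * \<delta>) ^ n = exp (- c0 * T)"
      by (simp add: exp_of_nat_mult[symmetric] n(2)[symmetric] mult_ac)
    have rM: "r ^ M = exp (a * \<tau> / 2)"
      by (simp add: r_def exp_of_nat_mult[symmetric] grid.M_step[symmetric] mult_ac)
    have mb: "ly.moment_bound T = U * (exp (L\<^sub>0 * T) * (K + 1 + s\<^sup>2 * real CARD('m) * T))"
      by (simp add: ly.moment_bound_def)
    note contr = ly.window_contraction(1)[OF n e mix v, unfolded rho_n rM mb, folded B_def q_def, folded C_def]
    interpret er: em_ergodic \<tau> \<delta> M b \<sigma> L\<^sub>0 P bw.increment_law C "q powr (\<delta> / T)"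
    proof
      show "0 \<le> C" using C by simp
      show "0 < q powr (\<delta> / T)" using q by simp
      have "\<delta> / T * ln q < 0" using q T \<delta>0 by (intro mult_pos_neg) simp_all
      then show "q powr (\<delta> / T) < 1" using q by (simp add: powr_def)
    qed (rule contr)
    have rate: "(q powr (\<delta> / T)) ^ k = exp (- A * real k * \<delta>)" for k
      using q by (simp add: powr_def A_def exp_of_nat_mult[symmetric] mult_ac)
    have law: "em_law \<Omega> W \<Lambda> \<tau> b \<sigma> \<delta> k (\<xi>, i) = er.law k (\<xi>, i)" for k \<xi> i
    proof -
      interpret dr: em_driven \<tau> \<delta> M b \<sigma> L\<^sub>0 P bw.increment_law \<Omega> bw.grid_increment "\<lambda>l. \<Lambda> i (real l * \<delta>)" i
      proof
        show "distr \<Omega> borel (bw.grid_increment l) = bw.increment_law" for l by (rule bw.grid_increment_law)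
        show "indep_rv \<Omega> (PiM {..<k} (\<lambda>_. borel)) (\<lambda>\<omega>. \<lambda>l\<in>{..<k}. bw.grid_increment l \<omega>) borel (bw.grid_increment k)" for k
          by (rule bw.increments_indep_past)
        show "\<Lambda> i (real l * \<delta>) \<in> \<Omega> \<rightarrow>\<^sub>M count_space UNIV" for l using \<delta>0 by (intro ch.chain_meas) simp
        show "AE \<omega> in \<Omega>. \<Lambda> i (real 0 * \<delta>) \<omega> = i" using mc(2)[of i] by simp
        show "\<P>(\<omega> in \<Omega>. \<forall>l\<le>Suc k. \<Lambda> i (real l * \<delta>) \<omega> = f l)
            = \<P>(\<omega> in \<Omega>. \<forall>l\<le>k. \<Lambda> i (real l * \<delta>) \<omega> = f l) * pmf (P (f k)) (f (Suc k))" for k f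
          unfolding P by (rule ch.path_prob[OF \<delta>0])
        show "indep_rv \<Omega> (PiM UNIV (\<lambda>_. borel)) (\<lambda>\<omega> l. bw.grid_increment l \<omega>)
            (PiM UNIV (\<lambda>_. count_space UNIV)) (\<lambda>\<omega> l. \<Lambda> i (real l * \<delta>) \<omega>)"
          unfolding bw.grid_increment_def
          by (rule indep_processes_grid[OF prob ind]) (use \<delta>0 in \<open>auto intro: bw.measurable_W ch.chain_meas\<close>)
      qed (rule bw.measurable_grid_increment)
      have win: "em_window \<tau> \<delta> M b \<sigma> (\<lambda>t. W t \<omega>) (\<lambda>t. \<Lambda> i t \<omega>) \<xi> k
          = dr.window_path (grid_window \<delta> M \<xi>) (\<lambda>l. bw.grid_increment l \<omega>) (\<lambda>l. \<Lambda> i (real l * \<delta>) \<omega>) k" for \<omega>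
      proof (induction k)
        case 0
        show ?case by (simp add: grid.em_window_0)
      next
        case (Suc k)
        then show ?case by (simp only: grid.em_window_Suc dr.window_path.simps bw.grid_increment_def)
      qed
      have "em_law \<Omega> W \<Lambda> \<tau> b \<sigma> \<delta> k (\<xi>, i) = distr \<Omega> (state_space \<tau>) (\<lambda>\<omega>. er.to_segment
          (dr.window_path (grid_window \<delta> M \<xi>) (\<lambda>l. bw.grid_increment l \<omega>) (\<lambda>l. \<Lambda> i (real l * \<delta>) \<omega>) k, \<Lambda> i (real k * \<delta>) \<omega>))"
        by (simp add: em_law_def grid.em_segment_em_process win er.to_segment_def)
      also have "\<dots> = er.law k (\<xi>, i)"
        unfolding er.law_def by (subst dr.distr_window_path) (simp_all add: er.to_window_def er.measurable_to_segment)
      finally show ?thesis .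
    qed
    have bind: "\<nu> \<bind> em_law \<Omega> W \<Lambda> \<tau> b \<sigma> \<delta> k = \<nu> \<bind> er.law k" for \<nu> k
      by (rule bind_cong) (auto simp: law)
    have contraction: "wasserstein (\<nu>\<^sub>1 \<bind> em_law \<Omega> W \<Lambda> \<tau> b \<sigma> \<delta> k) (\<nu>\<^sub>2 \<bind> em_law \<Omega> W \<Lambda> \<tau> b \<sigma> \<delta> k)
        \<le> ennreal C * (1 + first_moment \<nu>\<^sub>1 + first_moment \<nu>\<^sub>2) * ennreal (exp (- A * real k * \<delta>))"
      if "\<nu>\<^sub>1 \<in> prob_measures \<tau>" "\<nu>\<^sub>2 \<in> prob_measures \<tau>" for \<nu>\<^sub>1 \<nu>\<^sub>2 k
      using er.wasserstein_law_le[OF that, of k] by (simp only: bind rate)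
    show ?thesis
    proof (intro conjI allI ballI bexI[of _ er.inv_measure] impI)
      fix k and \<nu>\<^sub>1 \<nu>\<^sub>2 :: "((real \<Rightarrow>\<^sub>C (real ^ 'n)) \<times> 's) measure"
      assume "\<nu>\<^sub>1 \<in> prob_measures0 \<tau>" "\<nu>\<^sub>2 \<in> prob_measures0 \<tau>"
      then show "wasserstein (\<nu>\<^sub>1 \<bind> em_law \<Omega> W \<Lambda> \<tau> b \<sigma> \<delta> k) (\<nu>\<^sub>2 \<bind> em_law \<Omega> W \<Lambda> \<tau> b \<sigma> \<delta> k)
        \<le> ennreal C * (1 + first_moment \<nu>\<^sub>1 + first_moment \<nu>\<^sub>2) * ennreal (exp (- A * real k * \<delta>))"
        by (intro contraction) (simp_all add: prob_measures0_def)
    next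
      fix k show "er.inv_measure \<bind> em_law \<Omega> W \<Lambda> \<tau> b \<sigma> \<delta> k = er.inv_measure"
        unfolding bind by (rule er.inv_measure_invariant)
    next
      fix \<nu> :: "((real \<Rightarrow>\<^sub>C (real ^ 'n)) \<times> 's) measure"
      assume "\<nu> \<in> prob_measures \<tau>" "\<forall>k. \<nu> \<bind> em_law \<Omega> W \<Lambda> \<tau> b \<sigma> \<delta> k = \<nu>"
      then show "\<nu> = er.inv_measure" by (intro er.invariant_unique) (simp_all add: bind)
    next
      fix \<xi> :: "real \<Rightarrow>\<^sub>C (real ^ 'n)" and i :: 's and k
      assume \<xi>: "\<xi> \<in> seg_space \<tau>"
      have mem: "(\<xi>, i) \<in> space (state_space \<tau>)" using \<xi> by (simp add: er.space_state_space)
      have ret: "return (state_space \<tau>) (\<xi>, i) \<in> prob_measures \<tau>"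
        using prob_space_return[OF mem] by (simp add: prob_measures_def)
      have "first_moment (return (state_space \<tau>) (\<xi>, i)) = ennreal (norm \<xi>)"
        unfolding er.nn_integral_first_moment[OF ret]
        using er.measurable_fst_state_space by (subst nn_integral_return[OF mem]) simp_all
      then show "wasserstein (return (state_space \<tau>) (\<xi>, i) \<bind> em_law \<Omega> W \<Lambda> \<tau> b \<sigma> \<delta> k) (er.inv_measure \<bind> em_law \<Omega> W \<Lambda> \<tau> b \<sigma> \<delta> k)
          \<le> ennreal C * (1 + ennreal (norm \<xi>) + first_moment er.inv_measure) * ennreal (exp (- A * real k * \<delta>))"
        using contraction[OF ret er.inv_measure_prob, of k] by simp
    next
      show "er.inv_measure \<in> prob_measures0 \<tau>" by (rule er.inv_measure_moment)
    qed
  qed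
  have "0 < \<delta>0" "\<delta>0 < 1" using d by (auto simp: \<delta>0_def)
  with A C show ?thesis
    by (intro exI[of _ \<delta>0] exI[of _ A] exI[of _ C] conjI) (assumption | intro ballI impI main)+
qed

end
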